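(* Let $p$ be a prime and $m\ge 0$ an integer. For $n\ge 1$ let $\mu$ be the normalized Haar measure on $\mathrm{Mat}_{n\times(n+m)}(\mathbb{Z}_p)$ (total mass $1$). Then for every finite abelian $p$-group $G$, $$\mu\left(\{M\in \mathrm{Mat}_{n\times(n+m)}(\mathbb{Z}_p): \mathrm{coker}\, M\simeq G\}\right)=w_m(G)+\lambda_m(G)\,p^{-n}+O(p^{-2n}),$$ where $$w_m(G)=\frac{\eta_\infty(p)/\eta_m(p)}{|G|^m\,|\mathrm{Aut}(G)|},\qquad \lambda_m(G)=\frac{w_m(G)\left(1+p^{-m}-p^{\mathrm{rk}_p(G)}\right)}{p-1}.$$ The implicit constant is at most $\left(\eta_m(p)^2/\eta_\infty(p)^2-1\right)^{1/2}$; that is, for all $n\ge1$ the $O(p^{-2n})$ term is bounded in absolute value by $\left(\eta_m(p)^2/\eta_\infty(p)^2-1\right)^{1/2}p^{-2n}$.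
   Context: $\mathbb{Z}_p$ is the ring of $p$-adic integers. For $M\in\mathrm{Mat}_{n\times(n+m)}(\mathbb{Z}_p)$, $\mathrm{coker}\,M=\mathbb{Z}_p^n/M\mathbb{Z}_p^{n+m}$ (the quotient by the submodule generated by the columns of $M$). For $i\in\{0,1,2,\dots,\infty\}$, $\eta_i(p)=\prod_{j=1}^{i}(1-p^{-j})$ (so $\eta_0(p)=1$). The $p$-rank of $G$ is $\mathrm{rk}_p(G)=\dim_{\mathbb{F}_p}G/pG$. *)

theory Defs
  imports
    "HOL-Probability.Probability"
    "HOL-Algebra.Bij"
    "HOL-Algebra.Product_Groups"
    "HOL-Number_Theory.Residues"
    "Jordan_Normal_Form.Missing_VectorSpace"
begin

text \<open>
  $\mathbb{Z}_p$ is the inverse limit of the rings $\mathbb{Z}/p^k$: an element is the sequence of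
  its canonical residues, \<open>x k \<in> {0..<p ^ k}\<close>, compatible under reduction.
\<close>

definition Zp_carrier :: "nat \<Rightarrow> (nat \<Rightarrow> int) set" where
  "Zp_carrier p =
     {x. (\<forall>k. x k \<in> {0..<int p ^ k}) \<and> (\<forall>k. x (Suc k) mod int p ^ k = x k)}"

definition Zp :: "nat \<Rightarrow> (nat \<Rightarrow> int) ring" where
  "Zp p = \<lparr>carrier = Zp_carrier p,
           monoid.mult = (\<lambda>x y k. (x k * y k) mod int p ^ k),
           one = (\<lambda>k. 1 mod int p ^ k),
           ring.zero = (\<lambda>k. 0),
           ring.add = (\<lambda>x y k. (x k + y k) mod int p ^ k)\<rparr>"

text \<open>
  The $p$-adic topology is the inverse limit topology, i.e. the one induced from the product of the
  finite discrete spaces $\mathbb{Z}/p^k$.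
\<close>

definition Zp_topology :: "nat \<Rightarrow> (nat \<Rightarrow> int) topology" where
  "Zp_topology p =
     subtopology (product_topology (\<lambda>k. discrete_topology {0..<int p ^ k}) UNIV) (Zp_carrier p)"

definition Zp_vec :: "nat \<Rightarrow> nat \<Rightarrow> (nat \<Rightarrow> nat \<Rightarrow> int) monoid" where
  "Zp_vec p n = product_group {..<n} (\<lambda>_. add_monoid (Zp p))"

text \<open>
  \<open>Zp_vec\<close> and \<open>Zp_mat\<close> are written multiplicatively in HOL-Algebra style, with entrywise
  addition as operation. The entry of \<open>M\<close> in row \<open>i\<close> and column \<open>j\<close> is \<open>M (i, j)\<close>, counting from 0.
\<close>

definition Zp_mat :: "nat \<Rightarrow> nat \<Rightarrow> nat \<Rightarrow> (nat \<times> nat \<Rightarrow> nat \<Rightarrow> int) monoid" where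
  "Zp_mat p r c = product_group ({..<r} \<times> {..<c}) (\<lambda>_. add_monoid (Zp p))"

definition Zp_mat_topology :: "nat \<Rightarrow> nat \<Rightarrow> nat \<Rightarrow> (nat \<times> nat \<Rightarrow> nat \<Rightarrow> int) topology" where
  "Zp_mat_topology p r c = product_topology (\<lambda>_. Zp_topology p) ({..<r} \<times> {..<c})"

definition Zp_mat_vec ::
    "nat \<Rightarrow> nat \<Rightarrow> nat \<Rightarrow> (nat \<times> nat \<Rightarrow> nat \<Rightarrow> int) \<Rightarrow> (nat \<Rightarrow> nat \<Rightarrow> int) \<Rightarrow> (nat \<Rightarrow> nat \<Rightarrow> int)" where
  "Zp_mat_vec p r c M v =
     (\<lambda>i\<in>{..<r}. \<Oplus>\<^bsub>Zp p\<^esub>j\<in>{..<c}. M (i, j) \<otimes>\<^bsub>Zp p\<^esub> v j)"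

definition coker ::
    "nat \<Rightarrow> nat \<Rightarrow> nat \<Rightarrow> (nat \<times> nat \<Rightarrow> nat \<Rightarrow> int) \<Rightarrow> (nat \<Rightarrow> nat \<Rightarrow> int) set monoid" where
  "coker p r c M = Zp_vec p r Mod (Zp_mat_vec p r c M ` carrier (Zp_vec p c))"

text \<open>
  \<open>G\<close> is meant to be a compact metrizable topological group with topology \<open>T\<close>. On such a group every
  finite Borel measure is automatically regular, so regularity is not part of the definition.
\<close>

definition normalized_haar_measure ::
    "('g, 'b) monoid_scheme \<Rightarrow> 'g topology \<Rightarrow> 'g measure \<Rightarrow> bool" where
  "normalized_haar_measure G T \<mu> \<longleftrightarrow>
     prob_space \<mu> \<and>
     sets \<mu> = sets (sigma (topspace T) {U. openin T U}) \<and>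
     (\<forall>g\<in>carrier G. \<forall>A\<in>sets \<mu>. emeasure \<mu> ((\<lambda>x. g \<otimes>\<^bsub>G\<^esub> x) ` A) = emeasure \<mu> A)"

definition finite_abelian_p_group :: "nat \<Rightarrow> ('a, 'b) monoid_scheme \<Rightarrow> bool" where
  "finite_abelian_p_group p G \<longleftrightarrow>
     comm_group G \<and> finite (carrier G) \<and> (\<exists>k. order G = p ^ k)"

text \<open>
  $G/pG$ as a vector space over $\mathbb{F}_p$; as \<open>G\<close> is written multiplicatively, $pG$ is the set of
  \<open>p\<close>-th powers. The fields \<open>monoid.mult\<close> and \<open>one\<close> of the module record play no role for a module.
\<close>

definition mod_p_space :: "nat \<Rightarrow> ('a, 'b) monoid_scheme \<Rightarrow> (int, 'a set) module" where
  "mod_p_space p G =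
     (let Q = G Mod ((\<lambda>x. x [^]\<^bsub>G\<^esub> p) ` carrier G)
      in \<lparr>carrier = carrier Q, monoid.mult = undefined, one = undefined,
          ring.zero = \<one>\<^bsub>Q\<^esub>, ring.add = monoid.mult Q, smult = (\<lambda>k C. C [^]\<^bsub>Q\<^esub> k)\<rparr>)"

definition p_rank :: "nat \<Rightarrow> ('a, 'b) monoid_scheme \<Rightarrow> nat" where
  "p_rank p G = vectorspace.dim (residue_ring (int p)) (mod_p_space p G)"

definition eta :: "nat \<Rightarrow> enat \<Rightarrow> real" where
  "eta p i = (case i of enat k \<Rightarrow> \<Prod>j=1..k. 1 - 1 / real p ^ j
                      | \<infinity> \<Rightarrow> \<Prod>j. 1 - 1 / real p ^ Suc j)"

definition w_coeff :: "nat \<Rightarrow> nat \<Rightarrow> ('a, 'b) monoid_scheme \<Rightarrow> real" where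
  "w_coeff p m G = (eta p \<infinity> / eta p (enat m)) / (real (order G) ^ m * real (order (AutoGroup G)))"

definition lambda_coeff :: "nat \<Rightarrow> nat \<Rightarrow> ('a, 'b) monoid_scheme \<Rightarrow> real" where
  "lambda_coeff p m G = w_coeff p m G * (1 + 1 / real p ^ m - real p ^ p_rank p G) / (real p - 1)"

end

theory Submission
  imports Defs
begin

text \<open>
  Write $|G| = p^k$, let $r$ be the rank of $G$ and $A = (\mathbb{Z}/p^{k+1})^n$. By Nakayama,
  whether the cokernel of $M$ is isomorphic to $G$ depends only on $M$ modulo $p^{k+1}$, so the
  measure is a proportion of tuples of $n+m$ vectors in $A$. The subgroups $N$ with $A/N \cong G$ are
  the kernels of the surjections $A \to G$ and correspond to $\mathrm{Aut}(G)$-orbits of such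
  surjections; each $N$ contains the $p$-torsion of $A$, hence has rank $n$. Counting generating
  tuples of $G$ and of $N$ gives the exact value
  $$\frac{1}{|G|^m |\mathrm{Aut}(G)|} \prod_{i<r} (1 - p^{i-n}) \, \frac{\eta_{n+m}(p)}{\eta_m(p)},$$
  which is then expanded in $p^{-n}$. The remainder is controlled by a lower bound for
  $|G|^m |\mathrm{Aut}(G)|$, which comes from the case $n = r$: there $M$ must vanish modulo $p$, so
  the exact value is at most $p^{-r(r+m)}$.
\<close>

section \<open>Counting generating tuples\<close>

text \<open>The exponent k+1 serves twice. Every N with A/N \<cong> G contains p^k A, and modulo
  p^(k+1) this is exactly the p-torsion of A; modulo p^k the rank of N could drop below n, as it
  does for G cyclic of order p^k. On the p-adic side, with L = Z_p^n and I the image of M, the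
  inclusion of p^k L in I + p^(k+1) L is precisely what Nakayama turns into the inclusion of p^k L
  in I.

  The obstacle in the expansion is uniformity in G, since the second-order coefficient grows with r.
  Dividing the exact value by w_m(G) leaves a product over i < r times
  \<eta>_{n+m}(p)/\<eta>_\<infinity>(p). For r \<ge> 1 the second-order remainder of this quotient
  is at most 2 |GL_r(F_p)| p^(-2n-1), while the lower bound on |G|^m |Aut(G)| gives w_m(G) \<le>
  1/(|GL_r(F_p)| p^(rm)). The two factors |GL_r(F_p)| cancel and leave 2 p^(-m-1) p^(-2n). The
  constant of the theorem dominates 2 p^(-m-1), which already follows from the first factor of
  \<eta>_\<infinity>(p)/\<eta>_m(p). For r = 0 nothing cancels, and the power of p comes from the
  remainder itself.\<close>

abbreviation pth_powers :: "nat \<Rightarrow> ('a, 'b) monoid_scheme \<Rightarrow> 'a set" where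
  "pth_powers p G \<equiv> (\<lambda>x. x [^]\<^bsub>G\<^esub> p) ` carrier G"

lemma (in group) generate_generate_Un:
  assumes "S \<subseteq> carrier G" "T \<subseteq> carrier G"
  shows "generate G (generate G S \<union> T) = generate G (S \<union> T)"
proof
  show "generate G (generate G S \<union> T) \<subseteq> generate G (S \<union> T)"
  proof (rule generate_subgroup_incl)
    show "generate G S \<union> T \<subseteq> generate G (S \<union> T)"
      using mono_generate[of S "S \<union> T"] generate.incl[of _ "S \<union> T" G] by auto
    show "subgroup (generate G (S \<union> T)) G"
      using assms by (intro generate_is_subgroup) auto
  qed
  show "generate G (S \<union> T) \<subseteq> generate G (generate G S \<union> T)"
    by (rule mono_generate) (auto intro: generate.incl)
qed

lemma (in group) generate_subgroup_eq:
  assumes "subgroup H G" shows "generate G H = H"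
  using generate_subgroup_incl[OF order_refl assms] generate.incl[of _ H G] by blast

lemma (in group) subgroup_mem_of_coprime_pows:
  assumes "subgroup C G" "h \<in> carrier G" "h [^] (a::nat) \<in> C" "h [^] (b::nat) \<in> C" "coprime a b"
  shows "h \<in> C"
proof -
  obtain u v :: int where uv: "u * int a + v * int b = 1"
    using assms(5) bezout_int[of "int a" "int b"] by auto
  have "h = h [^] (u * int a + v * int b)" using assms(2) uv by simp
  also have "\<dots> = (h [^] a) [^] u \<otimes> (h [^] b) [^] v"
    using assms(2) by (simp add: int_pow_mult int_pow_pow mult.commute flip: int_pow_int)
  also have "\<dots> \<in> C"
    using assms by (intro subgroup.m_closed subgroup_int_pow_closed) auto
  finally show ?thesis .
qed

text \<open>G/C is elementary abelian because C contains all p-th powers. Hence h has order exactly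
  p modulo C, and the products c h^i with i < p are distinct and exhaust the enlarged
  subgroup.\<close>

lemma (in comm_group) card_generate_insert:
  assumes p: "Factorial_Ring.prime p" and fin: "finite (carrier G)" and C: "subgroup C G"
    and P: "pth_powers p G \<subseteq> C" and h: "h \<in> carrier G" "h \<notin> C"
  shows "card (generate G (insert h C)) = p * card C"
proof -
  have Csub: "C \<subseteq> carrier G" by (rule subgroup.subset[OF C])
  define f where "f = (\<lambda>(c, i::nat). c \<otimes> h [^] i)"
  let ?D = "f ` (C \<times> {..<p})"
  have p0: "p > 0" using p by (simp add: prime_gt_0_nat)
  have hp: "h [^] p \<in> C" using P h by auto
  have red: "c \<otimes> h [^] (i::nat) \<in> ?D" if "c \<in> C" for c i
  proof -
    have cC: "c \<in> carrier G" using that Csub by auto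
    have "h [^] i = h [^] (p * (i div p) + i mod p)" by simp
    also have "\<dots> = (h [^] p) [^] (i div p) \<otimes> h [^] (i mod p)"
      using h by (simp add: nat_pow_mult nat_pow_pow)
    finally have "c \<otimes> h [^] i = (c \<otimes> (h [^] p) [^] (i div p)) \<otimes> h [^] (i mod p)"
      using h cC by (simp add: m_assoc)
    moreover have "c \<otimes> (h [^] p) [^] (i div p) \<in> C"
    proof -
      have "(h [^] p) [^] (int (i div p)) \<in> C" by (rule subgroup_int_pow_closed[OF C hp])
      then have "(h [^] p) [^] (i div p) \<in> C" by (simp only: int_pow_int)
      then show ?thesis using subgroup.m_closed[OF C that] by simp
    qed
    moreover have "i mod p < p" using p0 by simp
    ultimately show ?thesis unfolding f_def by (intro image_eqI[where x = "(c \<otimes> (h [^] p) [^] (i div p), i mod p)"]) auto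
  qed
  have D: "subgroup ?D G"
  proof (rule subgroupI)
    show "?D \<subseteq> carrier G" using Csub h by (auto simp: f_def)
    show "?D \<noteq> {}" using subgroup.one_closed[OF C] p0 by auto
    show "inv a \<in> ?D" if a: "a \<in> ?D" for a
    proof -
      obtain c i where ci: "c \<in> C" "i < p" "a = c \<otimes> h [^] i" using a unfolding f_def by fastforce
      have cc: "c \<in> carrier G" using ci Csub by auto
      \<comment> \<open>The inverse of h^i is written as h^(-p) h^(p-i): the first factor is
        absorbed into C and the exponent stays a natural number, as \<open>red\<close>
        requires.\<close>
      have "h [^] i \<otimes> (inv (h [^] p) \<otimes> h [^] (p - i)) = \<one>"
      proof -
        have "h [^] i \<otimes> h [^] (p - i) = h [^] p" using h ci by (simp add: nat_pow_mult)
        moreover have "h [^] i \<otimes> (inv (h [^] p) \<otimes> h [^] (p - i)) = inv (h [^] p) \<otimes> (h [^] i \<otimes> h [^] (p - i))"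
          using h by (intro m_lcomm) auto
        ultimately show ?thesis using h by simp
      qed
      then have "inv (h [^] i) = inv (h [^] p) \<otimes> h [^] (p - i)"
        using h by (intro inv_equality) (simp_all add: m_comm)
      then have "inv a = (inv c \<otimes> inv (h [^] p)) \<otimes> h [^] (p - i)"
        using ci cc h by (simp add: inv_mult m_assoc)
      moreover have "inv c \<otimes> inv (h [^] p) \<in> C"
        by (intro subgroup.m_closed[OF C] subgroup.m_inv_closed[OF C] ci hp)
      ultimately show ?thesis using red by simp
    qed
    show "a \<otimes> b \<in> ?D" if ab: "a \<in> ?D" "b \<in> ?D" for a b
    proof -
      obtain c i d j where ci: "c \<in> C" "a = c \<otimes> h [^] (i::nat)" "d \<in> C" "b = d \<otimes> h [^] (j::nat)"
        using ab unfolding f_def by fastforce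
      have cc: "c \<in> carrier G" "d \<in> carrier G" using ci Csub by auto
      have "a \<otimes> b = (c \<otimes> d) \<otimes> h [^] (i + j)"
        using ci cc h by (simp add: nat_pow_mult[symmetric] m_ac)
      then show ?thesis using red[OF subgroup.m_closed[OF C ci(1) ci(3)]] by simp
    qed
  qed
  have "generate G (insert h C) = ?D"
  proof (rule generateI[OF D, symmetric])
    have "h \<in> ?D" using red[OF subgroup.one_closed[OF C], of 1] h by simp
    moreover have "C \<subseteq> ?D"
    proof
      fix x assume "x \<in> C"
      then show "x \<in> ?D" using red[of x 0] Csub by (simp add: subset_iff)
    qed
    ultimately show "insert h C \<subseteq> ?D" by simp
    show "?D \<subseteq> K" if K: "subgroup K G" "insert h C \<subseteq> K" for K
    proof -
      have "h [^] i \<in> K" for i :: nat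
        using subgroup_int_pow_closed[OF K(1), of h "int i"] K(2) by (simp add: int_pow_int)
      then show ?thesis using K subgroup.m_closed[OF K(1)] by (auto simp: f_def)
    qed
  qed
  moreover have "inj_on f (C \<times> {..<p})"
  proof -
    have *: "i = j" if "c \<in> C" "d \<in> C" "i < p" "j < p" "c \<otimes> h [^] i = d \<otimes> h [^] j" "i \<le> j" for c d i j
    proof (rule ccontr)
      assume "i \<noteq> j"
      have cc: "c \<in> carrier G" "d \<in> carrier G" using that Csub by auto
      have "h [^] j = h [^] i \<otimes> h [^] (j - i)" using h that by (simp add: nat_pow_mult)
      then have "c \<otimes> h [^] i = (d \<otimes> h [^] (j - i)) \<otimes> h [^] i" using that h cc by (simp add: m_ac)
      then have "c = d \<otimes> h [^] (j - i)" using h cc by simp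
      then have "h [^] (j - i) = inv d \<otimes> c" using h cc by (simp add: inv_solve_left)
      \<comment> \<open>If i < j, then C contains h^(j-i) as well as h^p, whose exponents are
        coprime, so it would contain h.\<close>
      then have "h [^] (j - i) \<in> C"
        using subgroup.m_closed[OF C subgroup.m_inv_closed[OF C \<open>d \<in> C\<close>] \<open>c \<in> C\<close>] by simp
      moreover have "coprime p (j - i)"
        using p that \<open>i \<noteq> j\<close> by (intro prime_imp_coprime) (auto dest: dvd_imp_le)
      ultimately show False using subgroup_mem_of_coprime_pows[OF C h(1) hp] h(2) by blast
    qed
    show ?thesis
    proof (rule inj_onI, clarsimp simp: f_def)
      fix c i d j assume a: "c \<in> C" "i < p" "d \<in> C" "j < p" "c \<otimes> h [^] i = d \<otimes> h [^] j"
      have "i = j" using *[of c d i j] *[of d c j i] a by (cases "i \<le> j") auto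
      moreover have "c \<in> carrier G" "d \<in> carrier G" using a Csub by auto
      ultimately show "c = d \<and> i = j" using a h by simp
    qed
  qed
  ultimately show ?thesis by (simp add: card_image card_cartesian_product)
qed

lemma (in comm_group) subgroup_pth_powers: "subgroup (pth_powers p G) G"
proof -
  have "(\<lambda>x. x [^] p) \<in> hom G G" by (auto simp: hom_def nat_pow_distrib)
  then interpret group_hom G G "\<lambda>x. x [^] p" by unfold_locales
  show ?thesis by (rule img_is_subgroup)
qed

text \<open>Nakayama for finite abelian p-groups. Substituting the decomposition x = b z^p into z
  again and again raises the exponent to p^j; at j = e the power is trivial and x itself lies in the
  generated subgroup.\<close>

lemma (in comm_group) generate_eq_carrier_if_mod_p:
  assumes ord: "order G = p ^ e" and fin: "finite (carrier G)" and S: "S \<subseteq> carrier G"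
    and gen: "generate G (S \<union> pth_powers p G) = carrier G"
  shows "generate G S = carrier G"
proof -
  let ?B = "generate G S"
  have B: "subgroup ?B G" by (rule generate_is_subgroup[OF S])
  have sub: "subgroup (?B <#> pth_powers p G) G" by (rule mult_subgroups[OF B subgroup_pth_powers])
  have one_P: "\<one> \<in> pth_powers p G" by (rule subgroup.one_closed[OF subgroup_pth_powers])
  have "S \<union> pth_powers p G \<subseteq> ?B <#> pth_powers p G"
  proof
    fix x assume x: "x \<in> S \<union> pth_powers p G"
    show "x \<in> ?B <#> pth_powers p G"
    proof (cases "x \<in> S")
      case True
      then have "x \<in> ?B" "x = x \<otimes> \<one>" using S by (auto intro: generate.incl)
      then show ?thesis using one_P unfolding set_mult_def by blast
    next
      case False
      then have "x \<in> pth_powers p G" "x = \<one> \<otimes> x" using x by auto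
      then show ?thesis using generate.one[of G S] unfolding set_mult_def by blast
    qed
  qed
  from generate_subgroup_incl[OF this sub] gen
  have dec: "\<exists>b\<in>?B. \<exists>z\<in>carrier G. x = b \<otimes> z [^] p" if "x \<in> carrier G" for x
    using that unfolding set_mult_def by blast
  have *: "\<exists>b\<in>?B. \<exists>z\<in>carrier G. x = b \<otimes> z [^] (p ^ j)" if x: "x \<in> carrier G" for x j
  proof (induction j)
    case 0
    show ?case using x generate.one[of G S] by (intro bexI[of _ \<one>] bexI[of _ x]) auto
  next
    case (Suc j)
    then obtain b z where bz: "b \<in> ?B" "z \<in> carrier G" "x = b \<otimes> z [^] (p ^ j)" by blast
    obtain c y where cy: "c \<in> ?B" "y \<in> carrier G" "z = c \<otimes> y [^] p" using dec[OF bz(2)] by blast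
    have cc: "c \<in> carrier G" "b \<in> carrier G" using cy bz subgroup.subset[OF B] by auto
    have "z [^] (p ^ j) = c [^] (p ^ j) \<otimes> y [^] (p ^ Suc j)"
      using cy cc by (simp add: nat_pow_distrib nat_pow_pow)
    then have "x = (b \<otimes> c [^] (p ^ j)) \<otimes> y [^] (p ^ Suc j)"
      using bz cc cy by (simp add: m_assoc)
    moreover have "b \<otimes> c [^] (p ^ j) \<in> ?B"
      using subgroup_int_pow_closed[OF B cy(1), of "int (p ^ j)"]
      by (intro generate.eng bz) (simp only: int_pow_int)
    ultimately show ?case using cy by blast
  qed
  have "carrier G \<subseteq> ?B"
  proof
    fix x assume "x \<in> carrier G"
    from *[OF this, of e] obtain b z where bz: "b \<in> ?B" "z \<in> carrier G" "x = b \<otimes> z [^] order G"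
      using ord by auto
    then have "x = b" using pow_order_eq_1[OF bz(2)] subgroup.subset[OF B] by auto
    then show "x \<in> ?B" using bz by simp
  qed
  then show ?thesis using subgroup.subset[OF B] by blast
qed

lemma card_UN_Cons:
  assumes "finite A" "\<And>h. h \<in> A \<Longrightarrow> finite (X h)"
  shows "card (\<Union>h\<in>A. (#) h ` X h) = (\<Sum>h\<in>A. card (X h))"
  using assms by (subst card_UN_disjoint) (auto simp: card_image)

text \<open>The set S makes the count inductive: the entries of the list are moved into S one at a
  time. Here r is the codimension of the span of S in G/pG, so a new entry either lies in the
  preimage of that span and keeps r, or lies outside and lowers r by one. For S empty, r is the rank
  of G; for r > t the factor with i = t vanishes, as it should.\<close>

lemma (in comm_group) card_generating_lists:
  assumes p: "Factorial_Ring.prime p" and ord: "order G = p ^ e" and fin: "finite (carrier G)"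
    and "S \<subseteq> carrier G"
    and "order G = p ^ r * card (generate G (S \<union> pth_powers p G))"
  shows "real (card {xs. length xs = t \<and> set xs \<subseteq> carrier G \<and> generate G (S \<union> set xs) = carrier G})
      = real (order G) ^ t * (\<Prod>i<r. 1 - real p ^ i / real p ^ t)"
  using assms(4,5)
proof (induction t arbitrary: S r)
  case 0
  let ?C = "generate G (S \<union> pth_powers p G)"
  have SP: "S \<union> pth_powers p G \<subseteq> carrier G" using 0 by auto
  have ord0: "order G > 0" using ord p by (simp add: prime_gt_0_nat)
  have "{xs. length xs = 0 \<and> set xs \<subseteq> carrier G \<and> generate G (S \<union> set xs) = carrier G}
      = {xs. xs = [] \<and> generate G S = carrier G}"
  proof (rule Collect_cong)
    show "(length xs = 0 \<and> set xs \<subseteq> carrier G \<and> generate G (S \<union> set xs) = carrier G)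
      = (xs = [] \<and> generate G S = carrier G)" for xs by (cases xs) simp_all
  qed
  then have "{xs. length xs = 0 \<and> set xs \<subseteq> carrier G \<and> generate G (S \<union> set xs) = carrier G}
      = (if generate G S = carrier G then {[]} else {})" by simp
  moreover have "generate G S = carrier G \<longleftrightarrow> r = 0"
  proof
    assume "generate G S = carrier G"
    then have "?C = carrier G"
      using mono_generate[of S "S \<union> pth_powers p G"] generate_incl[OF SP] by auto
    then have "p ^ r = 1" using 0(2) ord0 by (simp add: order_def)
    then show "r = 0" using p prime_gt_1_nat by (metis less_irrefl one_less_power not_gr_zero)
  next
    assume "r = 0"
    then have "card ?C = card (carrier G)" using 0 by (simp add: order_def)
    then have "?C = carrier G" using generate_incl[OF SP] fin card_subset_eq by blast
    then show "generate G S = carrier G"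
      using generate_eq_carrier_if_mod_p[OF ord fin 0(1)] by simp
  qed
  \<comment> \<open>The factor with i = 0 is 1 - 1, so the product just tests whether r = 0.\<close>
  moreover have "(\<Prod>i<r. 1 - real p ^ i / real p ^ 0) = (if r = 0 then 1 else 0)"
    by (auto intro!: bexI[of _ 0])
  ultimately show ?case by auto
next
  case (Suc t)
  let ?P = "pth_powers p G"
  let ?C = "generate G (S \<union> ?P)"
  let ?N = "\<lambda>S t. {xs. length xs = t \<and> set xs \<subseteq> carrier G \<and> generate G (S \<union> set xs) = carrier G}"
  have SP: "S \<union> ?P \<subseteq> carrier G" using Suc.prems by auto
  have C: "subgroup ?C G" by (rule generate_is_subgroup[OF SP])
  have Csub: "?C \<subseteq> carrier G" by (rule subgroup.subset[OF C])
  have ord0: "order G > 0" using ord p by (simp add: prime_gt_0_nat)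
  have p1: "p > 1" using p prime_gt_1_nat by blast
  have finN: "finite (?N S t)" for S t
    by (rule finite_subset[OF _ finite_lists_length_eq[OF fin, of t]]) auto
  have eq: "?N S (Suc t) = (\<Union>h\<in>carrier G. (#) h ` ?N (insert h S) t)"
  proof (intro Set.set_eqI iffI)
    fix xs assume "xs \<in> ?N S (Suc t)"
    then show "xs \<in> (\<Union>h\<in>carrier G. (#) h ` ?N (insert h S) t)"
      by (cases xs) (auto simp: insert_commute)
  qed auto
  have "card (?N S (Suc t)) = (\<Sum>h\<in>carrier G. card (?N (insert h S) t))"
    unfolding eq by (rule card_UN_Cons[OF fin finN])
  then have "real (card (?N S (Suc t))) = (\<Sum>h\<in>carrier G. real (card (?N (insert h S) t)))" by simp
  also have "\<dots> = (\<Sum>h\<in>carrier G. if h \<in> ?C then real (order G) ^ t * (\<Prod>i<r. 1 - real p ^ i / real p ^ t)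
       else real (order G) ^ t * (\<Prod>i<r - 1. 1 - real p ^ i / real p ^ t))"
  proof (intro sum.cong refl)
    fix h assume h: "h \<in> carrier G"
    have hS: "insert h S \<subseteq> carrier G" using h Suc.prems by auto
    have eq: "generate G (insert h S \<union> ?P) = generate G (insert h ?C)"
      using generate_generate_Un[OF SP, of "{h}"] h by (simp add: Un_commute)
    show "real (card (?N (insert h S) t)) = (if h \<in> ?C then real (order G) ^ t * (\<Prod>i<r. 1 - real p ^ i / real p ^ t)
       else real (order G) ^ t * (\<Prod>i<r - 1. 1 - real p ^ i / real p ^ t))"
    proof (cases "h \<in> ?C")
      case True
      then have "generate G (insert h S \<union> ?P) = ?C"
        using eq generate_subgroup_eq[OF C] by (simp add: insert_absorb)
      then show ?thesis using Suc.IH[OF hS, of r] Suc.prems True by simp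
    next
      case False
      have "?P \<subseteq> ?C" by (auto intro: generate.incl)
      from card_generate_insert[OF p fin C this h False]
      have c: "card (generate G (insert h S \<union> ?P)) = p * card ?C" using eq by simp
      have "r \<noteq> 0"
      proof
        assume "r = 0"
        then have "card ?C = card (carrier G)" using Suc.prems by (simp add: order_def)
        then have "?C = carrier G" using Csub fin card_subset_eq by blast
        then show False using False h by simp
      qed
      then have "order G = p ^ (r - 1) * card (generate G (insert h S \<union> ?P))"
        using c Suc.prems(2) by (cases r) auto
      then show ?thesis using Suc.IH[OF hS, of "r - 1"] False by simp
    qed
  qed
  also have "\<dots> = real (card ?C) * (real (order G) ^ t * (\<Prod>i<r. 1 - real p ^ i / real p ^ t))
     + (real (order G) - real (card ?C)) * (real (order G) ^ t * (\<Prod>i<r - 1. 1 - real p ^ i / real p ^ t))"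
  proof -
    have "{x \<in> carrier G. x \<in> ?C} = ?C" using Csub by blast
    moreover have "{x \<in> carrier G. x \<notin> ?C} = carrier G - ?C" by blast
    moreover have "card (carrier G - ?C) = order G - card ?C" "card ?C \<le> order G"
      using Csub fin by (auto simp: card_Diff_subset finite_subset order_def card_mono)
    ultimately show ?thesis using fin
      by (simp add: sum.If_cases Int_def of_nat_diff)
  qed
  also have "\<dots> = real (order G) ^ Suc t * (\<Prod>i<r. 1 - real p ^ i / real p ^ Suc t)"
  proof (cases r)
    \<comment> \<open>The truncated \<open>r - 1\<close> does no harm here: for r = 0 the subgroup
      is all of G and the second summand has coefficient 0.\<close>
    case 0
    then show ?thesis using Suc.prems(2) by simp
  next
    case (Suc s)
    \<comment> \<open>Since p^(i+1)/p^(t+1) = p^i/p^t, all three products are multiples of this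
      common one.\<close>
    define W where "W = (\<Prod>i<s. 1 - real p ^ i / real p ^ t)"
    have "(\<Prod>i<Suc s. 1 - real p ^ i / real p ^ Suc t) = (1 - 1 / real p ^ Suc t) * W"
      unfolding prod.lessThan_Suc_shift W_def using p1 by simp
    moreover have "(\<Prod>i<Suc s. 1 - real p ^ i / real p ^ t) = W * (1 - real p ^ s / real p ^ t)"
      by (simp add: W_def)
    moreover have "real (order G) = real p ^ Suc s * real (card ?C)" using Suc.prems(2) Suc by simp
    ultimately have "?thesis \<longleftrightarrow> real (card ?C) * (real (order G) ^ t * (W * (1 - real p ^ s / real p ^ t)))
        + (real p ^ Suc s * real (card ?C) - real (card ?C)) * (real (order G) ^ t * W)
        = real (order G) ^ t * (real p ^ Suc s * real (card ?C)) * ((1 - 1 / real p ^ Suc t) * W)"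
      unfolding Suc by (simp add: W_def mult.commute)
    moreover have "c * (g * (W * (1 - real p ^ s / real p ^ t))) + (real p ^ Suc s * c - c) * (g * W)
        = g * (real p ^ Suc s * c) * ((1 - 1 / real p ^ Suc t) * W)" for c g
      using p1 by (simp add: field_simps)
    ultimately show ?thesis by blast
  qed
  finally show ?case .
qed

section \<open>Counting surjections\<close>

text \<open>Extensionality identifies maps that agree on the carrier, so that the set can be
  counted.\<close>

definition epis :: "('a, 'c) monoid_scheme \<Rightarrow> ('b, 'd) monoid_scheme \<Rightarrow> ('a \<Rightarrow> 'b) set" where
  "epis A G = {\<phi> \<in> hom A G. \<phi> \<in> extensional (carrier A) \<and> \<phi> ` carrier A = carrier G}"

lemma epi_kernel_iso:
  assumes "group A" "group G" "\<phi> \<in> epis A G"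
  shows "kernel A G \<phi> \<lhd> A" "A Mod kernel A G \<phi> \<cong> G"
proof -
  interpret group_hom A G \<phi>
    using assms by (simp add: epis_def group_hom_def group_hom_axioms_def)
  show "kernel A G \<phi> \<lhd> A" by (rule normal_kernel)
  show "A Mod kernel A G \<phi> \<cong> G" using FactGroup_iso assms(3) by (simp add: epis_def)
qed

lemma exists_epi_with_kernel:
  assumes "group A" "group G" "N \<lhd> A" "A Mod N \<cong> G"
  shows "\<exists>\<phi>\<in>epis A G. kernel A G \<phi> = N"
proof -
  interpret N: normal N A by fact
  obtain f where f: "f \<in> iso (A Mod N) G" using assms by (auto simp: is_iso_def)
  let ?\<phi> = "restrict (\<lambda>x. f (N #>\<^bsub>A\<^esub> x)) (carrier A)"
  have Q: "group (A Mod N)" by (rule N.factorgroup_is_group)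
  have "(\<lambda>x. f (N #>\<^bsub>A\<^esub> x)) \<in> hom A G"
    using hom_compose[OF N.r_coset_hom_Mod Group.iso_imp_homomorphism[OF f]] by (simp add: o_def)
  then have hom: "?\<phi> \<in> hom A G" using assms(1)
    by (auto simp: hom_def Pi_iff group.is_monoid monoid.m_closed)
  have onto: "?\<phi> ` carrier A = carrier G"
  proof -
    have "?\<phi> ` carrier A = f ` carrier (A Mod N)" by (auto simp: carrier_FactGroup)
    then show ?thesis using f by (simp add: iso_iff)
  qed
  have "kernel A G ?\<phi> = N"
  proof -
    have "f (N #>\<^bsub>A\<^esub> x) = \<one>\<^bsub>G\<^esub> \<longleftrightarrow> x \<in> N" if "x \<in> carrier A" for x
    proof -
      have inj: "inj_on f (carrier (A Mod N))" using f by (simp add: iso_iff)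
      have one: "f N = \<one>\<^bsub>G\<^esub>" using hom_one[OF Group.iso_imp_homomorphism[OF f] Q assms(2)] by simp
      have "N #>\<^bsub>A\<^esub> x \<in> carrier (A Mod N)" using that by (auto simp: carrier_FactGroup)
      moreover have "N \<in> carrier (A Mod N)" using group.is_monoid[OF Q] monoid.one_closed by force
      ultimately have "f (N #>\<^bsub>A\<^esub> x) = \<one>\<^bsub>G\<^esub> \<longleftrightarrow> N #>\<^bsub>A\<^esub> x = N"
        using inj one by (metis inj_on_eq_iff)
      also have "\<dots> \<longleftrightarrow> x \<in> N"
        using that by (metis N.rcos_self N.subgroup_axioms N.is_group group.coset_join2 subgroup.rcos_const)
      finally show ?thesis .
    qed
    then show ?thesis using N.subset by (auto simp: kernel_def)
  qed
  then show ?thesis using hom onto by (intro bexI[of _ ?\<phi>]) (auto simp: epis_def)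
qed

text \<open>Composition with automorphisms of G acts simply transitively on the epimorphisms with a
  given kernel: two such maps identify the same points of A, so one is obtained from the other by a
  unique automorphism.\<close>

lemma card_epis_with_kernel:
  fixes A :: "('a, 'c) monoid_scheme" and G :: "('b, 'd) monoid_scheme"
  assumes "group A" "group G" "\<phi> \<in> epis A G"
  shows "card {\<psi> \<in> epis A G. kernel A G \<psi> = kernel A G \<phi>} = order (AutoGroup G)"
proof -
  interpret A: group A by fact
  interpret G: group G by fact
  have eqv: "\<psi> x = \<psi> y \<longleftrightarrow> x \<otimes>\<^bsub>A\<^esub> inv\<^bsub>A\<^esub> y \<in> kernel A G \<psi>"
    if "\<psi> \<in> epis A G" "x \<in> carrier A" "y \<in> carrier A" for \<psi> x y
  proof -
    interpret group_hom A G \<psi> using that by unfold_locales (simp add: epis_def)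
    have "\<psi> (x \<otimes>\<^bsub>A\<^esub> inv\<^bsub>A\<^esub> y) = \<one>\<^bsub>G\<^esub> \<longleftrightarrow> \<psi> x = \<psi> y"
      using that by (simp add: G.inv_solve_right')
    then show ?thesis using that by (auto simp: kernel_def)
  qed
  have \<phi>: "\<phi> \<in> hom A G" "\<phi> \<in> extensional (carrier A)" "\<phi> ` carrier A = carrier G"
    using assms(3) by (auto simp: epis_def)
  define F :: "('b \<Rightarrow> 'b) \<Rightarrow> 'a \<Rightarrow> 'b" where "F = (\<lambda>\<alpha>. restrict (\<lambda>x. \<alpha> (\<phi> x)) (carrier A))"
  have "bij_betw F (auto G) {\<psi> \<in> epis A G. kernel A G \<psi> = kernel A G \<phi>}"
    unfolding bij_betw_def
  proof
    show "inj_on F (auto G)"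
    proof (rule inj_onI)
      fix \<alpha> \<beta> assume a: "\<alpha> \<in> auto G" "\<beta> \<in> auto G" "F \<alpha> = F \<beta>"
      have "\<alpha> g = \<beta> g" if g: "g \<in> carrier G" for g
      proof -
        obtain x where "x \<in> carrier A" "\<phi> x = g" using g \<phi>(3) by (metis imageE)
        then show ?thesis using fun_cong[OF a(3), of x] by (simp add: F_def)
      qed
      then show "\<alpha> = \<beta>" using a by (intro extensionalityI[of _ "carrier G"]) (auto simp: auto_def Bij_def)
    qed
    show "F ` auto G = {\<psi> \<in> epis A G. kernel A G \<psi> = kernel A G \<phi>}"
    proof (intro Set.set_eqI iffI)
      fix \<psi> assume "\<psi> \<in> F ` auto G"
      then obtain \<alpha> where \<alpha>: "\<alpha> \<in> auto G" "\<psi> = F \<alpha>" by blast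
      then have bij: "\<alpha> \<in> hom G G" "bij_betw \<alpha> (carrier G) (carrier G)" by (auto simp: auto_def Bij_def)
      then have iso: "\<alpha> \<in> iso G G" by (simp add: iso_def)
      have "\<psi> \<in> hom A G"
        using hom_compose[OF \<phi>(1) bij(1)] by (auto simp: \<alpha> F_def hom_def Pi_iff)
      moreover have "\<psi> ` carrier A = carrier G"
      proof -
        have "\<psi> ` carrier A = \<alpha> ` \<phi> ` carrier A" by (auto simp: \<alpha> F_def)
        then show ?thesis using \<phi> bij by (simp add: bij_betw_def)
      qed
      moreover have "kernel A G \<psi> = kernel A G \<phi>"
      proof -
        have "\<alpha> (\<phi> x) = \<one>\<^bsub>G\<^esub> \<longleftrightarrow> \<phi> x = \<one>\<^bsub>G\<^esub>" if "x \<in> carrier A" for x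
          using bij that \<phi> hom_one[OF bij(1) assms(2) assms(2)] hom_in_carrier[OF \<phi>(1) that]
          by (metis G.one_closed bij_betw_imp_inj_on inj_on_eq_iff)
        then show ?thesis by (auto simp: kernel_def \<alpha> F_def)
      qed
      ultimately show "\<psi> \<in> {\<psi> \<in> epis A G. kernel A G \<psi> = kernel A G \<phi>}"
        by (simp add: epis_def \<alpha> F_def)
    next
      fix \<psi> assume "\<psi> \<in> {\<psi> \<in> epis A G. kernel A G \<psi> = kernel A G \<phi>}"
      then have \<psi>: "\<psi> \<in> epis A G" "kernel A G \<psi> = kernel A G \<phi>" by auto
      have \<psi>': "\<psi> \<in> hom A G" "\<psi> \<in> extensional (carrier A)" "\<psi> ` carrier A = carrier G"
        using \<psi> by (auto simp: epis_def)
      have same: "\<psi> x = \<psi> y \<longleftrightarrow> \<phi> x = \<phi> y" if "x \<in> carrier A" "y \<in> carrier A" for x y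
        using eqv[OF \<psi>(1) that] eqv[OF assms(3) that] \<psi>(2) by simp
      \<comment> \<open>A set-theoretic section of \<phi>. It need not be a homomorphism: by
        \<open>same\<close>, the value of \<psi> does not depend on the chosen preimage.\<close>
      define s where "s = (\<lambda>g. SOME x. x \<in> carrier A \<and> \<phi> x = g)"
      have s: "s g \<in> carrier A \<and> \<phi> (s g) = g" if "g \<in> carrier G" for g
        unfolding s_def by (rule someI_ex) (metis that \<phi>(3) imageE)
      define \<alpha> where "\<alpha> = restrict (\<lambda>g. \<psi> (s g)) (carrier G)"
      have \<alpha>\<phi>: "\<alpha> (\<phi> x) = \<psi> x" if "x \<in> carrier A" for x
        using that s[of "\<phi> x"] same[of "s (\<phi> x)" x] hom_in_carrier[OF \<phi>(1) that] by (simp add: \<alpha>_def)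
      have "\<alpha> \<in> hom G G"
      proof (rule homI)
        show "\<alpha> x \<in> carrier G" if "x \<in> carrier G" for x
          using that s[OF that] hom_in_carrier[OF \<psi>'(1)] by (simp add: \<alpha>_def)
        fix x y assume xy: "x \<in> carrier G" "y \<in> carrier G"
        have "\<phi> (s x \<otimes>\<^bsub>A\<^esub> s y) = x \<otimes>\<^bsub>G\<^esub> y" using s xy hom_mult[OF \<phi>(1)] by simp
        then have "\<alpha> (x \<otimes>\<^bsub>G\<^esub> y) = \<psi> (s x \<otimes>\<^bsub>A\<^esub> s y)" using \<alpha>\<phi>[of "s x \<otimes>\<^bsub>A\<^esub> s y"] s xy by simp
        then show "\<alpha> (x \<otimes>\<^bsub>G\<^esub> y) = \<alpha> x \<otimes>\<^bsub>G\<^esub> \<alpha> y"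
          using s xy hom_mult[OF \<psi>'(1)] by (simp add: \<alpha>_def)
      qed
      moreover have "bij_betw \<alpha> (carrier G) (carrier G)"
        unfolding bij_betw_def
      proof
        show "inj_on \<alpha> (carrier G)"
        proof (rule inj_onI)
          fix x y assume xy: "x \<in> carrier G" "y \<in> carrier G" "\<alpha> x = \<alpha> y"
          then have "\<psi> (s x) = \<psi> (s y)" by (simp add: \<alpha>_def)
          then show "x = y" using same s xy by metis
        qed
        have "\<alpha> ` \<phi> ` carrier A = \<psi> ` carrier A" using \<alpha>\<phi> by (force simp: image_image)
        then show "\<alpha> ` carrier G = carrier G" using \<phi> \<psi>' by simp
      qed
      ultimately have "\<alpha> \<in> auto G" by (simp add: auto_def Bij_def \<alpha>_def)
      moreover have "\<psi> = F \<alpha>"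
        using \<psi>' \<alpha>\<phi> by (intro extensionalityI[of _ "carrier A"]) (auto simp: F_def)
      ultimately show "\<psi> \<in> F ` auto G" by blast
    qed
  qed
  then have "card (auto G) = card {\<psi> \<in> epis A G. kernel A G \<psi> = kernel A G \<phi>}"
    by (rule bij_betw_same_card)
  then show ?thesis by (simp add: order_def AutoGroup_def)
qed

lemma card_epis:
  assumes "group A" "group G" and fin: "finite (carrier A)"
  shows "card (epis A G) = card {N. N \<lhd> A \<and> A Mod N \<cong> G} * order (AutoGroup G)"
proof -
  let ?N = "{N. N \<lhd> A \<and> A Mod N \<cong> G}"
  have "?N \<subseteq> Pow (carrier A)" by (auto dest: normal_imp_subgroup subgroup.subset)
  then have finN: "finite ?N" using fin by (meson finite_Pow_iff finite_subset)
  have fin_fib: "finite {\<psi> \<in> epis A G. kernel A G \<psi> = N}" for N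
  proof (cases "epis A G = {}")
    case False
    then obtain \<phi> where "\<phi> ` carrier A = carrier G" by (auto simp: epis_def)
    then have finG: "finite (carrier G)" using fin finite_imageI by metis
    have "epis A G \<subseteq> carrier A \<rightarrow>\<^sub>E carrier G" by (auto simp: epis_def PiE_def hom_def)
    then have "finite (epis A G)" using fin finG by (meson finite_PiE finite_subset)
    then show ?thesis by simp
  qed simp
  have "epis A G = (\<Union>N\<in>?N. {\<psi> \<in> epis A G. kernel A G \<psi> = N})"
    using epi_kernel_iso[OF assms(1,2)] by auto
  then have "card (epis A G) = (\<Sum>N\<in>?N. card {\<psi> \<in> epis A G. kernel A G \<psi> = N})"
    using card_UN_disjoint[OF finN, of "\<lambda>N. {\<psi> \<in> epis A G. kernel A G \<psi> = N}"] fin_fib by auto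
  also have "\<dots> = (\<Sum>N\<in>?N. order (AutoGroup G))"
  proof (intro sum.cong refl)
    fix N assume "N \<in> ?N"
    then obtain \<phi> where "\<phi> \<in> epis A G" "kernel A G \<phi> = N"
      using exists_epi_with_kernel[OF assms(1,2)] by blast
    then show "card {\<psi> \<in> epis A G. kernel A G \<psi> = N} = order (AutoGroup G)"
      using card_epis_with_kernel[OF assms(1,2)] by blast
  qed
  finally show ?thesis by simp
qed

section \<open>The products $\eta$ and the expansion in $p^{-n}$\<close>

lemma eta_Suc: "eta p (enat (Suc k)) = eta p (enat k) * (1 - 1 / real p ^ Suc k)"
  by (simp add: eta_def)

lemma eta_0: "eta p (enat 0) = 1"
  by (simp add: eta_def)

text \<open>The order of GL_r(F_p).\<close>

definition gl_size :: "nat \<Rightarrow> nat \<Rightarrow> real" where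
  "gl_size p r = real p ^ (r * r) * eta p (enat r)"

text \<open>The sum 1 + p + ... + p^(r-1), that is, the number of points of the projective space of
  F_p^r and the first elementary symmetric function of 1, p, ..., p^(r-1).\<close>

definition proj_size :: "nat \<Rightarrow> nat \<Rightarrow> real" where
  "proj_size p r = (real p ^ r - 1) / (real p - 1)"

text \<open>The second elementary symmetric function of 1, p, ..., p^(r-1): the recursion adds the
  products of the new variable p^r with all earlier ones.\<close>

fun esym2 :: "nat \<Rightarrow> nat \<Rightarrow> real" where
  "esym2 p 0 = 0"
| "esym2 p (Suc r) = esym2 p r + real p ^ r * proj_size p r"

context
  fixes p :: nat assumes p2: "p \<ge> 2"
begin

lemma one_minus_inverse_power_pos: "0 < 1 - 1 / real p ^ Suc k" "1 - 1 / real p ^ Suc k < 1"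
proof -
  have "1 < real p ^ Suc k" using p2 by (intro one_less_power) auto
  then show "0 < 1 - 1 / real p ^ Suc k" "1 - 1 / real p ^ Suc k < 1" by (auto simp: field_simps)
qed

lemma eta_enat_pos: "eta p (enat k) > 0"
  by (induction k) (use one_minus_inverse_power_pos in \<open>auto simp: eta_0 eta_Suc simp del: power_Suc\<close>)

text \<open>The fraction is the geometric sum of p^(-j) over N < j \<le> N + d. The two bounds are
  the general inequalities 1 - sum y_j \<le> prod (1 - y_j) and prod (1 - y_j) * (1 + sum y_j) \<le>
  1, applied to y_j = p^(-j).\<close>

lemma eta_bounds:
  "eta p (enat N) * (1 - (1 - 1 / real p ^ d) / (real p ^ N * (real p - 1))) \<le> eta p (enat (N + d))"
  "eta p (enat (N + d)) * (1 + (1 - 1 / real p ^ d) / (real p ^ N * (real p - 1))) \<le> eta p (enat N)"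
proof -
  define S where "S = (\<lambda>d. (1 - 1 / real p ^ d) / (real p ^ N * (real p - 1)))"
  have S0: "S d \<ge> 0" for d using p2 by (auto simp: S_def field_simps)
  have S_Suc: "S (Suc d) = S d + 1 / real p ^ Suc (N + d)" for d
    using p2 by (simp add: S_def field_simps power_add)
  have "eta p (enat N) * (1 - S d) \<le> eta p (enat (N + d)) \<and> eta p (enat (N + d)) * (1 + S d) \<le> eta p (enat N)"
  proof (induction d)
    case 0
    then show ?case by (simp add: S_def)
  next
    case (Suc d)
    define y where "y = 1 / real p ^ Suc (N + d)"
    have y: "0 < y" "y < 1" using one_minus_inverse_power_pos[of "N + d"] by (auto simp: y_def)
    have SS: "S (Suc d) = S d + y" unfolding y_def by (rule S_Suc)
    have e: "eta p (enat (N + Suc d)) = eta p (enat (N + d)) * (1 - y)" by (simp add: eta_Suc y_def)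
    have "eta p (enat N) * (1 - S (Suc d)) \<le> eta p (enat N) * ((1 - S d) * (1 - y))"
      using S0[of d] y by (intro mult_left_mono) (auto simp: SS algebra_simps less_imp_le[OF eta_enat_pos])
    also have "\<dots> \<le> eta p (enat (N + d)) * (1 - y)"
      using mult_right_mono[OF conjunct1[OF Suc], of "1 - y"] y by (simp add: mult.assoc)
    finally have 1: "eta p (enat N) * (1 - S (Suc d)) \<le> eta p (enat (N + Suc d))" using e by simp
    have "eta p (enat (N + Suc d)) * (1 + S (Suc d)) = eta p (enat (N + d)) * ((1 - y) * (1 + S d + y))"
      unfolding e SS by (simp add: algebra_simps)
    also have "\<dots> \<le> eta p (enat (N + d)) * (1 + S d)"
      using S0[of d] y by (intro mult_left_mono) (auto simp: algebra_simps less_imp_le[OF eta_enat_pos])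
    also have "\<dots> \<le> eta p (enat N)" using Suc by simp
    finally show ?case using 1 by simp
  qed
  then show "eta p (enat N) * (1 - (1 - 1 / real p ^ d) / (real p ^ N * (real p - 1))) \<le> eta p (enat (N + d))"
  "eta p (enat (N + d)) * (1 + (1 - 1 / real p ^ d) / (real p ^ N * (real p - 1))) \<le> eta p (enat N)"
    by (auto simp: S_def)
qed

lemma eta_infinity:
  "(\<lambda>k. eta p (enat k)) \<longlonglongrightarrow> eta p \<infinity>" "eta p \<infinity> > 0"
proof -
  have sm: "summable (\<lambda>j. norm ((1 - 1 / real p ^ Suc j) - 1))"
  proof -
    have "summable (\<lambda>j. (1 / real p) ^ Suc j)"
      using p2 by (subst summable_Suc_iff) (auto intro!: summable_geometric)
    moreover have "norm ((1 - 1 / real p ^ Suc j) - 1) = (1 / real p) ^ Suc j" for j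
      by (simp add: power_one_over del: power_Suc)
    ultimately show ?thesis by (simp only:)
  qed
  have conv: "convergent_prod (\<lambda>j. 1 - 1 / real p ^ Suc j)"
    using sm by (intro abs_convergent_prod_imp_convergent_prod summable_imp_abs_convergent_prod)
  have eq: "(\<Prod>j\<le>k. 1 - 1 / real p ^ Suc j) = eta p (enat (Suc k))" for k
    by (induction k) (auto simp: eta_Suc eta_0 simp del: power_Suc)
  have "(\<lambda>k. eta p (enat (Suc k))) \<longlonglongrightarrow> eta p \<infinity>"
    using convergent_prod_LIMSEQ[OF conv] unfolding eq by (simp add: eta_def)
  then show lim: "(\<lambda>k. eta p (enat k)) \<longlonglongrightarrow> eta p \<infinity>" by (rule LIMSEQ_imp_Suc)
  have "eta p \<infinity> \<ge> 0" by (rule LIMSEQ_le_const[OF lim]) (auto intro: less_imp_le[OF eta_enat_pos])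
  moreover have "eta p \<infinity> \<noteq> 0"
    unfolding eta_def using prodinf_nonzero[OF conv] one_minus_inverse_power_pos(1)
    by (metis (no_types, lifting) enat.simps(5) less_irrefl)
  ultimately show "eta p \<infinity> > 0" by simp
qed

lemma eta_infinity_bounds:
  "eta p (enat N) * (1 - 1 / (real p ^ N * (real p - 1))) \<le> eta p \<infinity>"
  "eta p \<infinity> * (1 + 1 / (real p ^ N * (real p - 1))) \<le> eta p (enat N)"
proof -
  have l: "(\<lambda>d. eta p (enat (N + d))) \<longlonglongrightarrow> eta p \<infinity>"
    using LIMSEQ_ignore_initial_segment[OF eta_infinity(1), of N] by (simp add: add.commute)
  have "(\<lambda>d. (1 / real p) ^ d) \<longlonglongrightarrow> 0" using p2 by (intro LIMSEQ_power_zero) auto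
  then have z: "(\<lambda>d. 1 / real p ^ d) \<longlonglongrightarrow> 0" by (simp add: power_one_over)
  have s: "(\<lambda>d. (1 - 1 / real p ^ d) / (real p ^ N * (real p - 1))) \<longlonglongrightarrow> (1 - 0) / (real p ^ N * (real p - 1))"
    using p2 by (intro tendsto_intros z) auto
  have "(\<lambda>d. eta p (enat N) * (1 - (1 - 1 / real p ^ d) / (real p ^ N * (real p - 1))))
      \<longlonglongrightarrow> eta p (enat N) * (1 - (1 - 0) / (real p ^ N * (real p - 1)))" by (intro tendsto_intros s)
  from LIMSEQ_le[OF this l] show "eta p (enat N) * (1 - 1 / (real p ^ N * (real p - 1))) \<le> eta p \<infinity>"
    using eta_bounds(1) by simp
  have "(\<lambda>d. eta p (enat (N + d)) * (1 + (1 - 1 / real p ^ d) / (real p ^ N * (real p - 1))))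
      \<longlonglongrightarrow> eta p \<infinity> * (1 + (1 - 0) / (real p ^ N * (real p - 1)))" by (intro tendsto_intros s l)
  from LIMSEQ_le_const2[OF this] show "eta p \<infinity> * (1 + 1 / (real p ^ N * (real p - 1))) \<le> eta p (enat N)"
    using eta_bounds(2) by simp
qed

lemma eta_infinity_le: "eta p \<infinity> \<le> eta p (enat N)"
proof -
  have "eta p \<infinity> * 1 \<le> eta p \<infinity> * (1 + 1 / (real p ^ N * (real p - 1)))"
    using p2 eta_infinity(2) by (intro mult_left_mono) auto
  then show ?thesis using eta_infinity_bounds(2)[of N] by simp
qed

text \<open>Only the first factor 1 - \<delta> of \<eta>_\<infinity>/\<eta>_m is kept, with \<delta>
  = p^(-m-1). The inverse ratio is then at least 1 + \<delta>, and (1 + \<delta>)^2 - 1 \<ge> 2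
  \<delta> \<ge> (2 \<delta>)^2 because \<delta> \<le> 1/2.\<close>

lemma sqrt_eta_bound: "2 / real p ^ Suc m \<le> sqrt ((eta p (enat m))\<^sup>2 / (eta p \<infinity>)\<^sup>2 - 1)"
proof -
  define \<delta> where "\<delta> = 1 / real p ^ Suc m"
  have "real p \<le> real p ^ Suc m" using p2 by (intro self_le_power) auto
  then have pw: "real p ^ Suc m \<ge> 2" using p2 by linarith
  have \<delta>: "0 < \<delta>" "\<delta> \<le> 1 / 2" using pw by (auto simp: \<delta>_def field_simps)
  have "eta p \<infinity> \<le> eta p (enat m) * (1 - \<delta>)"
    using eta_infinity_le[of "Suc m"] by (simp add: eta_Suc \<delta>_def)
  then have "eta p \<infinity> * (1 + \<delta>) \<le> eta p (enat m) * (1 - \<delta>) * (1 + \<delta>)"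
    using \<delta> by (intro mult_right_mono) auto
  also have "\<dots> \<le> eta p (enat m) * 1"
    unfolding mult.assoc using eta_enat_pos[of m] by (intro mult_left_mono) (auto simp: algebra_simps)
  finally have "1 + \<delta> \<le> eta p (enat m) / eta p \<infinity>"
    using eta_infinity(2) by (simp add: field_simps)
  then have "(1 + \<delta>)\<^sup>2 \<le> (eta p (enat m) / eta p \<infinity>)\<^sup>2"
    using \<delta> by (intro power_mono) auto
  moreover have "(2 * \<delta>)\<^sup>2 \<le> (1 + \<delta>)\<^sup>2 - 1"
  proof -
    have "\<delta> * \<delta> \<le> (1/2) * \<delta>" using \<delta> by (intro mult_right_mono) auto
    then show ?thesis using \<delta> by (simp add: power2_eq_square algebra_simps)
  qed
  ultimately have "(2 * \<delta>)\<^sup>2 \<le> (eta p (enat m))\<^sup>2 / (eta p \<infinity>)\<^sup>2 - 1"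
    by (simp add: power_divide)
  then show ?thesis using real_le_rsqrt by (simp add: \<delta>_def)
qed

section \<open>The order of GL_r(F_p) against symmetric functions of 1, p, ..., p^(r-1)\<close>

lemma gl_size_Suc: "gl_size p (Suc r) = gl_size p r * real p ^ r * (real p ^ Suc r - 1)"
  using p2 by (simp add: gl_size_def eta_Suc field_simps power_add)

lemma gl_size_pos: "gl_size p r > 0"
  using p2 eta_enat_pos by (simp add: gl_size_def)

lemma proj_size_Suc: "proj_size p (Suc r) = real p * proj_size p r + 1" "proj_size p (Suc r) = proj_size p r + real p ^ r"
  using p2 by (auto simp: proj_size_def field_simps)

lemma proj_size_nonneg: "0 \<le> proj_size p r"
  using p2 by (auto simp: proj_size_def)

text \<open>Passing from r to r+1 multiplies the left side by at most p (p + 1) and the right side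
  by p^r (p^(r+1) - 1), which is larger, so everything rests on the base case. There the claim
  amounts to (p - 2)(2p - 1) \<ge> 0; for p = 2 both sides are 12, so the factor 2 cannot be
  lowered.\<close>

lemma proj_size_le_gl_size: "r \<ge> 2 \<Longrightarrow> real p ^ r * proj_size p r \<le> 2 * gl_size p r"
proof (induction r rule: dec_induct)
  case base
  have g2: "gl_size p 2 = (real p - 1) * real p * (real p ^ 2 - 1)"
    using gl_size_Suc[of 0] gl_size_Suc[of 1] by (simp add: gl_size_def eta_0 numeral_2_eq_2)
  have "real p ^ 2 * proj_size p 2 = (real p * (real p + 1)) * real p"
    using p2 by (simp add: proj_size_def field_simps power2_eq_square)
  also have "\<dots> \<le> (real p * (real p + 1)) * (2 * (real p - 1)\<^sup>2)"
  proof (intro mult_left_mono)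
    have "0 \<le> (real p - 2) * (2 * real p - 1)" using p2 by (intro mult_nonneg_nonneg) auto
    then show "real p \<le> 2 * (real p - 1)\<^sup>2" by (simp add: power2_eq_square algebra_simps)
  qed auto
  also have "\<dots> = 2 * gl_size p 2" by (simp add: g2 power2_eq_square algebra_simps)
  finally show ?case .
next
  case (step r)
  have ps: "1 \<le> proj_size p r" using p2 step self_le_power[of "real p" r] by (simp add: proj_size_def field_simps)
  have pr: "real p ^ 2 \<le> real p ^ r" "real p ^ 3 \<le> real p ^ Suc r"
    using p2 step by (auto intro!: power_increasing simp del: power_Suc)
  have "real p ^ Suc r * proj_size p (Suc r) \<le> real p ^ Suc r * ((real p + 1) * proj_size p r)"
    unfolding proj_size_Suc(1) using ps by (intro mult_left_mono) (auto simp: algebra_simps)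
  also have "\<dots> = (real p ^ r * proj_size p r) * (real p * (real p + 1))" by simp
  also have "\<dots> \<le> (2 * gl_size p r) * (real p ^ r * (real p ^ Suc r - 1))"
  proof (rule mult_mono[OF step.IH])
    have "real p * (real p + 1) \<le> real p ^ 2 * (real p ^ 3 - 1)"
    proof -
      have "real p ^ 3 \<ge> real p ^ 2 * 2" using p2 by (simp add: power3_eq_cube power2_eq_square mult_left_mono)
      moreover have "real p ^ 2 \<ge> 2 * 2" unfolding power2_eq_square using p2 by (intro mult_mono) auto
      ultimately have "2 \<le> real p ^ 3 - 1" by simp
      then have "real p ^ 2 * 2 \<le> real p ^ 2 * (real p ^ 3 - 1)" by (intro mult_left_mono) auto
      moreover have "real p * (real p + 1) \<le> real p * (real p * 2)" using p2 by (intro mult_left_mono) auto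
      ultimately show ?thesis by (simp add: power2_eq_square)
    qed
    also have "\<dots> \<le> real p ^ r * (real p ^ Suc r - 1)"
      using pr p2 by (intro mult_mono) (auto simp del: power_Suc)
    finally show "real p * (real p + 1) \<le> real p ^ r * (real p ^ Suc r - 1)" .
    show "0 \<le> 2 * gl_size p r" using gl_size_pos[of r] by simp
  qed (use p2 in auto)
  also have "\<dots> = 2 * gl_size p (Suc r)" by (simp add: gl_size_Suc)
  finally show ?case .
qed

lemma esym2_nonneg: "esym2 p r \<ge> 0"
  by (induction r) (use proj_size_nonneg in auto)

text \<open>The factor 3/2 makes room for 1 + s with s \<le> 1/2 in the remainder estimate. In
  closed form \<open>esym2 p (Suc r)\<close> is \<open>proj_size p (Suc r)\<close> * (p^r - 1) *
  p/(p^2 - 1), and p/(p^2 - 1) \<le> 2/3 with equality for p = 2.\<close>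

lemma esym2_le: "3 / 2 * esym2 p (Suc r) \<le> proj_size p (Suc r) * (real p ^ r - 1)"
proof (induction r)
  case 0
  then show ?case by (simp add: proj_size_def)
next
  case (Suc r)
  define a where "a = proj_size p (Suc r)"
  have a: "a \<ge> 0" "(real p - 1) * a = real p ^ Suc r - 1"
    using p2 proj_size_nonneg[of "Suc r"] by (simp_all add: a_def proj_size_def del: power_Suc)
  have "3 / 2 * esym2 p (Suc (Suc r)) = 3 / 2 * esym2 p (Suc r) + 3 / 2 * (real p ^ Suc r * a)"
    by (simp add: a_def algebra_simps)
  also have "\<dots> \<le> a * (real p ^ r * (1 + 3 / 2 * real p) - 1)"
    using Suc by (simp add: a_def[symmetric] algebra_simps)
  also have "\<dots> \<le> a * (real p ^ r * (real p * real p) - 1)"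
  proof (intro mult_left_mono diff_right_mono a)
    have "0 \<le> (real p - 2) * (real p + 1 / 2)" using p2 by (intro mult_nonneg_nonneg) auto
    then show "1 + 3 / 2 * real p \<le> real p * real p" by (simp add: algebra_simps)
  qed auto
  also have "\<dots> = a * (real p * (real p ^ Suc r - 1)) + (real p - 1) * a" by (simp add: algebra_simps)
  also have "\<dots> = proj_size p (Suc (Suc r)) * (real p ^ Suc r - 1)"
    unfolding a proj_size_Suc(1)[of "Suc r"] a_def[symmetric] by (simp add: algebra_simps)
  finally show ?case .
qed

text \<open>Bonferroni inequalities: as long as all p^i x lie in [0, 1], truncating the alternating
  expansion of the product into elementary symmetric functions errs by the sign of the first omitted
  term.\<close>

lemma prod_bounds:
  assumes x: "x \<ge> 0" and "\<And>i. i < r \<Longrightarrow> real p ^ i * x \<le> 1"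
  shows "0 \<le> (\<Prod>i<r. 1 - real p ^ i * x)"
    "1 - proj_size p r * x \<le> (\<Prod>i<r. 1 - real p ^ i * x)"
    "(\<Prod>i<r. 1 - real p ^ i * x) \<le> 1 - proj_size p r * x + esym2 p r * x\<^sup>2"
    "(\<Prod>i<r. 1 - real p ^ i * x) \<le> 1"
proof -
  have "0 \<le> (\<Prod>i<r. 1 - real p ^ i * x) \<and> (\<Prod>i<r. 1 - real p ^ i * x) \<le> 1
    \<and> 1 - proj_size p r * x \<le> (\<Prod>i<r. 1 - real p ^ i * x)
    \<and> (\<Prod>i<r. 1 - real p ^ i * x) \<le> 1 - proj_size p r * x + esym2 p r * x\<^sup>2"
    using assms(2)
  proof (induction r)
    case 0
    then show ?case by (simp add: proj_size_def)
  next
    case (Suc r)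
    define A where "A = (\<Prod>i<r. 1 - real p ^ i * x)"
    define y where "y = real p ^ r * x"
    define a where "a = proj_size p r"
    have y: "0 \<le> y" "y \<le> 1" using Suc.prems[of r] x by (auto simp: y_def)
    have IH: "0 \<le> A" "A \<le> 1" "1 - a * x \<le> A" "A \<le> 1 - a * x + esym2 p r * x\<^sup>2"
      using Suc by (auto simp: A_def a_def)
    have a0: "a \<ge> 0" using proj_size_nonneg by (auto simp: a_def)
    have eq: "(\<Prod>i<Suc r. 1 - real p ^ i * x) = A * (1 - y)" by (simp add: A_def y_def)
    have ps: "proj_size p (Suc r) * x = a * x + y" unfolding proj_size_Suc(2) by (simp add: a_def y_def algebra_simps)
    have 1: "0 \<le> A * (1 - y)" using IH y by simp
    have 2: "A * (1 - y) \<le> 1" using IH y by (intro mult_le_one) auto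
    have "1 - (a * x + y) \<le> A - y" using IH by simp
    also have "\<dots> \<le> A * (1 - y)" using IH y mult_right_mono[of A 1 y] by (simp add: algebra_simps)
    finally have 3: "1 - (a * x + y) \<le> A * (1 - y)" .
    have "A * (1 - y) \<le> (1 - a * x + esym2 p r * x\<^sup>2) * (1 - y)" using IH y by (intro mult_right_mono) auto
    also have "\<dots> = 1 - (a * x + y) + (esym2 p r * x\<^sup>2 + y * a * x) - esym2 p r * x\<^sup>2 * y"
      by (simp add: algebra_simps)
    also have "\<dots> \<le> 1 - (a * x + y) + (esym2 p r * x\<^sup>2 + y * a * x)"
      using esym2_nonneg[of r] y by simp
    also have "esym2 p r * x\<^sup>2 + y * a * x = esym2 p (Suc r) * x\<^sup>2"
      by (simp add: y_def a_def algebra_simps power2_eq_square)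
    finally show ?case unfolding eq ps using 1 2 3 by simp
  qed
  then show "0 \<le> (\<Prod>i<r. 1 - real p ^ i * x)"
    "1 - proj_size p r * x \<le> (\<Prod>i<r. 1 - real p ^ i * x)"
    "(\<Prod>i<r. 1 - real p ^ i * x) \<le> 1 - proj_size p r * x + esym2 p r * x\<^sup>2"
    "(\<Prod>i<r. 1 - real p ^ i * x) \<le> 1" by auto
qed

end

text \<open>This is the error relative to w_m(G): F stands for \<eta>_{n+m}/\<eta>_\<infinity>, and
  c - \<open>proj_size p r\<close> for \<lambda>_m(G)/w_m(G). The bound is expressed through the
  order of GL_r(F_p) because the upper bound for w_m(G) carries the same quantity in its
  denominator.\<close>

lemma expansion_remainder_bound:
  fixes x s F :: real
  assumes p2: "p \<ge> 2" and r: "r \<ge> 1" and n: "n \<ge> 1" and x: "x = 1 / real p ^ n"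
    and s: "s = c * x" "0 < c" "c * (real p - 1) \<le> 1" and F: "1 + s \<le> F" "F \<le> 1 + s + 2 * s\<^sup>2"
  shows "real p * \<bar>(\<Prod>i<r. 1 - real p ^ i * x) * F - 1 - (c - proj_size p r) * x\<bar> \<le> 2 * gl_size p r * x\<^sup>2"
proof -
  define A where "A = (\<Prod>i<r. 1 - real p ^ i * x)"
  define a where "a = proj_size p r"
  define D where "D = A * F - 1 - (c - a) * x"
  have pn: "real p \<le> real p ^ n" using p2 n by (intro self_le_power) auto
  have x0: "0 < x" "real p ^ n * x = 1" using p2 by (auto simp: x)
  have "2 \<le> real p ^ n" using pn p2 by linarith
  then have x2: "x \<le> 1 / 2" unfolding x by (intro divide_left_mono) (use p2 in auto)
  have "c * 1 \<le> c * (real p - 1)" using s p2 by (intro mult_left_mono) auto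
  also have "\<dots> \<le> 1" by (rule s)
  finally have c1: "c \<le> 1" by simp
  have s0: "0 < s" "s \<le> 1 / 2" using s x0 x2 c1 mult_mono[of c 1 x "1/2"] by auto
  have cx: "c * x \<le> x" using mult_right_mono[OF c1, of x] x0 by simp
  have a1: "a \<ge> 1" using p2 r self_le_power[of "real p" r] by (simp add: a_def proj_size_def field_simps)
  show ?thesis
  proof (cases "r \<le> n")
    \<comment> \<open>For r \<le> n all p^i x with i < r are at most 1, so the Bonferroni bounds
      apply.\<close>
    case True
    have le1: "real p ^ i * x \<le> 1" if "i < r" for i
    proof -
      have "real p ^ i * x \<le> real p ^ n * x" using that True p2 x0 by (intro mult_right_mono power_increasing) auto
      then show ?thesis using x0 by simp
    qed
    note A = prod_bounds[OF p2 less_imp_le[OF x0(1)] le1, of r, folded A_def a_def]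
    have "(1 - a * x) * (1 + s) \<le> A * (1 + s)" using A s0 by (intro mult_right_mono) auto
    also have "\<dots> \<le> A * F" using A F by (intro mult_left_mono) auto
    finally have lower: "- (a * c * x\<^sup>2) \<le> D" by (simp add: D_def s power2_eq_square algebra_simps)
    have "A * F \<le> A * (1 + s) + 1 * (2 * s\<^sup>2)"
      using mult_left_mono[OF F(2) A(1)] mult_right_mono[OF A(4), of "2 * s\<^sup>2"] by (simp add: algebra_simps)
    also have "A * (1 + s) \<le> (1 - a * x + esym2 p r * x\<^sup>2) * (1 + s)"
      using A s0 by (intro mult_right_mono) auto
    finally have upper: "D \<le> (esym2 p r * (1 + s) + 2 * c\<^sup>2 - a * c) * x\<^sup>2"
      by (simp add: D_def s power2_eq_square algebra_simps)
    show ?thesis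
    proof (cases "r = 1")
      case True
      have g: "gl_size p r = real p - 1" using True p2 by (simp add: gl_size_def eta_def field_simps)
      have a': "a = 1" using True p2 by (simp add: a_def proj_size_def)
      have e': "esym2 p r = 0" using True by (simp add: proj_size_def)
      \<comment> \<open>For r = 1 there is no symmetric function of degree 2, and the errors of the
        two factors are both of size c x^2. The claim then follows from c \<le> 1 and p \<le> 2 (p -
        1).\<close>
      have "2 * c\<^sup>2 - c \<le> c" using c1 s mult_left_mono[of c 1 c] by (simp add: power2_eq_square)
      then have "(2 * c\<^sup>2 - c) * x\<^sup>2 \<le> c * x\<^sup>2" by (intro mult_right_mono) auto
      then have "\<bar>D\<bar> \<le> c * x\<^sup>2" using lower upper by (simp add: a' e' abs_le_iff)
      then have "real p * \<bar>D\<bar> \<le> (real p * c) * x\<^sup>2" using mult_left_mono[of "\<bar>D\<bar>" "c * x\<^sup>2" "real p"] by simp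
      also have "\<dots> \<le> (2 * (real p - 1)) * x\<^sup>2"
        using p2 c1 mult_left_mono[OF c1, of "real p"] s by (intro mult_right_mono) (auto simp: algebra_simps)
      finally show ?thesis by (simp add: D_def A_def a_def g)
    next
      case False
      then obtain k where k: "r = Suc k" "k \<ge> 1" using r by (cases r) auto
      have r2: "r \<ge> 2" using k by simp
      have pk: "1 \<le> real p ^ k" using p2 by simp
      \<comment> \<open>This is where rank 1 has to be split off: \<open>esym2_le\<close> leaves a
        spare -a, which absorbs 2 c^2 \<le> 2 once a \<ge> 2.\<close>
      have a2: "a \<ge> 2"
      proof -
        have "a = real p * proj_size p k + 1" unfolding a_def k by (rule proj_size_Suc(1)[OF p2])
        moreover have "proj_size p k \<ge> 1" using p2 k self_le_power[of "real p" k] by (simp add: proj_size_def field_simps)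
        ultimately show ?thesis using p2 mult_mono[of 1 "real p" 1 "proj_size p k"] by simp
      qed
      have e: "3 / 2 * esym2 p r \<le> a * (real p ^ k - 1)" using esym2_le[OF p2, of k] by (simp add: k a_def)
      have "esym2 p r * (1 + s) \<le> esym2 p r * (3 / 2)"
        using s0 esym2_nonneg[OF p2, of r] by (intro mult_left_mono) auto
      moreover have "c\<^sup>2 \<le> 1" using c1 s by (simp add: power_le_one)
      moreover have "0 \<le> a * c" using a1 s by simp
      ultimately have "esym2 p r * (1 + s) + 2 * c\<^sup>2 - a * c \<le> a * real p ^ k"
        using e a2 by (simp add: algebra_simps)
      then have "(esym2 p r * (1 + s) + 2 * c\<^sup>2 - a * c) * x\<^sup>2 \<le> a * real p ^ k * x\<^sup>2"
        by (intro mult_right_mono) auto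
      moreover have "a * c * x\<^sup>2 \<le> a * real p ^ k * x\<^sup>2"
        using c1 pk a1 by (intro mult_right_mono mult_left_mono) auto
      ultimately have "\<bar>D\<bar> \<le> a * real p ^ k * x\<^sup>2" using lower upper by (simp add: abs_le_iff)
      then have "real p * \<bar>D\<bar> \<le> (real p ^ r * a) * x\<^sup>2"
        using mult_left_mono[of "\<bar>D\<bar>" "a * real p ^ k * x\<^sup>2" "real p"] by (simp add: k mult_ac)
      also have "\<dots> \<le> (2 * gl_size p r) * x\<^sup>2"
        using proj_size_le_gl_size[OF p2 r2] by (intro mult_right_mono) (auto simp: a_def)
      finally show ?thesis by (simp add: D_def A_def a_def)
    qed
  next
    case False
    then obtain k where k: "r = Suc k" "n \<le> k" by (cases r) auto
    have r2: "r \<ge> 2" using k n by simp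
    \<comment> \<open>For n < r the factor with i = n vanishes, since n generators cannot generate a
      group of rank r. Now D need not be small, but x^2 is not small either: with r = k + 1 and n
      \<le> k one has x \<le> p^k x^2 and 1 \<le> p^(2k) x^2, and p^k \<le> a.\<close>
    have "A = 0" unfolding A_def using False x0 by (intro prod_zero) (auto intro!: bexI[of _ n])
    then have D: "D = - 1 - c * x + a * x" by (simp add: D_def algebra_simps)
    have pnk: "real p ^ n \<le> real p ^ k" using k p2 by (intro power_increasing) auto
    have ak: "real p ^ k \<le> a" using proj_size_Suc(2)[OF p2, of k] proj_size_nonneg[OF p2, of k] by (simp add: a_def k)
    have xe: "x = real p ^ n * x\<^sup>2" "1 = real p ^ n * real p ^ n * x\<^sup>2"
      using x0 by (auto simp: power2_eq_square x)
    have "a * x \<le> a * real p ^ k * x\<^sup>2"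
      by (subst xe(1)) (use pnk a1 in \<open>auto intro!: mult_right_mono mult_left_mono\<close>)
    moreover have "1 \<le> a * real p ^ k * x\<^sup>2"
      by (subst xe(2)) (use pnk ak a1 in \<open>auto intro!: mult_right_mono mult_mono\<close>)
    moreover have "c * x \<le> a * x" using c1 a1 x0 by (intro mult_right_mono) auto
    ultimately have "\<bar>D\<bar> \<le> a * real p ^ k * x\<^sup>2"
      using s0 s unfolding D by (simp add: abs_le_iff)
    then have "real p * \<bar>D\<bar> \<le> (real p ^ r * a) * x\<^sup>2"
      using mult_left_mono[of "\<bar>D\<bar>" "a * real p ^ k * x\<^sup>2" "real p"] by (simp add: k mult_ac)
    also have "\<dots> \<le> (2 * gl_size p r) * x\<^sup>2"
      using proj_size_le_gl_size[OF p2 r2] by (intro mult_right_mono) (auto simp: a_def)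
    finally show ?thesis by (simp add: D_def A_def a_def)
  qed
qed

text \<open>Here v stands for 1/(|G|^m |Aut(G)|). The assumption \<open>hyp\<close> says that the
  exact value at n = r is at most p^(-r(r+m)); as it does not involve n, it bounds v once and for
  all.\<close>

lemma expansion_bound:
  fixes v :: real
  assumes p2: "p \<ge> 2" and n: "n \<ge> 1" and v: "v > 0"
    and hyp: "v * (eta p (enat r) * eta p (enat (r + m)) / eta p (enat m)) \<le> 1 / real p ^ (r * (r + m))"
  defines "w \<equiv> eta p \<infinity> / eta p (enat m) * v"
  shows "\<bar>v * ((\<Prod>i<r. 1 - real p ^ i / real p ^ n) * (eta p (enat (n + m)) / eta p (enat m)))
      - (w + w * (1 + 1 / real p ^ m - real p ^ r) / (real p - 1) / real p ^ n)\<bar>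
     \<le> sqrt ((eta p (enat m))\<^sup>2 / (eta p \<infinity>)\<^sup>2 - 1) / real p ^ (2 * n)"
proof -
  define x where "x = 1 / real p ^ n"
  define c where "c = 1 / (real p ^ m * (real p - 1))"
  define s where "s = c * x"
  define F where "F = eta p (enat (n + m)) / eta p \<infinity>"
  define \<delta> where "\<delta> = 1 / real p ^ Suc m"
  define D where "D = (\<Prod>i<r. 1 - real p ^ i * x) * F - 1 - (c - proj_size p r) * x"
  note pos = eta_enat_pos[OF p2] eta_infinity(2)[OF p2]
  have E0: "0 < eta p \<infinity>" and em0: "0 < eta p (enat m)" and er0: "0 < eta p (enat r)" by (rule pos)+
  have pn: "real p \<le> real p ^ n" using p2 n by (intro self_le_power) auto
  have "2 \<le> real p ^ n" using pn p2 by linarith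
  then have x0: "0 < x" "x \<le> 1 / 2" using p2 by (auto simp: x_def field_simps)
  have pm: "1 \<le> real p ^ m" using p2 by simp
  have "c * (real p - 1) = 1 / real p ^ m" using p2 by (simp add: c_def)
  then have c0: "0 < c" "c * (real p - 1) \<le> 1" using p2 pm by (auto simp: c_def)
  have "c * 1 \<le> c * (real p - 1)" using c0 p2 by (intro mult_left_mono) auto
  also have "\<dots> \<le> 1" by (rule c0)
  finally have c1: "c \<le> 1" by simp
  have s0: "0 < s" "s \<le> 1 / 2" using c0 x0 c1 mult_mono[of c 1 x "1/2"] by (auto simp: s_def)
  have s_eq: "s = 1 / (real p ^ (n + m) * (real p - 1))" by (simp add: s_def c_def x_def power_add)
  have F1: "1 + s \<le> F"
    using eta_infinity_bounds(2)[OF p2, of "n + m"] pos(2) by (simp add: F_def s_eq field_simps)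
  have "F * (1 - s) \<le> 1"
    using eta_infinity_bounds(1)[OF p2, of "n + m"] pos(2) unfolding F_def s_eq[symmetric] by (simp add: field_simps)
  \<comment> \<open>This encodes 1/(1 - s) \<le> 1 + s + 2 s^2, valid for 0 \<le> s \<le>
    1/2.\<close>
  also have "1 \<le> (1 + s + 2 * s\<^sup>2) * (1 - s)"
  proof -
    have "0 \<le> s\<^sup>2 * (1 - 2 * s)" using s0 by simp
    then show ?thesis by (simp add: power2_eq_square algebra_simps)
  qed
  finally have F2: "F \<le> 1 + s + 2 * s\<^sup>2" using s0 by simp
  have w0: "w > 0" using pos v by (simp add: w_def)
  \<comment> \<open>The summand c is the first-order term of \<eta>_{n+m}/\<eta>_\<infinity>, and -
    \<open>proj_size p r\<close> that of the product over i < r.\<close>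
  have coeff: "(1 + 1 / real p ^ m - real p ^ r) / (real p - 1) = c - proj_size p r"
    by (simp add: c_def proj_size_def diff_divide_distrib add_divide_distrib)
  have lhs: "v * ((\<Prod>i<r. 1 - real p ^ i / real p ^ n) * (eta p (enat (n + m)) / eta p (enat m)))
      - (w + w * (1 + 1 / real p ^ m - real p ^ r) / (real p - 1) / real p ^ n) = w * D"
  proof -
    have "w * (1 + 1 / real p ^ m - real p ^ r) / (real p - 1) / real p ^ n = w * (c - proj_size p r) * x"
      unfolding coeff[symmetric] by (simp add: x_def)
    moreover have "(\<Prod>i<r. 1 - real p ^ i / real p ^ n) = (\<Prod>i<r. 1 - real p ^ i * x)" by (simp add: x_def)
    moreover have "v * (P * (eta p (enat (n + m)) / eta p (enat m))) = w * (P * F)" for P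
      using E0 by (simp add: w_def F_def)
    ultimately show ?thesis unfolding D_def by (simp only:) (simp add: algebra_simps)
  qed
  have "w * \<bar>D\<bar> \<le> 2 * \<delta> * x\<^sup>2"
  proof (cases "r = 0")
    \<comment> \<open>For r = 0 the bound on w contains no power of p^m. The decay comes from s = c
      x instead, through c \<le> 2 \<delta>; the resulting factor 4 \<delta> (1 - \<delta>) is at
      most 1 because of w \<le> 1 - \<delta>, so plain w \<le> 1 would not suffice for this
      argument.\<close>
    case True
    have "D = F - 1 - s" using True by (simp add: D_def proj_size_def s_def)
    then have D: "\<bar>D\<bar> \<le> 2 * s\<^sup>2" using F1 F2 by simp
    have \<delta>0: "0 < \<delta>" using p2 by (simp add: \<delta>_def)
    have c\<delta>: "c \<le> 2 * \<delta>" using p2 pm by (simp add: c_def \<delta>_def field_simps)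
    have "v \<le> 1" using hyp True pos(1)[of m] by (simp add: eta_0)
    then have "w \<le> eta p \<infinity> / eta p (enat m)" using E0 em0 mult_left_mono[of v 1 "eta p \<infinity> / eta p (enat m)"]
      by (simp add: w_def)
    also have "\<dots> \<le> 1 - \<delta>"
      using eta_infinity_le[OF p2, of "Suc m"] em0 by (simp add: eta_Suc \<delta>_def[symmetric] pos_divide_le_eq mult.commute del: power_Suc)
    finally have w1: "w \<le> 1 - \<delta>" .
    have "w * \<bar>D\<bar> \<le> (1 - \<delta>) * (2 * s\<^sup>2)" using w0 w1 D by (intro mult_mono) auto
    also have "\<dots> = (1 - \<delta>) * 2 * x\<^sup>2 * c\<^sup>2" by (simp add: s_def power_mult_distrib)
    also have "\<dots> \<le> (1 - \<delta>) * 2 * x\<^sup>2 * (2 * \<delta>)\<^sup>2"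
      using c\<delta> c0 w0 w1 by (intro mult_left_mono power_mono) auto
    also have "\<dots> = 2 * \<delta> * x\<^sup>2 * (4 * \<delta> * (1 - \<delta>))" by (simp add: power2_eq_square)
    also have "\<dots> \<le> 2 * \<delta> * x\<^sup>2 * 1"
    proof (intro mult_left_mono)
      have "0 \<le> (1 - 2 * \<delta>)\<^sup>2" by simp
      then show "4 * \<delta> * (1 - \<delta>) \<le> 1" by (simp add: power2_eq_square algebra_simps)
    qed (use \<delta>0 in auto)
    finally show ?thesis by simp
  next
    case False
    then have r: "r \<ge> 1" by simp
    have D: "real p * \<bar>D\<bar> \<le> 2 * gl_size p r * x\<^sup>2"
      unfolding D_def by (rule expansion_remainder_bound[OF p2 r n x_def s_def c0 F1 F2])
    \<comment> \<open>Enlarging \<open>eta p \<infinity>\<close> to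
      \<open>eta p (enat (r + m))\<close> brings w into the shape bounded by \<open>hyp\<close>;
      dividing by \<eta>_r(p) then puts the order of GL_r(F_p) into the denominator.\<close>
    have "w \<le> v * (eta p (enat (r + m)) / eta p (enat m))"
      using eta_infinity_le[OF p2, of "r + m"] em0 v
      by (simp add: w_def mult.commute[of _ v] divide_right_mono mult_left_mono)
    also have "\<dots> \<le> 1 / (real p ^ (r * (r + m)) * eta p (enat r))"
    proof -
      have "v * (eta p (enat (r + m)) / eta p (enat m)) * eta p (enat r) \<le> 1 / real p ^ (r * (r + m))"
        using hyp by (simp add: mult_ac)
      then have "v * (eta p (enat (r + m)) / eta p (enat m)) \<le> 1 / real p ^ (r * (r + m)) / eta p (enat r)"
        using er0 by (subst pos_le_divide_eq)
      then show ?thesis by simp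
    qed
    also have "\<dots> = 1 / (gl_size p r * real p ^ (r * m))"
      by (simp add: gl_size_def power_add distrib_left mult_ac)
    also have "\<dots> \<le> 1 / (gl_size p r * real p ^ m)"
    proof -
      have "real p ^ m \<le> real p ^ (r * m)" using p2 r by (intro power_increasing) auto
      then show ?thesis using gl_size_pos[OF p2, of r] p2 by (intro divide_left_mono mult_left_mono) auto
    qed
    finally have w: "w \<le> 1 / (gl_size p r * real p ^ m)" .
    have "w * \<bar>D\<bar> \<le> 1 / (gl_size p r * real p ^ m) * (2 * gl_size p r * x\<^sup>2 / real p)"
    proof (rule mult_mono[OF w])
      show "\<bar>D\<bar> \<le> 2 * gl_size p r * x\<^sup>2 / real p" using D p2 by (simp add: pos_le_divide_eq mult.commute)
    qed (use gl_size_pos[OF p2, of r] in auto)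
    also have "\<dots> = 2 * \<delta> * x\<^sup>2" using gl_size_pos[OF p2, of r] by (simp add: \<delta>_def)
    finally show ?thesis .
  qed
  also have "\<dots> \<le> sqrt ((eta p (enat m))\<^sup>2 / (eta p \<infinity>)\<^sup>2 - 1) * x\<^sup>2"
    using sqrt_eta_bound[OF p2, of m] by (intro mult_right_mono) (auto simp: \<delta>_def)
  also have "\<dots> = sqrt ((eta p (enat m))\<^sup>2 / (eta p \<infinity>)\<^sup>2 - 1) / real p ^ (2 * n)"
    by (simp add: x_def power_divide power_mult[symmetric] mult.commute)
  finally show ?thesis unfolding lhs using w0 by (simp add: abs_mult)
qed

section \<open>Cokernels modulo $p^{k+1}$\<close>

abbreviation Zmod_vec :: "nat \<Rightarrow> nat \<Rightarrow> (nat \<Rightarrow> int) monoid" where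
  "Zmod_vec q n \<equiv> product_group {..<n} (\<lambda>_. integer_mod_group q)"

abbreviation gen_lists :: "('a, 'b) monoid_scheme \<Rightarrow> nat \<Rightarrow> 'a list set" where
  "gen_lists G t \<equiv> {xs. length xs = t \<and> set xs \<subseteq> carrier G \<and> generate G (set xs) = carrier G}"

section \<open>The groups (Z/q)^n and their surjections onto G\<close>

lemma comm_group_product_group:
  assumes "\<And>i. i \<in> I \<Longrightarrow> comm_group (G i)"
  shows "comm_group (product_group I G)"
proof (rule group.group_comm_groupI)
  show "group (product_group I G)" using assms by (simp add: comm_group.axioms)
  fix x y assume "x \<in> carrier (product_group I G)" "y \<in> carrier (product_group I G)"
  then show "x \<otimes>\<^bsub>product_group I G\<^esub> y = y \<otimes>\<^bsub>product_group I G\<^esub> x"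
    using assms by (auto simp: fun_eq_iff PiE_iff comm_group_def comm_monoid.m_comm)
qed

lemma carrier_Zmod_vec: "q > 0 \<Longrightarrow> carrier (Zmod_vec q n) = {..<n} \<rightarrow>\<^sub>E {0..<int q}"
  by (simp add: carrier_integer_mod_group)

lemma comm_group_Zmod_vec: "comm_group (Zmod_vec q n)"
  by (rule comm_group_product_group) simp

lemma order_Zmod_vec: "q > 0 \<Longrightarrow> order (Zmod_vec q n) = q ^ n"
  unfolding order_def carrier_Zmod_vec by (simp add: card_PiE)

lemma finite_Zmod_vec: "q > 0 \<Longrightarrow> finite (carrier (Zmod_vec q n))"
  unfolding carrier_Zmod_vec by (intro finite_PiE) auto

lemma pow_Zmod_vec:
  assumes "x \<in> carrier (Zmod_vec q n)"
  shows "x [^]\<^bsub>Zmod_vec q n\<^esub> (k::nat) = (\<lambda>i\<in>{..<n}. (int k * x i) mod int q)"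
proof (induction k)
  case 0
  show ?case by (auto simp: fun_eq_iff nat_pow_def)
next
  case (Suc k)
  have "x [^]\<^bsub>Zmod_vec q n\<^esub> Suc k = x [^]\<^bsub>Zmod_vec q n\<^esub> k \<otimes>\<^bsub>Zmod_vec q n\<^esub> x"
    by (simp add: nat_pow_def)
  then show ?case unfolding Suc by (auto simp: fun_eq_iff mod_simps algebra_simps)
qed

definition unit_vec_mod :: "nat \<Rightarrow> nat \<Rightarrow> nat \<Rightarrow> int" where
  "unit_vec_mod n j = (\<lambda>i\<in>{..<n}. if i = j then 1 else 0)"

lemma unit_vec_mod_carrier: "q > 1 \<Longrightarrow> unit_vec_mod n j \<in> carrier (Zmod_vec q n)"
  by (auto simp: unit_vec_mod_def carrier_integer_mod_group)

lemma generate_unit_vecs: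
  assumes q: "q > 1"
  shows "generate (Zmod_vec q n) (unit_vec_mod n ` {..<n}) = carrier (Zmod_vec q n)" (is "?L = _")
proof
  interpret A: comm_group "Zmod_vec q n" by (rule comm_group_Zmod_vec)
  have sub: "unit_vec_mod n ` {..<n} \<subseteq> carrier (Zmod_vec q n)" using unit_vec_mod_carrier[OF q] by blast
  then have S: "subgroup ?L (Zmod_vec q n)" by (rule A.generate_is_subgroup)
  show "?L \<subseteq> carrier (Zmod_vec q n)" by (rule A.generate_incl[OF sub])
  show "carrier (Zmod_vec q n) \<subseteq> ?L"
  proof
    fix x assume x: "x \<in> carrier (Zmod_vec q n)"
    have xP: "x \<in> {..<n} \<rightarrow>\<^sub>E {0..<int q}" using x carrier_Zmod_vec[of q n] q by simp
    have x': "x i \<in> {0..<int q}" if "i < n" for i using PiE_mem[OF xP] that by simp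
    have "(\<lambda>i\<in>{..<n}. if i < k then x i else 0) \<in> ?L" if "k \<le> n" for k
      using that
    proof (induction k)
      case 0
      have "(\<lambda>i\<in>{..<n}. if i < 0 then x i else 0) = \<one>\<^bsub>Zmod_vec q n\<^esub>" by (auto simp: fun_eq_iff)
      then show ?case by (simp only: generate.one)
    next
      case (Suc k)
      have e: "unit_vec_mod n k \<in> ?L" using Suc by (intro generate.incl) auto
      have "unit_vec_mod n k [^]\<^bsub>Zmod_vec q n\<^esub> (int (nat (x k))) \<in> ?L"
        by (rule A.subgroup_int_pow_closed[OF S e])
      then have "unit_vec_mod n k [^]\<^bsub>Zmod_vec q n\<^esub> (nat (x k)) \<in> ?L" by (simp only: int_pow_int)
      then have "(\<lambda>i\<in>{..<n}. if i < k then x i else 0) \<otimes>\<^bsub>Zmod_vec q n\<^esub> unit_vec_mod n k [^]\<^bsub>Zmod_vec q n\<^esub> (nat (x k)) \<in> ?L"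
      proof (rule generate.eng[rotated])
        show "(\<lambda>i\<in>{..<n}. if i < k then x i else 0) \<in> ?L" by (rule Suc.IH) (use Suc.prems in simp)
      qed
      also have "(\<lambda>i\<in>{..<n}. if i < k then x i else 0) \<otimes>\<^bsub>Zmod_vec q n\<^esub> unit_vec_mod n k [^]\<^bsub>Zmod_vec q n\<^esub> (nat (x k))
          = (\<lambda>i\<in>{..<n}. if i < Suc k then x i else 0)"
        unfolding pow_Zmod_vec[OF unit_vec_mod_carrier[OF q]]
        using x' by (auto simp: fun_eq_iff unit_vec_mod_def less_Suc_eq)
      finally show ?case .
    qed
    from this[of n] have "(\<lambda>i\<in>{..<n}. if i < n then x i else 0) \<in> ?L" by simp
    also have "(\<lambda>i\<in>{..<n}. if i < n then x i else 0) = x"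
      using x by (auto simp: fun_eq_iff PiE_iff extensional_def)
    finally show "x \<in> ?L" .
  qed
qed

lemma hom_eq_on_generate:
  assumes "group A" "group G" "\<phi> \<in> hom A G" "\<psi> \<in> hom A G" "S \<subseteq> carrier A"
    "\<And>s. s \<in> S \<Longrightarrow> \<phi> s = \<psi> s" "x \<in> generate A S"
  shows "\<phi> x = \<psi> x"
proof -
  interpret f: group_hom A G \<phi> using assms by (simp add: group_hom_def group_hom_axioms_def)
  interpret g: group_hom A G \<psi> using assms by (simp add: group_hom_def group_hom_axioms_def)
  show ?thesis using assms(7)
  proof (induction rule: generate.induct)
    case (eng x y)
    then show ?case using f.G.generate_in_carrier[OF assms(5)] by simp
  qed (use assms(5,6) in auto)
qed

lemma (in comm_group) int_pow_mod_exponent: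
  assumes "g \<in> carrier G" "g [^] (q::nat) = \<one>"
  shows "g [^] (a mod int q) = g [^] (a::int)"
proof -
  have "g [^] a = g [^] (int q * (a div int q) + a mod int q)" by simp
  also have "\<dots> = (g [^] int q) [^] (a div int q) \<otimes> g [^] (a mod int q)"
    unfolding int_pow_mult[OF assms(1)] using assms(1) by (simp add: int_pow_pow)
  also have "g [^] int q = \<one>" using assms(2) by (simp add: int_pow_int)
  finally show ?thesis using assms(1) by simp
qed

text \<open>As q annihilates G, the group (Z/q)^n is free for maps into G: the images of the unit
  vectors can be prescribed arbitrarily, and the map is onto exactly when they generate G.\<close>

lemma card_epis_Zmod_vec:
  assumes "comm_group G" and q: "q > 1" and ex: "\<And>g. g \<in> carrier G \<Longrightarrow> g [^]\<^bsub>G\<^esub> q = \<one>\<^bsub>G\<^esub>"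
  shows "card (epis (Zmod_vec q n) G) = card (gen_lists G n)"
proof -
  let ?A = "Zmod_vec q n" and ?e = "unit_vec_mod n"
  interpret G: comm_group G by fact
  interpret A: comm_group ?A by (rule comm_group_Zmod_vec)
  have esub: "?e ` {..<n} \<subseteq> carrier ?A" using unit_vec_mod_carrier[OF q] by blast
  have onto: "\<phi> ` carrier ?A = generate G (set (map (\<lambda>j. \<phi> (?e j)) [0..<n]))" if "\<phi> \<in> hom ?A G" for \<phi>
  proof -
    interpret group_hom ?A G \<phi> using that by unfold_locales
    have "set (map (\<lambda>j. \<phi> (?e j)) [0..<n]) = \<phi> ` ?e ` {..<n}" by auto
    then show ?thesis using generate_img[OF esub] generate_unit_vecs[OF q, of n] by simp
  qed
  have "bij_betw (\<lambda>\<phi>. map (\<lambda>j. \<phi> (?e j)) [0..<n]) (epis ?A G) (gen_lists G n)"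
    unfolding bij_betw_def
  proof
    show "inj_on (\<lambda>\<phi>. map (\<lambda>j. \<phi> (?e j)) [0..<n]) (epis ?A G)"
    proof (rule inj_onI)
      fix \<phi> \<psi> assume a: "\<phi> \<in> epis ?A G" "\<psi> \<in> epis ?A G"
        "map (\<lambda>j. \<phi> (?e j)) [0..<n] = map (\<lambda>j. \<psi> (?e j)) [0..<n]"
      have h: "\<phi> \<in> hom ?A G" "\<psi> \<in> hom ?A G" using a by (auto simp: epis_def)
      have "\<phi> x = \<psi> x" if "x \<in> carrier ?A" for x
        by (rule hom_eq_on_generate[OF A.is_group G.is_group h esub])
          (use a(3) that generate_unit_vecs[OF q, of n] in auto)
      then show "\<phi> = \<psi>" using a by (intro extensionalityI[of _ "carrier ?A"]) (auto simp: epis_def)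
    qed
    show "(\<lambda>\<phi>. map (\<lambda>j. \<phi> (?e j)) [0..<n]) ` epis ?A G = gen_lists G n"
    proof (intro equalityI subsetI)
      fix gs assume "gs \<in> (\<lambda>\<phi>. map (\<lambda>j. \<phi> (?e j)) [0..<n]) ` epis ?A G"
      then obtain \<phi> where \<phi>: "\<phi> \<in> epis ?A G" "gs = map (\<lambda>j. \<phi> (?e j)) [0..<n]" by blast
      have h: "\<phi> \<in> hom ?A G" "\<phi> ` carrier ?A = carrier G" using \<phi> by (auto simp: epis_def)
      have "set gs \<subseteq> carrier G" using \<phi>(2) hom_in_carrier[OF h(1)] unit_vec_mod_carrier[OF q] by auto
      then show "gs \<in> gen_lists G n" using onto[OF h(1)] h \<phi>(2) by simp
    next
      fix gs assume gs: "gs \<in> gen_lists G n"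
      then have gsc: "gs ! i \<in> carrier G" if "i < n" for i using that by auto
      define \<phi> where "\<phi> = restrict (\<lambda>x. finprod G (\<lambda>i. gs ! i [^]\<^bsub>G\<^esub> (x i :: int)) {..<n}) (carrier ?A)"
      have hom: "\<phi> \<in> hom ?A G"
      proof (rule homI)
        show "\<phi> x \<in> carrier G" if "x \<in> carrier ?A" for x
          using that gsc by (auto simp: \<phi>_def intro!: G.finprod_closed)
        fix x y assume xy: "x \<in> carrier ?A" "y \<in> carrier ?A"
        have "\<phi> (x \<otimes>\<^bsub>?A\<^esub> y) = finprod G (\<lambda>i. gs ! i [^]\<^bsub>G\<^esub> (x i + y i)) {..<n}"
        proof -
          have "\<phi> (x \<otimes>\<^bsub>?A\<^esub> y) = finprod G (\<lambda>i. gs ! i [^]\<^bsub>G\<^esub> ((x \<otimes>\<^bsub>?A\<^esub> y) i)) {..<n}"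
            unfolding \<phi>_def by (rule restrict_apply') (rule A.m_closed[OF xy])
          \<comment> \<open>Entries of a sum in (Z/q)^n are reduced modulo q, which powers of an
            element with g^q = 1 do not notice.\<close>
          also have "\<dots> = finprod G (\<lambda>i. gs ! i [^]\<^bsub>G\<^esub> (x i + y i)) {..<n}"
          proof (rule G.finprod_cong')
            show "gs ! i [^]\<^bsub>G\<^esub> ((x \<otimes>\<^bsub>?A\<^esub> y) i) = gs ! i [^]\<^bsub>G\<^esub> (x i + y i)" if "i \<in> {..<n}" for i
              using that gsc G.int_pow_mod_exponent[OF gsc ex[OF gsc]] by simp
          qed (use gsc in auto)
          finally show ?thesis .
        qed
        also have "\<dots> = finprod G (\<lambda>i. gs ! i [^]\<^bsub>G\<^esub> x i \<otimes>\<^bsub>G\<^esub> gs ! i [^]\<^bsub>G\<^esub> y i) {..<n}"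
          using gsc by (intro G.finprod_cong') (auto simp: G.int_pow_mult)
        also have "\<dots> = \<phi> x \<otimes>\<^bsub>G\<^esub> \<phi> y"
          using xy gsc unfolding \<phi>_def restrict_apply'[OF xy(1)] restrict_apply'[OF xy(2)]
          by (intro G.finprod_multf) auto
        finally show "\<phi> (x \<otimes>\<^bsub>?A\<^esub> y) = \<phi> x \<otimes>\<^bsub>G\<^esub> \<phi> y" .
      qed
      have "\<phi> (?e j) = gs ! j" if "j < n" for j
      proof -
        have "\<phi> (?e j) = finprod G (\<lambda>i. gs ! i [^]\<^bsub>G\<^esub> (?e j i)) {..<n}"
          unfolding \<phi>_def by (rule restrict_apply') (rule unit_vec_mod_carrier[OF q])
        also have "\<dots> = finprod G (\<lambda>i. if j = i then gs ! i else \<one>\<^bsub>G\<^esub>) {..<n}"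
          using gsc by (intro G.finprod_cong') (auto simp: unit_vec_mod_def G.int_pow_1)
        also have "\<dots> = gs ! j" using that gsc by (intro G.finprod_singleton) auto
        finally show ?thesis .
      qed
      then have map: "map (\<lambda>j. \<phi> (?e j)) [0..<n] = gs" using gs by (intro nth_equalityI) auto
      then have "\<phi> ` carrier ?A = carrier G" using onto[OF hom] gs by simp
      then have "\<phi> \<in> epis ?A G" using hom by (simp add: epis_def \<phi>_def)
      then show "gs \<in> (\<lambda>\<phi>. map (\<lambda>j. \<phi> (?e j)) [0..<n]) ` epis ?A G" using map by blast
    qed
  qed
  then show ?thesis by (rule bij_betw_same_card)
qed

section \<open>Torsion, p-th powers and rank\<close>

lemma (in group_hom) order_eq_card_kernel_image:
  assumes "finite (carrier G)"
  shows "order G = card (kernel G H h) * card (h ` carrier G)"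
proof -
  have "G Mod kernel G H h \<cong> H\<lparr>carrier := h ` carrier G\<rparr>"
  proof -
    have "group (H\<lparr>carrier := h ` carrier G\<rparr>)"
      by (rule subgroup.subgroup_is_group[OF img_is_subgroup H.is_group])
    moreover have "h \<in> hom G (H\<lparr>carrier := h ` carrier G\<rparr>)" using homh by (auto simp: hom_def)
    ultimately interpret h': group_hom G "H\<lparr>carrier := h ` carrier G\<rparr>" h
      by (simp add: group_hom_def group_hom_axioms_def)
    have "kernel G (H\<lparr>carrier := h ` carrier G\<rparr>) h = kernel G H h" by (simp add: kernel_def)
    then show ?thesis using h'.FactGroup_iso by simp
  qed
  then have "card (carrier (G Mod kernel G H h)) = card (h ` carrier G)"
    by (auto simp: is_iso_def iso_def dest: bij_betw_same_card)
  then have "card (rcosets\<^bsub>G\<^esub> (kernel G H h)) = card (h ` carrier G)" by (simp add: FactGroup_def)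
  then show ?thesis using G.lagrange[OF subgroup_kernel] by (simp add: mult.commute)
qed

text \<open>The index of the p-th powers equals the order of the p-torsion. The rank of a subgroup
  can thus be read off its torsion, which is easier to locate than its p-th powers.\<close>

lemma (in comm_group) order_eq_card_torsion_pth_powers:
  assumes "finite (carrier G)"
  shows "order G = card {x \<in> carrier G. x [^] p = \<one>} * card (pth_powers p G)"
proof -
  have "(\<lambda>x. x [^] p) \<in> hom G G" by (auto simp: hom_def nat_pow_distrib)
  then interpret group_hom G G "\<lambda>x. x [^] p" by unfold_locales
  show ?thesis using order_eq_card_kernel_image[OF assms] by (simp add: kernel_def)
qed

text \<open>Modulo p^(k+1), p x = 0 means that p^k divides every entry of x; the quotients, taken in
  {0..<p}, parametrise the torsion.\<close>

lemma card_torsion_Zmod_vec: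
  assumes p: "p > 0" and q: "q = p ^ Suc k"
  shows "card {x \<in> carrier (Zmod_vec q n). x [^]\<^bsub>Zmod_vec q n\<^esub> p = \<one>\<^bsub>Zmod_vec q n\<^esub>} = p ^ n"
    "{x \<in> carrier (Zmod_vec q n). x [^]\<^bsub>Zmod_vec q n\<^esub> p = \<one>\<^bsub>Zmod_vec q n\<^esub>}
      \<subseteq> (\<lambda>x. x [^]\<^bsub>Zmod_vec q n\<^esub> (p ^ k)) ` carrier (Zmod_vec q n)"
proof -
  let ?A = "Zmod_vec q n"
  let ?T = "{x \<in> carrier ?A. x [^]\<^bsub>?A\<^esub> p = \<one>\<^bsub>?A\<^esub>}"
  have q0: "q > 0" "p \<le> q" using p q by auto
  define f where "f = (\<lambda>y::nat \<Rightarrow> int. \<lambda>i\<in>{..<n}. int p ^ k * y i)"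
  have bound: "int p ^ k * a \<in> {0..<int q}" if "a \<in> {0..<int p}" for a
    using that p by (auto simp: q mult.commute)
  have f: "f y \<in> carrier ?A" "f y [^]\<^bsub>?A\<^esub> p = \<one>\<^bsub>?A\<^esub>" "f y = y [^]\<^bsub>?A\<^esub> (p ^ k)" "y \<in> carrier ?A"
    if "y \<in> {..<n} \<rightarrow>\<^sub>E {0..<int p}" for y
  proof -
    have y: "y i \<in> {0..<int p}" if "i < n" for i
      by (rule PiE_mem[OF \<open>y \<in> _\<close>]) (use that in simp)
    show 1: "f y \<in> carrier ?A" unfolding carrier_Zmod_vec[OF q0(1)]
    proof (rule PiE_I)
      fix i assume i: "i \<in> {..<n}"
      then have "f y i = int p ^ k * y i" by (simp add: f_def)
      then show "f y i \<in> {0..<int q}" using bound[OF y[of i]] i by (simp only: lessThan_iff)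
    qed (simp add: f_def)
    have "(int p * (int p ^ k * y i)) mod int q = 0" for i
    proof -
      have eq: "int p * (int p ^ k * y i) = int q * y i" by (simp add: q)
      show ?thesis unfolding eq by simp
    qed
    then show "f y [^]\<^bsub>?A\<^esub> p = \<one>\<^bsub>?A\<^esub>" unfolding pow_Zmod_vec[OF 1] by (intro ext) (simp add: f_def)
    show 2: "y \<in> carrier ?A" unfolding carrier_Zmod_vec[OF q0(1)]
    proof (rule PiE_I)
      show "y i \<in> {0..<int q}" if "i \<in> {..<n}" for i using y[of i] q0 that by simp
      show "y i = undefined" if "i \<notin> {..<n}" for i by (rule PiE_arb[OF \<open>y \<in> _\<close> that])
    qed
    show "f y = y [^]\<^bsub>?A\<^esub> (p ^ k)"
      unfolding pow_Zmod_vec[OF 2] using bound[OF y] by (auto simp: f_def fun_eq_iff)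
  qed
  have T: "?T = f ` ({..<n} \<rightarrow>\<^sub>E {0..<int p})"
  proof (intro equalityI subsetI)
    fix x assume x: "x \<in> ?T"
    then have xc: "x \<in> {..<n} \<rightarrow>\<^sub>E {0..<int q}" using carrier_Zmod_vec[OF q0(1)] by simp
    have xp: "int p ^ k dvd x i" if "i < n" for i
    proof -
      have xA: "x \<in> carrier ?A" and x1: "x [^]\<^bsub>?A\<^esub> p = \<one>\<^bsub>?A\<^esub>" using x by blast+
      have "(int p * x i) mod int q = 0"
        using fun_cong[OF trans[OF pow_Zmod_vec[OF xA, symmetric] x1], of i] that by simp
      then have "int q dvd int p * x i" by (simp add: dvd_eq_mod_eq_0)
      then show ?thesis using p by (simp add: q)
    qed
    define y where "y = (\<lambda>i\<in>{..<n}. x i div int p ^ k)"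
    have yi: "y i \<in> {0..<int p}" if i: "i < n" for i
    proof -
      obtain a where a: "x i = int p ^ k * a" using dvdE[OF xp[OF i]] by blast
      have "0 \<le> int p ^ k * a" "int p ^ k * a < int p ^ k * int p"
        using PiE_mem[OF xc, of i] that a by (auto simp: q mult.commute)
      moreover have "0 < int p ^ k" using p by simp
      ultimately have "0 \<le> a" "a < int p" by (auto simp: zero_le_mult_iff)
      then show ?thesis using that p a by (simp add: y_def)
    qed
    have "x = f y" using xc xp by (auto simp: f_def y_def fun_eq_iff PiE_iff extensional_def)
    moreover have "y \<in> {..<n} \<rightarrow>\<^sub>E {0..<int p}" using yi by (auto simp: y_def)
    ultimately show "x \<in> f ` ({..<n} \<rightarrow>\<^sub>E {0..<int p})" by blast
  qed (use f in auto)
  have "inj_on f ({..<n} \<rightarrow>\<^sub>E {0..<int p})"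
  proof (rule inj_onI)
    fix x y assume xy: "x \<in> {..<n} \<rightarrow>\<^sub>E {0..<int p}" "y \<in> {..<n} \<rightarrow>\<^sub>E {0..<int p}" "f x = f y"
    have "x i = y i" if "i < n" for i using fun_cong[OF xy(3), of i] that p by (simp add: f_def)
    then show "x = y" using xy by (intro PiE_ext) auto
  qed
  then have "card ?T = card ({..<n} \<rightarrow>\<^sub>E {0..<int p})" unfolding T by (rule card_image)
  then show "card ?T = p ^ n" by (simp add: card_PiE)
  show "?T \<subseteq> (\<lambda>x. x [^]\<^bsub>?A\<^esub> (p ^ k)) ` carrier ?A" unfolding T using f(3,4) by blast
qed

section \<open>Tuples of columns with prescribed cokernel\<close>

lemma pow_order_in_quotient_kernel:
  assumes "group A" "group G" "N \<lhd> A" "A Mod N \<cong> G" "a \<in> carrier A"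
  shows "a [^]\<^bsub>A\<^esub> order G \<in> N"
proof -
  obtain \<phi> where \<phi>: "\<phi> \<in> epis A G" "kernel A G \<phi> = N"
    using exists_epi_with_kernel[OF assms(1-4)] by blast
  interpret group_hom A G \<phi>
    using assms \<phi> by (simp add: epis_def group_hom_def group_hom_axioms_def)
  have "\<phi> (a [^]\<^bsub>A\<^esub> order G) = \<phi> a [^]\<^bsub>G\<^esub> order G" by (rule hom_nat_pow[OF assms(5)])
  also have "\<dots> = \<one>\<^bsub>G\<^esub>" using assms(5) by (intro H.pow_order_eq_1) simp
  finally show ?thesis using assms(5) \<phi>(2) by (auto simp: kernel_def)
qed

lemma card_normal_quotient:
  assumes "group A" "N \<lhd> A" "A Mod N \<cong> G"
  shows "card N * order G = order A"
proof -
  interpret group A by fact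
  have "card (carrier (A Mod N)) = order G"
    using assms(3) by (auto simp: is_iso_def iso_def order_def dest: bij_betw_same_card)
  then show ?thesis using lagrange[OF normal_imp_subgroup[OF assms(2)]] by (simp add: FactGroup_def mult.commute)
qed

text \<open>A subgroup containing the whole p-torsion of A has the same p-torsion as A, hence rank
  n, and \<open>card_generating_lists\<close> applies inside it with r = n.\<close>

lemma generating_lists_of_subgroup:
  assumes p: "Factorial_Ring.prime p" and A: "comm_group A" "finite (carrier A)" "order A = p ^ e"
    and N: "subgroup N A"
    and T: "{x \<in> carrier A. x [^]\<^bsub>A\<^esub> p = \<one>\<^bsub>A\<^esub>} \<subseteq> N" "card {x \<in> carrier A. x [^]\<^bsub>A\<^esub> p = \<one>\<^bsub>A\<^esub>} = p ^ n"
  shows "real (card {xs. length xs = c \<and> set xs \<subseteq> carrier A \<and> generate A (set xs) = N})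
    = real (card N) ^ c * (\<Prod>i<n. 1 - real p ^ i / real p ^ c)"
proof -
  interpret A: comm_group A by fact
  let ?H = "A\<lparr>carrier := N\<rparr>"
  have sub: "N \<subseteq> carrier A" by (rule subgroup.subset[OF N])
  interpret H: comm_group ?H
    by (rule group.group_comm_groupI[OF A.subgroup_imp_group[OF N]]) (use sub A.m_comm in auto)
  have fin: "finite (carrier ?H)" using sub A(2) by (simp add: finite_subset)
  have "card N dvd p ^ e" using A.lagrange[OF N] A(3) by (metis dvd_triv_right)
  then have "order ?H dvd p ^ e" by (simp add: order_def)
  then obtain f where f: "order ?H = p ^ f" using p by (auto simp: divides_primepow_nat)
  have "{x \<in> carrier ?H. x [^]\<^bsub>?H\<^esub> p = \<one>\<^bsub>?H\<^esub>} = {x \<in> carrier A. x [^]\<^bsub>A\<^esub> p = \<one>\<^bsub>A\<^esub>}"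
    using T(1) sub by (auto simp: A.nat_pow_consistent[symmetric])
  then have "order ?H = p ^ n * card (pth_powers p ?H)"
    using H.order_eq_card_torsion_pth_powers[OF fin, of p] T(2) by simp
  then have "order ?H = p ^ n * card (generate ?H ({} \<union> pth_powers p ?H))"
    using H.generate_subgroup_eq[OF H.subgroup_pth_powers, of p] by simp
  from H.card_generating_lists[OF p f fin _ this, of c]
  have "real (card {xs. length xs = c \<and> set xs \<subseteq> N \<and> generate ?H (set xs) = N})
    = real (card N) ^ c * (\<Prod>i<n. 1 - real p ^ i / real p ^ c)" by (simp add: order_def)
  moreover have "{xs. length xs = c \<and> set xs \<subseteq> N \<and> generate ?H (set xs) = N}
      = {xs. length xs = c \<and> set xs \<subseteq> carrier A \<and> generate A (set xs) = N}"
  proof (rule Collect_cong)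
    fix xs
    have "set xs \<subseteq> N" if "generate A (set xs) = N"
      using that generate.incl[of _ "set xs" A] by blast
    then show "(length xs = c \<and> set xs \<subseteq> N \<and> generate ?H (set xs) = N)
      = (length xs = c \<and> set xs \<subseteq> carrier A \<and> generate A (set xs) = N)"
      using A.generate_consistent[OF _ N, of "set xs"] sub by auto
  qed
  ultimately show ?thesis by simp
qed

text \<open>The list holds the columns of a matrix over Z/q, so that the quotient is its
  cokernel.\<close>

abbreviation coker_lists :: "('c, 'd) monoid_scheme \<Rightarrow> ('a, 'b) monoid_scheme \<Rightarrow> nat \<Rightarrow> 'c list set" where
  "coker_lists A G c \<equiv> {xs. length xs = c \<and> set xs \<subseteq> carrier A \<and> A Mod generate A (set xs) \<cong> G}"

text \<open>The lists are sorted by the subgroup N that they generate. The number of N times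
  |Aut(G)| is the number of generating n-tuples of G, and every N contributes equally, because |N| =
  q^n/|G| and its rank is n. In the second claim n = r, so A/pA and G/pG both have order p^r; this
  forces N into pA, and each column has only (q/p)^r choices.\<close>

lemma card_coker_lists:
  fixes G :: "('a, 'b) monoid_scheme"
  assumes p: "Factorial_Ring.prime p" and G: "comm_group G" "finite (carrier G)" "order G = p ^ k"
    and r: "order G = p ^ r * card (pth_powers p G)" and q: "q = p ^ Suc k"
  shows "real (card (coker_lists (Zmod_vec q n) G c)) * (real (order (AutoGroup G)) * real (order G) ^ c)
    = (real q ^ n) ^ c * (real (order G) ^ n * (\<Prod>i<r. 1 - real p ^ i / real p ^ n)) * (\<Prod>i<n. 1 - real p ^ i / real p ^ c)"
    "card (coker_lists (Zmod_vec q r) G c) * (p ^ r) ^ c \<le> (q ^ r) ^ c"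
proof -
  interpret G: comm_group G by fact
  have p1: "p > 1" using p by (rule prime_gt_1_nat)
  then have p0: "p > 0" by simp
  have q1: "q > 1" unfolding q by (rule one_less_power[OF p1]) simp
  then have q0: "q > 0" by simp
  have aux: "N \<lhd> Zmod_vec q n \<Longrightarrow> Zmod_vec q n Mod N \<cong> G \<Longrightarrow> card N * order G = q ^ n" for N n
    using card_normal_quotient[where A = "Zmod_vec q n" and N = N and G = G]
      comm_group.axioms(2)[OF comm_group_Zmod_vec[of q n]] order_Zmod_vec[OF q0, of n] by simp
  show "real (card (coker_lists (Zmod_vec q n) G c)) * (real (order (AutoGroup G)) * real (order G) ^ c)
    = (real q ^ n) ^ c * (real (order G) ^ n * (\<Prod>i<r. 1 - real p ^ i / real p ^ n)) * (\<Prod>i<n. 1 - real p ^ i / real p ^ c)"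
  proof -
    let ?A = "Zmod_vec q n"
    let ?N = "{N. N \<lhd> ?A \<and> ?A Mod N \<cong> G}"
    interpret A: comm_group ?A by (rule comm_group_Zmod_vec)
    have finA: "finite (carrier ?A)" by (rule finite_Zmod_vec[OF q0])
    have ordA: "order ?A = p ^ (Suc k * n)" using order_Zmod_vec[OF q0] by (simp only: q power_mult)
    have finN: "finite ?N"
      by (rule finite_subset[of _ "Pow (carrier ?A)"]) (use finA normal_imp_subgroup subgroup.subset in blast)+
    have ex: "g [^]\<^bsub>G\<^esub> q = \<one>\<^bsub>G\<^esub>" if "g \<in> carrier G" for g
    proof -
      have "g [^]\<^bsub>G\<^esub> q = (g [^]\<^bsub>G\<^esub> order G) [^]\<^bsub>G\<^esub> p"
        using that by (simp add: q G.nat_pow_pow G(3) mult.commute)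
      then show ?thesis using G.pow_order_eq_1[OF that] by simp
    qed
    have "order G = p ^ r * card (generate G ({} \<union> pth_powers p G))"
      using r G.generate_subgroup_eq[OF G.subgroup_pth_powers, of p] by simp
    from G.card_generating_lists[OF p G(3,2) _ this, of n]
    have "real (card (gen_lists G n)) = real (order G) ^ n * (\<Prod>i<r. 1 - real p ^ i / real p ^ n)" by simp
    moreover have "card (gen_lists G n) = card ?N * order (AutoGroup G)"
      by (rule trans[OF card_epis_Zmod_vec[OF G(1) q1 ex, symmetric] card_epis[OF A.is_group G.is_group finA]])
    ultimately have nN: "real (card ?N) * real (order (AutoGroup G)) = real (order G) ^ n * (\<Prod>i<r. 1 - real p ^ i / real p ^ n)"
      by (simp only: of_nat_mult)
    have each: "real (card {xs. length xs = c \<and> set xs \<subseteq> carrier ?A \<and> generate ?A (set xs) = N}) * real (order G) ^ c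
        = (real q ^ n) ^ c * (\<Prod>i<n. 1 - real p ^ i / real p ^ c)" if "N \<in> ?N" for N
    proof -
      have N: "N \<lhd> ?A" "?A Mod N \<cong> G" using that by auto
      have "{x \<in> carrier ?A. x [^]\<^bsub>?A\<^esub> p = \<one>\<^bsub>?A\<^esub>} \<subseteq> N"
      proof
        fix x assume "x \<in> {x \<in> carrier ?A. x [^]\<^bsub>?A\<^esub> p = \<one>\<^bsub>?A\<^esub>}"
        then obtain y where "y \<in> carrier ?A" "x = y [^]\<^bsub>?A\<^esub> (p ^ k)"
          using card_torsion_Zmod_vec(2)[OF p0 q, of n] by blast
        then show "x \<in> N" using pow_order_in_quotient_kernel[OF A.is_group G.is_group N, of y] by (simp only: G(3))
      qed
      from generating_lists_of_subgroup[OF p A.comm_group_axioms finA ordA normal_imp_subgroup[OF N(1)] this card_torsion_Zmod_vec(1)[OF _ q]]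
      have "real (card {xs. length xs = c \<and> set xs \<subseteq> carrier ?A \<and> generate ?A (set xs) = N})
        = real (card N) ^ c * (\<Prod>i<n. 1 - real p ^ i / real p ^ c)" using p1 by simp
      moreover have "real (card N) * real (order G) = real q ^ n" using aux[OF N] by (metis of_nat_mult of_nat_power)
      ultimately show ?thesis by (simp add: power_mult_distrib[symmetric] mult.assoc mult.left_commute)
    qed
    have "coker_lists ?A G c = (\<Union>N\<in>?N. {xs. length xs = c \<and> set xs \<subseteq> carrier ?A \<and> generate ?A (set xs) = N})"
    proof (intro equalityI subsetI)
      fix xs assume xs: "xs \<in> coker_lists ?A G c"
      then have "generate ?A (set xs) \<lhd> ?A" by (intro A.subgroup_imp_normal A.generate_is_subgroup) blast
      then show "xs \<in> (\<Union>N\<in>?N. {xs. length xs = c \<and> set xs \<subseteq> carrier ?A \<and> generate ?A (set xs) = N})" using xs by blast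
    qed blast
    then have "card (coker_lists ?A G c) = (\<Sum>N\<in>?N. card {xs. length xs = c \<and> set xs \<subseteq> carrier ?A \<and> generate ?A (set xs) = N})"
    proof (simp only:, intro card_UN_disjoint finN ballI impI)
      show "finite {xs. length xs = c \<and> set xs \<subseteq> carrier ?A \<and> generate ?A (set xs) = N}" for N
        by (rule finite_subset[OF _ finite_lists_length_eq[OF finA, of c]]) blast
    qed blast
    then have "real (card (coker_lists ?A G c)) * real (order G) ^ c
        = (\<Sum>N\<in>?N. real (card {xs. length xs = c \<and> set xs \<subseteq> carrier ?A \<and> generate ?A (set xs) = N}) * real (order G) ^ c)"
      by (simp only: of_nat_sum sum_distrib_right)
    also have "\<dots> = real (card ?N) * ((real q ^ n) ^ c * (\<Prod>i<n. 1 - real p ^ i / real p ^ c))"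
      using sum.cong[OF refl each, of ?N] by simp
    finally have total: "real (card (coker_lists ?A G c)) * real (order G) ^ c
        = real (card ?N) * ((real q ^ n) ^ c * (\<Prod>i<n. 1 - real p ^ i / real p ^ c))" .
    have alg: "x * (a * g) = Q * R * W" if "x * g = N * (Q * W)" "N * a = R" for x a g N Q R W :: real
    proof -
      have "x * (a * g) = (x * g) * a" by simp
      also have "\<dots> = (N * a) * (Q * W)" unfolding that(1) by simp
      finally show ?thesis unfolding that(2) by simp
    qed
    show ?thesis by (rule alg[OF total nN])
  qed
  show "card (coker_lists (Zmod_vec q r) G c) * (p ^ r) ^ c \<le> (q ^ r) ^ c"
  proof -
    let ?A = "Zmod_vec q r"
    let ?P = "pth_powers p ?A"
    interpret A: comm_group ?A by (rule comm_group_Zmod_vec)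
    have finA: "finite (carrier ?A)" by (rule finite_Zmod_vec[OF q0])
    have finP: "finite ?P" using finA by simp
    have cP: "q ^ r = p ^ r * card ?P"
      using A.order_eq_card_torsion_pth_powers[OF finA, of p] card_torsion_Zmod_vec(1)[OF _ q, of r] p1 order_Zmod_vec[OF q0, of r] by simp
    have "coker_lists ?A G c \<subseteq> {xs. set xs \<subseteq> ?P \<and> length xs = c}"
    proof
      fix xs assume xs: "xs \<in> coker_lists ?A G c"
      let ?N = "generate ?A (set xs)"
      have N: "?N \<lhd> ?A" using xs by (intro A.subgroup_imp_normal A.generate_is_subgroup) blast
      have iso: "?A Mod ?N \<cong> G" using xs by blast
      obtain \<phi> where \<phi>: "\<phi> \<in> epis ?A G" "kernel ?A G \<phi> = ?N"
        using exists_epi_with_kernel[OF A.is_group G.is_group N iso] by blast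
      interpret h: group_hom ?A G \<phi>
        using \<phi> A.is_group G.is_group by (simp add: epis_def group_hom_def group_hom_axioms_def)
      \<comment> \<open>The preimage of pG contains both N and pA. Its order |N| |pG| equals that of
        pA, because |N| |G| = q^r and |G| = p^r |pG|; hence it is pA and N lies in pA.\<close>
      define B where "B = {x \<in> carrier ?A. \<phi> x \<in> pth_powers p G}"
      have onto: "\<phi> ` carrier ?A = carrier G" using \<phi>(1) by (simp add: epis_def)
      have B: "subgroup B ?A"
      proof (rule A.subgroupI)
        note P = G.subgroup_pth_powers[of p]
        have "\<one>\<^bsub>?A\<^esub> \<in> B"
          unfolding B_def mem_Collect_eq h.hom_one using A.one_closed subgroup.one_closed[OF P] by blast
        then show "B \<noteq> {}" by blast
        show "inv\<^bsub>?A\<^esub> a \<in> B" if "a \<in> B" for a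
          using that subgroup.m_inv_closed[OF P, of "\<phi> a"] A.inv_closed[of a] h.hom_inv[of a] unfolding B_def by fastforce
        show "a \<otimes>\<^bsub>?A\<^esub> b \<in> B" if "a \<in> B" "b \<in> B" for a b
          using that subgroup.m_closed[OF P, of "\<phi> a" "\<phi> b"] A.m_closed[of a b] h.hom_mult[of a b] unfolding B_def by fastforce
      qed (auto simp only: B_def)
      have NB: "?N \<subseteq> B"
      proof
        fix x assume "x \<in> ?N"
        then have "x \<in> kernel ?A G \<phi>" by (simp only: \<phi>(2))
        then have "x \<in> carrier ?A" "\<phi> x = \<one>\<^bsub>G\<^esub>" by (simp_all only: kernel_def mem_Collect_eq)
        then show "x \<in> B" unfolding B_def mem_Collect_eq
          using subgroup.one_closed[OF G.subgroup_pth_powers, of p] by (simp only:)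
      qed
      have PB: "?P \<subseteq> B"
      proof
        fix x assume "x \<in> ?P"
        then obtain y where y: "y \<in> carrier ?A" "x = y [^]\<^bsub>?A\<^esub> p" by blast
        then show "x \<in> B" using h.hom_nat_pow[OF y(1), of p] h.hom_closed[OF y(1)] A.nat_pow_closed[OF y(1)] unfolding B_def by blast
      qed
      have "card B = card ?N * card (pth_powers p G)"
      proof -
        interpret hB: group_hom "?A\<lparr>carrier := B\<rparr>" G \<phi>
          using A.subgroup_imp_group[OF B] G.is_group h.homh
          by (auto simp: group_hom_def group_hom_axioms_def hom_def B_def)
        have "finite (carrier (?A\<lparr>carrier := B\<rparr>))" using finA by (simp add: B_def)
        from hB.order_eq_card_kernel_image[OF this]
        have "card B = card (kernel (?A\<lparr>carrier := B\<rparr>) G \<phi>) * card (\<phi> ` B)" by (simp add: order_def)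
        moreover have "kernel (?A\<lparr>carrier := B\<rparr>) G \<phi> = ?N"
          using \<phi>(2) NB unfolding kernel_def B_def by auto
        moreover have "\<phi> ` B = pth_powers p G"
        proof
          show "pth_powers p G \<subseteq> \<phi> ` B"
          proof
            fix g assume g: "g \<in> pth_powers p G"
            then have "g \<in> \<phi> ` carrier ?A" unfolding onto by auto
            then show "g \<in> \<phi> ` B" using g unfolding B_def by blast
          qed
        qed (auto simp only: B_def)
        ultimately show ?thesis by simp
      qed
      moreover have "card ?N * order G = q ^ r" by (rule aux[OF N iso])
      ultimately have "p ^ r * card B = p ^ r * card ?P" using r cP by (simp add: mult.left_commute)
      then have "card B = card ?P" using p1 by simp
      then have "?P = B" using PB finA card_subset_eq[of B ?P] unfolding B_def by (metis (no_types, lifting) finite_subset mem_Collect_eq subsetI)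
      moreover have "set xs \<subseteq> ?N" by (auto intro: generate.incl)
      ultimately show "xs \<in> {xs. set xs \<subseteq> ?P \<and> length xs = c}" using NB xs by blast
    qed
    then have "card (coker_lists ?A G c) \<le> card {xs. set xs \<subseteq> ?P \<and> length xs = c}"
      by (rule card_mono[OF finite_lists_length_eq[OF finP]])
    also have "\<dots> = card ?P ^ c" by (rule card_lists_length_eq[OF finP])
    finally have "card (coker_lists ?A G c) * (p ^ r) ^ c \<le> card ?P ^ c * (p ^ r) ^ c" by (rule mult_right_mono) simp
    then show ?thesis unfolding cP by (simp add: power_mult_distrib mult.commute)
  qed
qed

section \<open>The rank of a finite abelian group\<close>

text \<open>The record built in \<open>mod_p_space\<close>, with the quotient replaced by an
  arbitrary group Q.\<close>

definition elementary_module :: "('a, 'b) monoid_scheme \<Rightarrow> (int, 'a) module" where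
  "elementary_module Q = \<lparr>carrier = carrier Q, monoid.mult = undefined, one = undefined,
     ring.zero = \<one>\<^bsub>Q\<^esub>, ring.add = monoid.mult Q, smult = (\<lambda>k C. C [^]\<^bsub>Q\<^esub> k)\<rparr>"

lemma elementary_module_vectorspace:
  assumes p: "Factorial_Ring.prime p" and Q: "comm_group Q" and ex: "\<And>x. x \<in> carrier Q \<Longrightarrow> x [^]\<^bsub>Q\<^esub> p = \<one>\<^bsub>Q\<^esub>"
  shows "vectorspace (residue_ring (int p)) (elementary_module Q)"
proof -
  interpret Q: comm_group Q by fact
  interpret R: residues_prime p "residue_ring (int p)" by unfold_locales (rule p)
  let ?V = "elementary_module Q"
  have mod: "x [^]\<^bsub>Q\<^esub> (a mod int p) = x [^]\<^bsub>Q\<^esub> a" if "x \<in> carrier Q" for x and a :: int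
    by (rule Q.int_pow_mod_exponent[OF that ex[OF that]])
  have ab: "abelian_group ?V"
  proof (rule abelian_groupI)
    fix x assume "x \<in> carrier ?V"
    then show "\<exists>y\<in>carrier ?V. y \<oplus>\<^bsub>?V\<^esub> x = \<zero>\<^bsub>?V\<^esub>"
      by (intro bexI[of _ "inv\<^bsub>Q\<^esub> x"]) (auto simp: elementary_module_def)
  qed (auto simp: elementary_module_def Q.m_ac)
  have "module (residue_ring (int p)) ?V"
  proof (rule moduleI)
    show "cring (residue_ring (int p))" by (rule R.cring)
  qed (use ab in \<open>auto simp: elementary_module_def R.res_add_eq R.res_mult_eq R.res_one_eq mod Q.int_pow_mult
        Q.int_pow_distrib Q.int_pow_pow mult.commute\<close>)
  then show ?thesis using R.is_field by (simp add: vectorspace_def)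
qed

lemma (in vectorspace) card_carrier_eq_power_dim:
  assumes "finite (carrier V)"
  shows "card (carrier V) = card (carrier K) ^ dim"
proof -
  have "fin_dim" unfolding fin_dim_def
    using assms in_own_span[of "carrier V"] span_is_subset2[of "carrier V"] by (intro exI[of _ "carrier V"]) auto
  then obtain B where B: "finite B" "basis B" using finite_basis_exists by blast
  have BV: "B \<subseteq> carrier V" using B by (simp add: basis_def)
  have "\<exists>!a. a \<in> B \<rightarrow>\<^sub>E carrier K \<and> lincomb a B = v" if "v \<in> carrier V" for v
    using basis_criterion[OF B(1) BV] B(2) that by blast
  moreover have "lincomb a B \<in> carrier V" if "a \<in> B \<rightarrow>\<^sub>E carrier K" for a
    using that BV by (intro lincomb_closed) auto
  ultimately have "bij_betw (\<lambda>a. lincomb a B) (B \<rightarrow>\<^sub>E carrier K) (carrier V)"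
    unfolding bij_betw_def inj_on_def by blast
  then have "card (carrier V) = card (B \<rightarrow>\<^sub>E carrier K)" by (simp add: bij_betw_same_card)
  also have "\<dots> = card (carrier K) ^ dim" using dim_basis[OF B] B(1) by (simp add: card_PiE)
  finally show ?thesis .
qed

text \<open>Turns the dimension behind \<open>p_rank\<close> into an index, the form in which the
  counting lemmas take the rank.\<close>

lemma order_eq_p_rank:
  assumes p: "Factorial_Ring.prime p" and G: "comm_group G" "finite (carrier G)"
  shows "order G = p ^ p_rank p G * card (pth_powers p G)"
proof -
  interpret G: comm_group G by fact
  let ?P = "pth_powers p G"
  let ?Q = "G Mod ?P"
  have P: "subgroup ?P G" by (rule G.subgroup_pth_powers)
  interpret N: normal ?P G by (rule G.subgroup_imp_normal[OF P])
  have Q: "comm_group ?Q" by (rule G.abelian_FactGroup[OF P])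
  have ex: "x [^]\<^bsub>?Q\<^esub> p = \<one>\<^bsub>?Q\<^esub>" if x: "x \<in> carrier ?Q" for x
  proof -
    obtain a where a: "a \<in> carrier G" "x = ?P #>\<^bsub>G\<^esub> a" using x unfolding carrier_FactGroup by blast
    have "x [^]\<^bsub>?Q\<^esub> p = ?P #>\<^bsub>G\<^esub> (a [^]\<^bsub>G\<^esub> p)" unfolding a(2) by (rule N.FactGroup_pow[OF a(1)])
    also have "\<dots> = ?P" using a(1) by (intro G.coset_join2 P) auto
    finally show ?thesis by simp
  qed
  have M: "mod_p_space p G = elementary_module ?Q" by (simp add: mod_p_space_def elementary_module_def Let_def)
  interpret V: vectorspace "residue_ring (int p)" "elementary_module ?Q"
    by (rule elementary_module_vectorspace[OF p Q ex])
  have fin: "finite (carrier ?Q)" using G(2) by (simp add: carrier_FactGroup)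
  have "card (carrier (residue_ring (int p))) = p" by (simp add: residue_ring_def)
  then have "card (carrier ?Q) = p ^ p_rank p G"
    using V.card_carrier_eq_power_dim fin by (simp add: p_rank_def M) (simp add: elementary_module_def)
  then show ?thesis using G.lagrange[OF P] by (simp add: FactGroup_def)
qed

section \<open>Linear algebra over the $p$-adic integers\<close>

lemma quotient_iso_of_surjective_hom:
  assumes "group_hom L A \<pi>" "\<pi> ` carrier L = carrier A" "I \<lhd> L" "kernel L A \<pi> \<subseteq> I" "\<pi> ` I \<lhd> A"
  shows "L Mod I \<cong> A Mod (\<pi> ` I)"
proof -
  interpret group_hom L A \<pi> by fact
  interpret N: normal "\<pi> ` I" A by fact
  have Isub: "I \<subseteq> carrier L" by (rule subgroup.subset[OF normal_imp_subgroup[OF assms(3)]])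
  let ?f = "\<lambda>x. (\<pi> ` I) #>\<^bsub>A\<^esub> \<pi> x"
  have hom: "?f \<in> hom L (A Mod (\<pi> ` I))"
    using Group.hom_compose[OF homh N.r_coset_hom_Mod] by (simp add: o_def)
  interpret f: group_hom L "A Mod (\<pi> ` I)" ?f
    using hom N.factorgroup_is_group G.is_group by (simp add: group_hom_def group_hom_axioms_def)
  have onto: "?f ` carrier L = carrier (A Mod (\<pi> ` I))"
    unfolding carrier_FactGroup assms(2)[symmetric] by (simp add: image_image)
  have "kernel L (A Mod (\<pi> ` I)) ?f = I"
  proof (intro equalityI subsetI)
    fix x assume "x \<in> kernel L (A Mod (\<pi> ` I)) ?f"
    then have x: "x \<in> carrier L" "(\<pi> ` I) #>\<^bsub>A\<^esub> \<pi> x = \<pi> ` I" by (auto simp: kernel_def)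
    have "\<pi> x \<in> (\<pi> ` I) #>\<^bsub>A\<^esub> \<pi> x"
      using H.rcos_self[of "\<pi> x" "\<pi> ` I"] N.subgroup_axioms x(1) by simp
    then obtain y where y: "y \<in> I" "\<pi> x = \<pi> y" using x(2) by auto
    have yc: "y \<in> carrier L" using y Isub by blast
    have "x \<otimes>\<^bsub>L\<^esub> inv\<^bsub>L\<^esub> y \<in> kernel L A \<pi>" using x(1) yc y(2) by (simp add: kernel_def)
    then have "x \<otimes>\<^bsub>L\<^esub> inv\<^bsub>L\<^esub> y \<in> I" using assms(4) by blast
    then have "(x \<otimes>\<^bsub>L\<^esub> inv\<^bsub>L\<^esub> y) \<otimes>\<^bsub>L\<^esub> y \<in> I"
      using y(1) subgroup.m_closed[OF normal_imp_subgroup[OF assms(3)]] by blast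
    then show "x \<in> I" using x(1) yc by (simp add: G.m_assoc)
  next
    fix x assume x: "x \<in> I"
    then have "(\<pi> ` I) #>\<^bsub>A\<^esub> \<pi> x = \<pi> ` I"
      using Isub by (intro H.coset_join2 N.subgroup_axioms) auto
    then show "x \<in> kernel L (A Mod (\<pi> ` I)) ?f" using x Isub by (auto simp: kernel_def)
  qed
  then show ?thesis using f.FactGroup_iso[OF onto] by simp
qed

text \<open>A p-adic integer is the sequence of its canonical residues, so reduction modulo p^K is
  evaluation at K.\<close>

definition red_vec :: "nat \<Rightarrow> nat \<Rightarrow> (nat \<Rightarrow> nat \<Rightarrow> int) \<Rightarrow> nat \<Rightarrow> int" where
  "red_vec K n x = (\<lambda>i\<in>{..<n}. x i K)"

definition red_cols :: "nat \<Rightarrow> nat \<Rightarrow> nat \<Rightarrow> (nat \<times> nat \<Rightarrow> nat \<Rightarrow> int) \<Rightarrow> (nat \<Rightarrow> int) list" where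
  "red_cols K n c M = map (\<lambda>j. \<lambda>i\<in>{..<n}. M (i, j) K) [0..<c]"

definition Zp_of_int :: "nat \<Rightarrow> int \<Rightarrow> nat \<Rightarrow> int" where
  "Zp_of_int p a = (\<lambda>k. a mod int p ^ k)"

section \<open>Arithmetic with compatible sequences of residues\<close>

context
  fixes p :: nat assumes p2: "p > 1"
begin

lemma Zp_carrier_mod:
  assumes "x \<in> Zp_carrier p" shows "x (k + d) mod int p ^ k = x k"
proof (induction d)
  case 0
  then show ?case using assms by (auto simp: Zp_carrier_def)
next
  case (Suc d)
  have "x (k + Suc d) mod int p ^ k = (x (Suc (k + d)) mod int p ^ (k + d)) mod int p ^ k"
    by (simp add: mod_mod_cancel power_add)
  also have "x (Suc (k + d)) mod int p ^ (k + d) = x (k + d)" using assms by (simp add: Zp_carrier_def)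
  finally show ?case using Suc by simp
qed

lemma Zp_carrierI:
  assumes "\<And>k. f (Suc k) mod int p ^ k = f k mod int p ^ k"
  shows "(\<lambda>k. f k mod int p ^ k) \<in> Zp_carrier p"
proof -
  have "f (Suc k) mod int p ^ Suc k mod int p ^ k = f k mod int p ^ k" for k
    using assms[of k] by (simp add: mod_mod_cancel)
  then show ?thesis using p2 by (simp add: Zp_carrier_def)
qed

lemma Zp_carrier_self_mod: "x \<in> Zp_carrier p \<Longrightarrow> x k mod int p ^ k = x k"
  by (auto simp: Zp_carrier_def)

lemma Zp_carrier_Suc_mod: "x \<in> Zp_carrier p \<Longrightarrow> x (Suc k) mod int p ^ k = x k"
  by (auto simp: Zp_carrier_def)

lemma Zp_carrier_cong: "x \<in> Zp_carrier p \<Longrightarrow> [x (Suc k) = x k] (mod int p ^ k)"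
  by (simp add: cong_def Zp_carrier_self_mod Zp_carrier_Suc_mod)

lemma Zp_simps [simp]:
  "carrier (Zp p) = Zp_carrier p" "x \<oplus>\<^bsub>Zp p\<^esub> y = (\<lambda>k. (x k + y k) mod int p ^ k)"
  "x \<otimes>\<^bsub>Zp p\<^esub> y = (\<lambda>k. (x k * y k) mod int p ^ k)" "\<zero>\<^bsub>Zp p\<^esub> = (\<lambda>k. 0)"
  by (simp_all add: Zp_def)

lemma Zp_add_closed: "x \<in> Zp_carrier p \<Longrightarrow> y \<in> Zp_carrier p \<Longrightarrow> (\<lambda>k. (x k + y k) mod int p ^ k) \<in> Zp_carrier p"
  by (intro Zp_carrierI) (use cong_add[OF Zp_carrier_cong[of x] Zp_carrier_cong[of y]] in \<open>simp add: cong_def\<close>)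

lemma Zp_mult_closed: "x \<in> Zp_carrier p \<Longrightarrow> y \<in> Zp_carrier p \<Longrightarrow> (\<lambda>k. (x k * y k) mod int p ^ k) \<in> Zp_carrier p"
  by (intro Zp_carrierI) (use cong_mult[OF Zp_carrier_cong[of x] Zp_carrier_cong[of y]] in \<open>simp add: cong_def\<close>)

lemma abelian_group_Zp: "abelian_group (Zp p)"
proof (rule abelian_groupI)
  show "\<zero>\<^bsub>Zp p\<^esub> \<in> carrier (Zp p)" using p2 by (simp add: Zp_carrier_def)
  fix x assume x: "x \<in> carrier (Zp p)"
  show "\<exists>y\<in>carrier (Zp p). y \<oplus>\<^bsub>Zp p\<^esub> x = \<zero>\<^bsub>Zp p\<^esub>"
  proof (intro bexI)
    show "(\<lambda>k. (- x k) mod int p ^ k) \<oplus>\<^bsub>Zp p\<^esub> x = \<zero>\<^bsub>Zp p\<^esub>" by (simp add: mod_simps)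
    show "(\<lambda>k. (- x k) mod int p ^ k) \<in> carrier (Zp p)"
      using x by (auto intro!: Zp_carrierI simp flip: cong_def simp: cong_minus_minus_iff Zp_carrier_cong)
  qed
  show "\<zero>\<^bsub>Zp p\<^esub> \<oplus>\<^bsub>Zp p\<^esub> x = x" using x by (auto simp: Zp_carrier_self_mod)
qed (auto simp: Zp_add_closed mod_simps add_ac)

lemma finsum_Zp:
  fixes c :: nat
  assumes "\<And>j. j < c \<Longrightarrow> f j \<in> Zp_carrier p"
  shows "finsum (Zp p) f {..<c} = (\<lambda>k. (\<Sum>j<c. f j k) mod int p ^ k)"
  using assms
proof (induction c)
  case 0
  interpret abelian_group "Zp p" by (rule abelian_group_Zp)
  show ?case by simp
next
  case (Suc c)
  interpret abelian_group "Zp p" by (rule abelian_group_Zp)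
  have "finsum (Zp p) f {..<Suc c} = f c \<oplus>\<^bsub>Zp p\<^esub> finsum (Zp p) f {..<c}"
    unfolding lessThan_Suc using Suc.prems by (intro finsum_insert) auto
  also have "finsum (Zp p) f {..<c} = (\<lambda>k. (\<Sum>j<c. f j k) mod int p ^ k)" using Suc by simp
  finally show ?case by (simp add: mod_simps add.commute)
qed

lemma comm_group_Zp_vec: "comm_group (Zp_vec p n)"
  unfolding Zp_vec_def
  by (rule comm_group_product_group) (rule abelian_group.a_comm_group[OF abelian_group_Zp])

lemma carrier_Zp_vec: "carrier (Zp_vec p n) = {..<n} \<rightarrow>\<^sub>E Zp_carrier p"
  by (simp add: Zp_vec_def)

lemma carrier_Zp_mat: "carrier (Zp_mat p n c) = {..<n} \<times> {..<c} \<rightarrow>\<^sub>E Zp_carrier p"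
  by (simp add: Zp_mat_def)

lemma mult_Zp_vec: "x \<otimes>\<^bsub>Zp_vec p n\<^esub> y = (\<lambda>i\<in>{..<n}. \<lambda>k. (x i k + y i k) mod int p ^ k)"
  by (simp add: Zp_vec_def)

lemma one_Zp_vec: "\<one>\<^bsub>Zp_vec p n\<^esub> = (\<lambda>i\<in>{..<n}. \<lambda>k. 0)"
  by (simp add: Zp_vec_def)

lemma Zp_vec_entry: "x \<in> carrier (Zp_vec p n) \<Longrightarrow> i < n \<Longrightarrow> x i \<in> Zp_carrier p"
  unfolding carrier_Zp_vec by (erule PiE_mem) simp

lemma Zp_vec_eqI:
  assumes "x \<in> carrier (Zp_vec p n)" "y \<in> carrier (Zp_vec p n)" "\<And>i k. i < n \<Longrightarrow> x i k = y i k"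
  shows "x = y"
  by (rule PiE_ext[OF assms(1,2)[unfolded carrier_Zp_vec]]) (use assms(3) in \<open>auto intro!: ext\<close>)

lemma pow_Zp_vec:
  assumes "x \<in> carrier (Zp_vec p n)" "i < n"
  shows "(x [^]\<^bsub>Zp_vec p n\<^esub> (m::nat)) i k = (int m * x i k) mod int p ^ k"
proof (induction m)
  case 0
  show ?case using assms(2) by (simp add: nat_pow_def one_Zp_vec)
next
  case (Suc m)
  have "x [^]\<^bsub>Zp_vec p n\<^esub> Suc m = x [^]\<^bsub>Zp_vec p n\<^esub> m \<otimes>\<^bsub>Zp_vec p n\<^esub> x"
    by (simp add: nat_pow_def)
  then show ?case using Suc assms(2) by (simp add: mult_Zp_vec mod_simps algebra_simps)
qed

lemma Zp_mat_entry: "M \<in> carrier (Zp_mat p n c) \<Longrightarrow> i < n \<Longrightarrow> j < c \<Longrightarrow> M (i, j) \<in> Zp_carrier p"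
  unfolding carrier_Zp_mat by (erule PiE_mem) simp

lemma Zp_mat_vec_entry:
  assumes M: "M \<in> carrier (Zp_mat p n c)" and v: "v \<in> carrier (Zp_vec p c)" and i: "i < n"
  shows "Zp_mat_vec p n c M v i k = (\<Sum>j<c. M (i, j) k * v j k) mod int p ^ k"
proof -
  have "Zp_mat_vec p n c M v i = finsum (Zp p) (\<lambda>j. M (i, j) \<otimes>\<^bsub>Zp p\<^esub> v j) {..<c}"
    using i by (simp add: Zp_mat_vec_def)
  also have "\<dots> = (\<lambda>k. (\<Sum>j<c. (M (i, j) \<otimes>\<^bsub>Zp p\<^esub> v j) k) mod int p ^ k)"
    using Zp_mult_closed[OF Zp_mat_entry[OF M i] Zp_vec_entry[OF v]] by (intro finsum_Zp) simp
  finally show ?thesis by (simp add: mod_simps)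
qed

lemma Zp_mat_vec_closed:
  assumes M: "M \<in> carrier (Zp_mat p n c)" and v: "v \<in> carrier (Zp_vec p c)"
  shows "Zp_mat_vec p n c M v \<in> carrier (Zp_vec p n)"
  unfolding carrier_Zp_vec
proof (rule PiE_I)
  interpret abelian_group "Zp p" by (rule abelian_group_Zp)
  show "Zp_mat_vec p n c M v i \<in> Zp_carrier p" if "i \<in> {..<n}" for i
  proof -
    have "Zp_mat_vec p n c M v i = finsum (Zp p) (\<lambda>j. M (i, j) \<otimes>\<^bsub>Zp p\<^esub> v j) {..<c}"
      using that by (simp add: Zp_mat_vec_def)
    moreover have "\<dots> \<in> carrier (Zp p)"
      using Zp_mult_closed[OF Zp_mat_entry[OF M] Zp_vec_entry[OF v]] that by (intro finsum_closed) auto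
    ultimately show ?thesis by simp
  qed
qed (simp add: Zp_mat_vec_def)

lemma Zp_mat_vec_hom:
  assumes M: "M \<in> carrier (Zp_mat p n c)"
  shows "Zp_mat_vec p n c M \<in> hom (Zp_vec p c) (Zp_vec p n)"
proof (rule homI)
  interpret C: comm_group "Zp_vec p c" by (rule comm_group_Zp_vec)
  interpret N: comm_group "Zp_vec p n" by (rule comm_group_Zp_vec)
  fix v w assume vw: "v \<in> carrier (Zp_vec p c)" "w \<in> carrier (Zp_vec p c)"
  show "Zp_mat_vec p n c M v \<in> carrier (Zp_vec p n)" by (rule Zp_mat_vec_closed[OF M vw(1)])
  show "Zp_mat_vec p n c M (v \<otimes>\<^bsub>Zp_vec p c\<^esub> w) = Zp_mat_vec p n c M v \<otimes>\<^bsub>Zp_vec p n\<^esub> Zp_mat_vec p n c M w"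
  proof (rule Zp_vec_eqI)
    fix i k assume i: "i < n"
    have "[(\<Sum>j<c. M (i, j) k * ((v j k + w j k) mod int p ^ k)) = (\<Sum>j<c. M (i, j) k * v j k + M (i, j) k * w j k)] (mod int p ^ k)"
      by (intro cong_sum) (simp add: cong_def mod_simps distrib_left)
    then have eq: "(\<Sum>j<c. M (i, j) k * ((v j k + w j k) mod int p ^ k)) mod int p ^ k
       = ((\<Sum>j<c. M (i, j) k * v j k) + (\<Sum>j<c. M (i, j) k * w j k)) mod int p ^ k"
      by (simp add: cong_def sum.distrib)
    have "Zp_mat_vec p n c M (v \<otimes>\<^bsub>Zp_vec p c\<^esub> w) i k = (\<Sum>j<c. M (i, j) k * ((v j k + w j k) mod int p ^ k)) mod int p ^ k"
      unfolding Zp_mat_vec_entry[OF M C.m_closed[OF vw] i] by (simp add: mult_Zp_vec)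
    also have "\<dots> = (Zp_mat_vec p n c M v \<otimes>\<^bsub>Zp_vec p n\<^esub> Zp_mat_vec p n c M w) i k"
      unfolding eq using i by (simp add: mult_Zp_vec Zp_mat_vec_entry[OF M] vw mod_simps)
    finally show "Zp_mat_vec p n c M (v \<otimes>\<^bsub>Zp_vec p c\<^esub> w) i k = (Zp_mat_vec p n c M v \<otimes>\<^bsub>Zp_vec p n\<^esub> Zp_mat_vec p n c M w) i k" .
  qed (auto intro!: Zp_mat_vec_closed[OF M] C.m_closed N.m_closed vw)
qed

lemma Zp_of_int_closed: "Zp_of_int p a \<in> Zp_carrier p"
  unfolding Zp_of_int_def by (rule Zp_carrierI) simp

lemma red_vec_hom: "red_vec K n \<in> hom (Zp_vec p n) (Zmod_vec (p ^ K) n)"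
proof (rule homI)
  have q0: "p ^ K > 0" using p2 by simp
  fix x y assume xy: "x \<in> carrier (Zp_vec p n)" "y \<in> carrier (Zp_vec p n)"
  show "red_vec K n x \<in> carrier (Zmod_vec (p ^ K) n)"
    unfolding carrier_Zmod_vec[OF q0]
  proof (rule PiE_I)
    show "red_vec K n x i \<in> {0..<int (p ^ K)}" if "i \<in> {..<n}" for i
      using Zp_vec_entry[OF xy(1), of i] that by (simp add: red_vec_def Zp_carrier_def)
  qed (simp add: red_vec_def)
  show "red_vec K n (x \<otimes>\<^bsub>Zp_vec p n\<^esub> y) = red_vec K n x \<otimes>\<^bsub>Zmod_vec (p ^ K) n\<^esub> red_vec K n y"
    by (auto simp: red_vec_def mult_Zp_vec fun_eq_iff)
qed

lemma red_vec_onto: "red_vec K n ` carrier (Zp_vec p n) = carrier (Zmod_vec (p ^ K) n)"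
proof
  have q0: "p ^ K > 0" using p2 by simp
  show "red_vec K n ` carrier (Zp_vec p n) \<subseteq> carrier (Zmod_vec (p ^ K) n)"
    using hom_in_carrier[OF red_vec_hom] by blast
  show "carrier (Zmod_vec (p ^ K) n) \<subseteq> red_vec K n ` carrier (Zp_vec p n)"
  proof
    fix a assume "a \<in> carrier (Zmod_vec (p ^ K) n)"
    then have a: "a \<in> {..<n} \<rightarrow>\<^sub>E {0..<int (p ^ K)}" unfolding carrier_Zmod_vec[OF q0] .
    have "(\<lambda>i\<in>{..<n}. Zp_of_int p (a i)) \<in> carrier (Zp_vec p n)"
      unfolding carrier_Zp_vec using Zp_of_int_closed by (intro PiE_I) auto
    moreover have "red_vec K n (\<lambda>i\<in>{..<n}. Zp_of_int p (a i)) = a"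
    proof
      fix i
      show "red_vec K n (\<lambda>i\<in>{..<n}. Zp_of_int p (a i)) i = a i"
        using PiE_mem[OF a, of i] PiE_arb[OF a, of i] by (cases "i < n") (auto simp: red_vec_def Zp_of_int_def)
    qed
    ultimately show "a \<in> red_vec K n ` carrier (Zp_vec p n)" by (metis image_eqI)
  qed
qed

lemma Zp_vec_divisible:
  assumes y: "y \<in> carrier (Zp_vec p n)" and 0: "\<And>i. i < n \<Longrightarrow> y i K = 0"
  shows "\<exists>z\<in>carrier (Zp_vec p n). y = z [^]\<^bsub>Zp_vec p n\<^esub> (p ^ K)"
proof -
  interpret comm_group "Zp_vec p n" by (rule comm_group_Zp_vec)
  \<comment> \<open>Division by p^K costs K digits of precision: level l of the quotient is read off
    level K + l of y.\<close>
  define z where "z = (\<lambda>i\<in>{..<n}. \<lambda>l. y i (K + l) div int p ^ K)"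
  have yK: "y i (K + l) = int p ^ K * (y i (K + l) div int p ^ K)" if "i < n" for i l
    using Zp_carrier_mod[OF Zp_vec_entry[OF y that], of K l] 0[OF that] by (simp add: mod_eq_0_iff_dvd)
  have zc: "z \<in> carrier (Zp_vec p n)"
    unfolding carrier_Zp_vec
  proof (rule PiE_I)
    fix i assume i: "i \<in> {..<n}"
    then have yi: "y i \<in> Zp_carrier p" using Zp_vec_entry[OF y] by simp
    have pK: "int p ^ K > 0" using p2 by simp
    show "z i \<in> Zp_carrier p" unfolding Zp_carrier_def mem_Collect_eq
    proof (intro conjI allI)
      fix l
      have b: "0 \<le> y i (K + l)" "y i (K + l) < int p ^ K * int p ^ l"
        using yi by (auto simp: Zp_carrier_def power_add[symmetric])
      have "int p ^ K * (y i (K + l) div int p ^ K) < int p ^ K * int p ^ l"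
        using b yK[of i l] i by simp
      then have "y i (K + l) div int p ^ K < int p ^ l" using pK by simp
      then show "z i l \<in> {0..<int p ^ l}" using b pK i by (simp add: z_def pos_imp_zdiv_nonneg_iff)
      have "int p ^ K * ((y i (K + Suc l) div int p ^ K) mod int p ^ l)
         = (int p ^ K * (y i (K + Suc l) div int p ^ K)) mod (int p ^ K * int p ^ l)"
        by (rule mult_mod_right)
      also have "\<dots> = y i (K + l)"
        using yK[of i "Suc l"] i Zp_carrier_Suc_mod[OF yi, of "K + l"] by (simp add: power_add)
      also have "\<dots> = int p ^ K * (y i (K + l) div int p ^ K)" using yK i by simp
      finally show "z i (Suc l) mod int p ^ l = z i l" using p2 i by (simp add: z_def)
    qed
  qed (simp add: z_def)
  have "y = z [^]\<^bsub>Zp_vec p n\<^esub> (p ^ K)"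
  proof (rule Zp_vec_eqI[OF y nat_pow_closed[OF zc]])
    fix i l assume i: "i < n"
    have "(z [^]\<^bsub>Zp_vec p n\<^esub> (p ^ K)) i l = (int p ^ K * (y i (K + l) div int p ^ K)) mod int p ^ l"
      unfolding pow_Zp_vec[OF zc i] using i by (simp add: z_def)
    also have "\<dots> = y i (l + K) mod int p ^ l" using yK[OF i, of l] by (simp add: add.commute)
    also have "\<dots> = y i l" by (rule Zp_carrier_mod[OF Zp_vec_entry[OF y i]])
    finally show "y i l = (z [^]\<^bsub>Zp_vec p n\<^esub> (p ^ K)) i l" by simp
  qed
  then show ?thesis using zc by blast
qed

end

section \<open>Comparison of the p-adic cokernel with its reduction\<close>

context
  fixes p :: nat assumes p2: "p > 1"
begin

text \<open>Modulo p^K a p-adic scalar acts through its residue, a natural number. The Z_p-span of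
  the columns therefore reduces to the subgroup generated by the reduced columns.\<close>

lemma red_vec_Zp_mat_vec:
  assumes M: "M \<in> carrier (Zp_mat p n c)"
  shows "red_vec K n ` (Zp_mat_vec p n c M ` carrier (Zp_vec p c)) = generate (Zmod_vec (p ^ K) n) (set (red_cols K n c M))"
proof -
  let ?A = "Zmod_vec (p ^ K) n" and ?col = "\<lambda>j. \<lambda>i\<in>{..<n}. M (i, j) K"
  have q0: "p ^ K > 0" using p2 by simp
  interpret A: comm_group ?A by (rule comm_group_Zmod_vec)
  interpret N: comm_group "Zp_vec p n" by (rule comm_group_Zp_vec[OF p2])
  interpret C: comm_group "Zp_vec p c" by (rule comm_group_Zp_vec[OF p2])
  interpret h: group_hom "Zp_vec p c" ?A "\<lambda>v. red_vec K n (Zp_mat_vec p n c M v)"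
    using Group.hom_compose[OF Zp_mat_vec_hom[OF p2 M] red_vec_hom[OF p2]] C.is_group A.is_group
    by (simp add: group_hom_def group_hom_axioms_def o_def)
  have entry: "red_vec K n (Zp_mat_vec p n c M v) = (\<lambda>i\<in>{..<n}. (\<Sum>j<c. M (i, j) K * v j K) mod int p ^ K)"
    if "v \<in> carrier (Zp_vec p c)" for v
    using Zp_mat_vec_entry[OF p2 M that] by (auto simp: red_vec_def fun_eq_iff)
  have col: "?col j \<in> carrier ?A" if "j < c" for j
    unfolding carrier_Zmod_vec[OF q0]
  proof (rule PiE_I)
    show "?col j i \<in> {0..<int (p ^ K)}" if "i \<in> {..<n}" for i
      using Zp_mat_entry[OF p2 M, of i j] that \<open>j < c\<close> by (simp add: Zp_carrier_def)
  qed simp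
  have cols: "set (red_cols K n c M) = ?col ` {..<c}" by (auto simp: red_cols_def)
  have colsub: "?col ` {..<c} \<subseteq> carrier ?A" using col by blast
  let ?G = "generate ?A (?col ` {..<c})"
  have S: "subgroup ?G ?A" by (rule A.generate_is_subgroup[OF colsub])
  have "(\<lambda>v. red_vec K n (Zp_mat_vec p n c M v)) ` carrier (Zp_vec p c) = ?G"
  proof
    show "(\<lambda>v. red_vec K n (Zp_mat_vec p n c M v)) ` carrier (Zp_vec p c) \<subseteq> ?G"
    proof
      fix x assume "x \<in> (\<lambda>v. red_vec K n (Zp_mat_vec p n c M v)) ` carrier (Zp_vec p c)"
      then obtain v where v: "v \<in> carrier (Zp_vec p c)" "x = red_vec K n (Zp_mat_vec p n c M v)" by blast
      have "(\<lambda>i\<in>{..<n}. (\<Sum>j<d. M (i, j) K * v j K) mod int p ^ K) \<in> ?G" if "d \<le> c" for d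
        using that
      proof (induction d)
        case 0
        have "(\<lambda>i\<in>{..<n}. (\<Sum>j<0::nat. M (i, j) K * v j K) mod int p ^ K) = \<one>\<^bsub>?A\<^esub>" by (auto simp: fun_eq_iff)
        then show ?case by (simp only: generate.one)
      next
        case (Suc d)
        have v0: "0 \<le> v d K" using Zp_vec_entry[OF p2 v(1), of d] Suc.prems by (simp add: Zp_carrier_def)
        have "?col d \<in> ?G" using Suc.prems by (intro generate.incl) auto
        then have "?col d [^]\<^bsub>?A\<^esub> (int (nat (v d K))) \<in> ?G" by (rule A.subgroup_int_pow_closed[OF S])
        then have "?col d [^]\<^bsub>?A\<^esub> (nat (v d K)) \<in> ?G" by (simp only: int_pow_int)
        then have "(\<lambda>i\<in>{..<n}. (\<Sum>j<d. M (i, j) K * v j K) mod int p ^ K) \<otimes>\<^bsub>?A\<^esub> ?col d [^]\<^bsub>?A\<^esub> (nat (v d K)) \<in> ?G"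
        proof (rule generate.eng[rotated])
          show "(\<lambda>i\<in>{..<n}. (\<Sum>j<d. M (i, j) K * v j K) mod int p ^ K) \<in> ?G"
            by (rule Suc.IH) (use Suc.prems in simp)
        qed
        also have "(\<lambda>i\<in>{..<n}. (\<Sum>j<d. M (i, j) K * v j K) mod int p ^ K) \<otimes>\<^bsub>?A\<^esub> ?col d [^]\<^bsub>?A\<^esub> (nat (v d K))
            = (\<lambda>i\<in>{..<n}. (\<Sum>j<Suc d. M (i, j) K * v j K) mod int p ^ K)"
          unfolding pow_Zmod_vec[OF col[OF Suc_le_lessD[OF Suc.prems]]]
          using v0 by (auto simp: fun_eq_iff mod_simps mult.commute)
        finally show ?case .
      qed
      from this[of c] show "x \<in> ?G" using entry[OF v(1)] v(2) by simp
    qed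
    show "?G \<subseteq> (\<lambda>v. red_vec K n (Zp_mat_vec p n c M v)) ` carrier (Zp_vec p c)"
    proof (rule A.generate_subgroup_incl[OF _ h.img_is_subgroup])
      show "?col ` {..<c} \<subseteq> (\<lambda>v. red_vec K n (Zp_mat_vec p n c M v)) ` carrier (Zp_vec p c)"
      proof
        fix x assume "x \<in> ?col ` {..<c}"
        then obtain j where j: "j < c" "x = ?col j" by blast
        define v where "v = (\<lambda>l\<in>{..<c}. Zp_of_int p (if l = j then 1 else 0))"
        have v: "v \<in> carrier (Zp_vec p c)"
          unfolding carrier_Zp_vec[OF p2] v_def using Zp_of_int_closed[OF p2] by (intro PiE_I) auto
        have "x i = red_vec K n (Zp_mat_vec p n c M v) i" for i
        proof (cases "i < n")
          case True
          have "(\<Sum>l<c. M (i, l) K * v l K) = (\<Sum>l<c. if l = j then M (i, j) K * (1 mod int p ^ K) else 0)"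
            by (intro sum.cong) (auto simp: v_def Zp_of_int_def)
          also have "\<dots> = M (i, j) K * (1 mod int p ^ K)" using j by simp
          finally show ?thesis using True j Zp_carrier_self_mod[OF p2 Zp_mat_entry[OF p2 M True j(1)], of K]
            unfolding entry[OF v] by (simp add: mod_simps)
        next
          case False
          then show ?thesis using j by (simp add: red_vec_def)
        qed
        then show "x \<in> (\<lambda>v. red_vec K n (Zp_mat_vec p n c M v)) ` carrier (Zp_vec p c)" using v by blast
      qed
    qed
  qed
  then show ?thesis by (simp add: image_image cols)
qed

text \<open>Nakayama's lemma for the image of a \<open>p\<close>-adic matrix: successive approximation produces the
  preimage of \<open>p ^ k * x\<close> as a \<open>p\<close>-adically convergent series.\<close>

lemma Zp_mat_vec_image_nakayama:
  assumes M: "M \<in> carrier (Zp_mat p n c)"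
    and approx: "\<And>x. x \<in> carrier (Zp_vec p n) \<Longrightarrow>
      red_vec (Suc k) n (x [^]\<^bsub>Zp_vec p n\<^esub> (p ^ k)) \<in> red_vec (Suc k) n ` (Zp_mat_vec p n c M ` carrier (Zp_vec p c))"
    and x: "x \<in> carrier (Zp_vec p n)"
  shows "x [^]\<^bsub>Zp_vec p n\<^esub> (p ^ k) \<in> Zp_mat_vec p n c M ` carrier (Zp_vec p c)"
proof -
  let ?L = "Zp_vec p n" and ?C = "Zp_vec p c" and ?M = "Zp_mat_vec p n c M"
  interpret L: comm_group ?L by (rule comm_group_Zp_vec[OF p2])
  \<comment> \<open>One round of approximation, p^k x = M v + p^(k+1) y, written as a congruence at
    every level l. The error is p times the vector p^k y, which has the same form as p^k x, so the
    round can be repeated.\<close>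
  have step: "\<exists>v y. v \<in> carrier ?C \<and> y \<in> carrier ?L \<and>
      (\<forall>i<n. \<forall>l. [int p ^ k * x i l = (\<Sum>j<c. M (i, j) l * v j l) + int p ^ Suc k * y i l] (mod int p ^ l))"
    if x: "x \<in> carrier ?L" for x
  proof -
    obtain v where v: "v \<in> carrier ?C" "red_vec (Suc k) n (x [^]\<^bsub>?L\<^esub> (p ^ k)) = red_vec (Suc k) n (?M v)"
      using approx[OF x] by auto
    have Mv: "?M v \<in> carrier ?L" by (rule Zp_mat_vec_closed[OF p2 M v(1)])
    have xk: "x [^]\<^bsub>?L\<^esub> (p ^ k) \<in> carrier ?L" by (rule L.nat_pow_closed[OF x])
    define d where "d = x [^]\<^bsub>?L\<^esub> (p ^ k) \<otimes>\<^bsub>?L\<^esub> inv\<^bsub>?L\<^esub> (?M v)"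
    have d: "d \<in> carrier ?L" unfolding d_def by (intro L.m_closed xk L.inv_closed Mv)
    have "?M v \<otimes>\<^bsub>?L\<^esub> d = x [^]\<^bsub>?L\<^esub> (p ^ k) \<otimes>\<^bsub>?L\<^esub> (?M v \<otimes>\<^bsub>?L\<^esub> inv\<^bsub>?L\<^esub> (?M v))"
      unfolding d_def by (rule L.m_lcomm[OF Mv xk L.inv_closed[OF Mv]])
    then have sum: "?M v \<otimes>\<^bsub>?L\<^esub> d = x [^]\<^bsub>?L\<^esub> (p ^ k)"
      using L.r_inv[OF Mv] L.r_one[OF xk] by (simp only:)
    have entry: "(?M v i l + d i l) mod int p ^ l = (int p ^ k * x i l) mod int p ^ l" if "i < n" for i l
      using fun_cong[OF fun_cong[OF sum, of i], of l] that pow_Zp_vec[OF p2 x that, of "p ^ k" l]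
      by (simp add: mult_Zp_vec[OF p2])
    have d0: "d i (Suc k) = 0" if "i < n" for i
    proof -
      have di: "d i \<in> Zp_carrier p" by (rule Zp_vec_entry[OF p2 d that])
      have "?M v i (Suc k) = (x [^]\<^bsub>?L\<^esub> (p ^ k)) i (Suc k)"
        using fun_cong[OF v(2), of i] that by (simp add: red_vec_def)
      also have "\<dots> = (int p ^ k * x i (Suc k)) mod int p ^ Suc k"
        using pow_Zp_vec[OF p2 x that, of "p ^ k" "Suc k"] by simp
      finally have "[?M v i (Suc k) + d i (Suc k) = ?M v i (Suc k) + 0] (mod int p ^ Suc k)"
        using entry[OF that, of "Suc k"] by (simp add: cong_def)
      then have "[d i (Suc k) = 0] (mod int p ^ Suc k)" by (simp only: cong_add_lcancel)
      then show ?thesis using Zp_carrier_self_mod[OF p2 di, of "Suc k"] by (simp add: cong_def)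
    qed
    obtain y where y: "y \<in> carrier ?L" "d = y [^]\<^bsub>?L\<^esub> (p ^ Suc k)"
      using Zp_vec_divisible[OF p2 d, of "Suc k"] d0 by blast
    have "[int p ^ k * x i l = (\<Sum>j<c. M (i, j) l * v j l) + int p ^ Suc k * y i l] (mod int p ^ l)" if "i < n" for i l
    proof -
      have "d i l = (int p ^ Suc k * y i l) mod int p ^ l"
        unfolding y(2) using pow_Zp_vec[OF p2 y(1) that, of "p ^ Suc k" l] by simp
      then show ?thesis
        using entry[OF that, of l] Zp_mat_vec_entry[OF p2 M v(1) that, of l] by (simp add: cong_def mod_simps)
    qed
    then show ?thesis using v(1) y(1) by blast
  qed
  define P where "P = (\<lambda>x vy. fst vy \<in> carrier ?C \<and> snd vy \<in> carrier ?L \<and>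
    (\<forall>i<n. \<forall>l. [int p ^ k * x i l = (\<Sum>j<c. M (i, j) l * fst vy j l) + int p ^ Suc k * snd vy i l] (mod int p ^ l)))"
  have "\<forall>x\<in>carrier ?L. \<exists>vy. P x vy"
  proof
    fix x assume "x \<in> carrier ?L"
    from step[OF this] obtain v y where "P x (v, y)" unfolding P_def fst_conv snd_conv by blast
    then show "\<exists>vy. P x vy" ..
  qed
  from bchoice[OF this] obtain f where f: "\<And>x. x \<in> carrier ?L \<Longrightarrow> P x (f x)" by blast
  define V Y where "V = (\<lambda>x. fst (f x))" and "Y = (\<lambda>x. snd (f x))"
  have VY: "V x \<in> carrier ?C" "Y x \<in> carrier ?L"
    "i < n \<Longrightarrow> [int p ^ k * x i l = (\<Sum>j<c. M (i, j) l * V x j l) + int p ^ Suc k * Y x i l] (mod int p ^ l)"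
    if "x \<in> carrier ?L" for x i l
    using f[OF that] unfolding P_def V_def Y_def by blast+
  \<comment> \<open>The successive remainders: p^k X_t = M V(X_t) + p * p^k X_(t+1), starting from
    X_0 = x.\<close>
  define X where "X = (\<lambda>t. (Y ^^ t) x)"
  have X: "X t \<in> carrier ?L" for t by (induction t) (auto simp: X_def x VY(2))
  have XS: "X (Suc t) = Y (X t)" for t by (simp add: X_def)
  define S where "S = (\<lambda>T j l. \<Sum>t<T. int p ^ t * V (X t) j l)"
  have approxT: "[int p ^ k * x i l = (\<Sum>j<c. M (i, j) l * S T j l) + int p ^ T * (int p ^ k * X T i l)] (mod int p ^ l)"
    \<comment> \<open>\<open>S\<close> is the T-th partial sum of the series of p^t V(X_t), and the
      last term is the error after T rounds.\<close>
    if i: "i < n" for i l T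
  proof (induction T)
    case 0
    show ?case by (simp add: S_def X_def)
  next
    case (Suc T)
    have "[int p ^ T * (int p ^ k * X T i l) = int p ^ T * ((\<Sum>j<c. M (i, j) l * V (X T) j l) + int p ^ Suc k * X (Suc T) i l)] (mod int p ^ l)"
      unfolding XS by (rule cong_mult[OF cong_refl VY(3)[OF X i]])
    from cong_trans[OF Suc cong_add[OF cong_refl this]]
    have "[int p ^ k * x i l = (\<Sum>j<c. M (i, j) l * S T j l)
        + int p ^ T * ((\<Sum>j<c. M (i, j) l * V (X T) j l) + int p ^ Suc k * X (Suc T) i l)] (mod int p ^ l)" .
    also have "(\<Sum>j<c. M (i, j) l * S T j l) + int p ^ T * ((\<Sum>j<c. M (i, j) l * V (X T) j l) + int p ^ Suc k * X (Suc T) i l)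
        = (\<Sum>j<c. M (i, j) l * S (Suc T) j l) + int p ^ Suc T * (int p ^ k * X (Suc T) i l)"
      by (simp add: S_def sum_distrib_left sum.distrib algebra_simps)
    finally show ?case .
  qed
  \<comment> \<open>Level l of the limit needs only the first l terms, as all later ones are
    divisible by p^l.\<close>
  define w where "w = (\<lambda>j\<in>{..<c}. \<lambda>l. S l j l mod int p ^ l)"
  have w: "w \<in> carrier ?C"
    unfolding carrier_Zp_vec[OF p2]
  proof (rule PiE_I)
    fix j assume j: "j \<in> {..<c}"
    have "(\<lambda>l. S l j l mod int p ^ l) \<in> Zp_carrier p"
    proof (rule Zp_carrierI[OF p2])
      fix l
      have "[S l j (Suc l) = S l j l] (mod int p ^ l)"
        unfolding S_def using Zp_carrier_cong[OF p2 Zp_vec_entry[OF p2 VY(1)[OF X]]] j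
        by (intro cong_sum cong_mult cong_refl) simp
      then have "[S l j (Suc l) + int p ^ l * V (X l) j (Suc l) = S l j l + 0] (mod int p ^ l)"
        by (intro cong_add) (simp_all add: cong_def)
      then show "S (Suc l) j (Suc l) mod int p ^ l = S l j l mod int p ^ l"
        by (simp add: S_def cong_def)
    qed
    then show "w j \<in> Zp_carrier p" using j by (simp add: w_def)
  qed (simp add: w_def)
  have "x [^]\<^bsub>?L\<^esub> (p ^ k) = ?M w"
  proof (rule Zp_vec_eqI[OF p2 L.nat_pow_closed[OF x] Zp_mat_vec_closed[OF p2 M w]])
    fix i l assume i: "i < n"
    have "[(\<Sum>j<c. M (i, j) l * S l j l) + int p ^ l * (int p ^ k * X l i l) = (\<Sum>j<c. M (i, j) l * w j l) + 0] (mod int p ^ l)"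
    proof (rule cong_add)
      show "[(\<Sum>j<c. M (i, j) l * S l j l) = (\<Sum>j<c. M (i, j) l * w j l)] (mod int p ^ l)"
        by (intro cong_sum cong_mult cong_refl) (simp add: w_def cong_def)
    qed (simp add: cong_def)
    from cong_trans[OF approxT[OF i] this]
    show "(x [^]\<^bsub>?L\<^esub> (p ^ k)) i l = ?M w i l"
      unfolding Zp_mat_vec_entry[OF p2 M w i] using pow_Zp_vec[OF p2 x i, of "p ^ k" l] by (simp add: cong_def)
  qed
  then show ?thesis using w by blast
qed

text \<open>Everything hinges on I containing p^k L, where L = Z_p^n and I is the image of M: then I
  also contains the kernel p^(k+1) L of the reduction, and the two quotients agree. If L/I \<cong>
  G, the inclusion holds because |G| annihilates G. If the reduced quotient is G, the same argument
  gives it only modulo p^(k+1), and \<open>Zp_mat_vec_image_nakayama\<close> lifts it.\<close>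

lemma coker_iso_iff:
  assumes M: "M \<in> carrier (Zp_mat p n c)" and G: "group G" "order G = p ^ k"
  shows "coker p n c M \<cong> G \<longleftrightarrow>
    Zmod_vec (p ^ Suc k) n Mod generate (Zmod_vec (p ^ Suc k) n) (set (red_cols (Suc k) n c M)) \<cong> G"
proof -
  let ?L = "Zp_vec p n" and ?A = "Zmod_vec (p ^ Suc k) n" and ?I = "Zp_mat_vec p n c M ` carrier (Zp_vec p c)"
    and ?\<pi> = "red_vec (Suc k) n" and ?W = "generate (Zmod_vec (p ^ Suc k) n) (set (red_cols (Suc k) n c M))"
  interpret L: comm_group ?L by (rule comm_group_Zp_vec[OF p2])
  interpret C: comm_group "Zp_vec p c" by (rule comm_group_Zp_vec[OF p2])
  interpret A: comm_group ?A by (rule comm_group_Zmod_vec)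
  interpret \<pi>: group_hom ?L ?A ?\<pi>
    using red_vec_hom[OF p2] L.is_group A.is_group unfolding group_hom_def group_hom_axioms_def by blast
  interpret M: group_hom "Zp_vec p c" ?L "Zp_mat_vec p n c M"
    using Zp_mat_vec_hom[OF p2 M] L.is_group C.is_group by (simp add: group_hom_def group_hom_axioms_def)
  have I: "subgroup ?I ?L" by (rule M.img_is_subgroup)
  have NI: "?I \<lhd> ?L" by (rule L.subgroup_imp_normal[OF I])
  have WI: "?\<pi> ` ?I = ?W" by (rule red_vec_Zp_mat_vec[OF M])
  have W: "?\<pi> ` ?I \<lhd> ?A" by (rule A.subgroup_imp_normal[OF \<pi>.subgroup_img_is_subgroup[OF I]])
  have iso: "?L Mod ?I \<cong> ?A Mod ?W" if pow: "\<And>x. x \<in> carrier ?L \<Longrightarrow> x [^]\<^bsub>?L\<^esub> (p ^ k) \<in> ?I"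
  proof -
    have "kernel ?L ?A ?\<pi> \<subseteq> ?I"
    proof
      fix y assume "y \<in> kernel ?L ?A ?\<pi>"
      then have y: "y \<in> carrier ?L" "?\<pi> y = \<one>\<^bsub>?A\<^esub>" by (simp_all only: kernel_def mem_Collect_eq)
      have "y i (Suc k) = 0" if "i < n" for i
        using fun_cong[OF y(2), of i] that by (simp add: red_vec_def)
      from Zp_vec_divisible[OF p2 y(1) this] obtain z where z: "z \<in> carrier ?L" "y = z [^]\<^bsub>?L\<^esub> (p ^ Suc k)" by blast
      have "y = (z [^]\<^bsub>?L\<^esub> p) [^]\<^bsub>?L\<^esub> (p ^ k)" using z by (simp add: L.nat_pow_pow)
      then show "y \<in> ?I" using pow[OF L.nat_pow_closed[OF z(1)]] by simp
    qed
    from quotient_iso_of_surjective_hom[OF \<pi>.group_hom_axioms red_vec_onto[OF p2] NI this W]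
    show ?thesis unfolding WI .
  qed
  have QA: "group (?A Mod ?W)" using normal.factorgroup_is_group[OF W] unfolding WI .
  have QL: "group (?L Mod ?I)" by (rule normal.factorgroup_is_group[OF NI])
  show ?thesis
  proof
    assume *: "coker p n c M \<cong> G"
    then have "?L Mod ?I \<cong> G" by (simp add: coker_def)
    from iso[OF pow_order_in_quotient_kernel[OF L.is_group G(1) NI this, unfolded G(2)]]
    have "?A Mod ?W \<cong> ?L Mod ?I" by (rule group.iso_sym[OF QL])
    then show "?A Mod ?W \<cong> G" using \<open>?L Mod ?I \<cong> G\<close> by (rule iso_trans)
  next
    assume *: "?A Mod ?W \<cong> G"
    have "x [^]\<^bsub>?L\<^esub> (p ^ k) \<in> ?I" if "x \<in> carrier ?L" for x
    proof (rule Zp_mat_vec_image_nakayama[OF M _ that])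
      fix x assume x: "x \<in> carrier ?L"
      have "?\<pi> (x [^]\<^bsub>?L\<^esub> (p ^ k)) = ?\<pi> x [^]\<^bsub>?A\<^esub> (p ^ k)" by (rule \<pi>.hom_nat_pow[OF x])
      also have "\<dots> \<in> ?W"
        using pow_order_in_quotient_kernel[OF A.is_group G(1) W[unfolded WI] *, of "?\<pi> x"] \<pi>.hom_closed[OF x]
        unfolding G(2) by blast
      finally show "?\<pi> (x [^]\<^bsub>?L\<^esub> (p ^ k)) \<in> ?\<pi> ` ?I" unfolding WI .
    qed
    then have "?L Mod ?I \<cong> ?A Mod ?W" by (rule iso)
    then show "coker p n c M \<cong> G" unfolding coker_def using * by (rule iso_trans)
  qed
qed

end

section \<open>Haar measure\<close>

lemma topspace_Zp_topology: "topspace (Zp_topology p) = Zp_carrier p"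
  by (auto simp: Zp_topology_def Zp_carrier_def)

lemma openin_Zp_topology_residue:
  assumes "v \<in> {0..<int p ^ K}"
  shows "openin (Zp_topology p) {x \<in> Zp_carrier p. x K = v}"
proof -
  let ?T = "product_topology (\<lambda>k. discrete_topology {0..<int p ^ k}) UNIV"
  have "continuous_map ?T (discrete_topology {0..<int p ^ K}) (\<lambda>x. x K)"
    by (rule continuous_map_product_projection) simp
  then have "openin ?T {x \<in> topspace ?T. x K \<in> {v}}"
    by (rule openin_continuous_map_preimage) (use assms in simp)
  moreover have "{x \<in> Zp_carrier p. x K = v} = {x \<in> topspace ?T. x K \<in> {v}} \<inter> Zp_carrier p"
    by (auto simp: Zp_carrier_def)
  ultimately show ?thesis unfolding Zp_topology_def openin_subtopology by blast
qed

text \<open>For a table of residues this is a coset of the matrices divisible by p^K. These finitely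
  many cosets are the only sets on which the Haar measure has to be known.\<close>

definition mat_fibre :: "nat \<Rightarrow> nat \<Rightarrow> nat \<Rightarrow> nat \<Rightarrow> (nat \<times> nat \<Rightarrow> int) \<Rightarrow> (nat \<times> nat \<Rightarrow> nat \<Rightarrow> int) set" where
  "mat_fibre p K n c a = {M \<in> carrier (Zp_mat p n c). \<forall>z\<in>{..<n} \<times> {..<c}. M z K = a z}"

lemma mat_fibre_translate:
  assumes p2: "p > 1" and a: "a \<in> {..<n} \<times> {..<c} \<rightarrow>\<^sub>E {0..<int p ^ K}"
  shows "\<exists>g\<in>carrier (Zp_mat p n c). mat_fibre p K n c a = (\<lambda>x. g \<otimes>\<^bsub>Zp_mat p n c\<^esub> x) ` mat_fibre p K n c (\<lambda>_. 0)"
proof -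
  let ?R = "Zp_mat p n c" and ?I = "{..<n} \<times> {..<c}"
  interpret comm_group ?R
    unfolding Zp_mat_def
    by (rule comm_group_product_group) (rule abelian_group.a_comm_group[OF abelian_group_Zp[OF p2]])
  have mult: "(x \<otimes>\<^bsub>?R\<^esub> y) z k = (x z k + y z k) mod int p ^ k" if "z \<in> ?I" for x y z k
    using that by (simp add: Zp_mat_def Zp_simps[OF p2])
  define g where "g = (\<lambda>z\<in>?I. Zp_of_int p (a z))"
  have g: "g \<in> carrier ?R"
    unfolding carrier_Zp_mat[OF p2] g_def using Zp_of_int_closed[OF p2] by (intro PiE_I) auto
  have gK: "g z K = a z" if "z \<in> ?I" for z
    using PiE_mem[OF a that] that by (simp add: g_def Zp_of_int_def)
  have "mat_fibre p K n c a = (\<lambda>x. g \<otimes>\<^bsub>?R\<^esub> x) ` mat_fibre p K n c (\<lambda>_. 0)"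
  proof (intro equalityI subsetI)
    fix M assume M: "M \<in> mat_fibre p K n c a"
    then have Mc: "M \<in> carrier ?R" by (simp add: mat_fibre_def)
    define x where "x = inv\<^bsub>?R\<^esub> g \<otimes>\<^bsub>?R\<^esub> M"
    have xc: "x \<in> carrier ?R" unfolding x_def by (intro m_closed inv_closed g Mc)
    have gx: "g \<otimes>\<^bsub>?R\<^esub> x = M"
      unfolding x_def m_assoc[OF g inv_closed[OF g] Mc, symmetric] r_inv[OF g] by (rule l_one[OF Mc])
    have "x z K = 0" if z: "z \<in> ?I" for z
    proof -
      have xz: "x z \<in> Zp_carrier p" by (rule PiE_mem[OF xc[unfolded carrier_Zp_mat[OF p2]] z])
      have "(a z + x z K) mod int p ^ K = M z K" using mult[OF z, of g x K] gx gK[OF z] by simp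
      also have "\<dots> = a z" using M z unfolding mat_fibre_def by blast
      finally have "[a z + x z K = a z + 0] (mod int p ^ K)"
        using PiE_mem[OF a z] by (simp add: cong_def)
      then have "[x z K = 0] (mod int p ^ K)" by (simp only: cong_add_lcancel)
      then show ?thesis using Zp_carrier_self_mod[OF p2 xz, of K] by (simp add: cong_def)
    qed
    then have "x \<in> mat_fibre p K n c (\<lambda>_. 0)" using xc unfolding mat_fibre_def by blast
    then show "M \<in> (\<lambda>x. g \<otimes>\<^bsub>?R\<^esub> x) ` mat_fibre p K n c (\<lambda>_. 0)" using gx by blast
  next
    fix M assume "M \<in> (\<lambda>x. g \<otimes>\<^bsub>?R\<^esub> x) ` mat_fibre p K n c (\<lambda>_. 0)"
    then obtain x where x: "x \<in> mat_fibre p K n c (\<lambda>_. 0)" "M = g \<otimes>\<^bsub>?R\<^esub> x" by blast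
    have xc: "x \<in> carrier ?R" "\<forall>z\<in>?I. x z K = 0" using x(1) unfolding mat_fibre_def by blast+
    have "M z K = a z" if z: "z \<in> ?I" for z
      unfolding x(2) mult[OF z] gK[OF z] using bspec[OF xc(2) z] PiE_mem[OF a z] by simp
    then show "M \<in> mat_fibre p K n c a" unfolding mat_fibre_def x(2) using m_closed[OF g xc(1)] by blast
  qed
  then show ?thesis using g by blast
qed

text \<open>The fibres are open, pairwise disjoint, cover the group and are translates of one
  another, so invariance and total mass 1 give each of them the measure p^(-Knc).\<close>

lemma haar_measure_mat_fibres:
  assumes p2: "p > 1" and haar: "normalized_haar_measure (Zp_mat p n c) (Zp_mat_topology p n c) \<mu>"
    and S: "S \<subseteq> {..<n} \<times> {..<c} \<rightarrow>\<^sub>E {0..<int p ^ K}"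
  shows "(\<Union>a\<in>S. mat_fibre p K n c a) \<in> sets \<mu>"
    "measure \<mu> (\<Union>a\<in>S. mat_fibre p K n c a) = real (card S) / (real p ^ K) ^ (n * c)"
proof -
  let ?R = "Zp_mat p n c" and ?I = "{..<n} \<times> {..<c}" and ?T = "Zp_mat_topology p n c"
  let ?V = "?I \<rightarrow>\<^sub>E {0..<int p ^ K}" and ?F = "mat_fibre p K n c"
  interpret prob_space \<mu> using haar by (simp add: normalized_haar_measure_def)
  have top: "topspace ?T = carrier ?R"
    by (simp add: Zp_mat_topology_def topspace_Zp_topology carrier_Zp_mat[OF p2])
  have sub: "{U. openin ?T U} \<subseteq> Pow (topspace ?T)" by (auto dest: openin_subset)
  have sets: "sets \<mu> = sets (sigma (topspace ?T) {U. openin ?T U})"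
    using haar by (simp add: normalized_haar_measure_def)
  have space: "space \<mu> = carrier ?R"
    using sets_eq_imp_space_eq[OF sets] sub by (simp add: top)
  have F_sets: "?F a \<in> sets \<mu>" if a: "a \<in> ?V" for a
  proof -
    have "?F a = (\<Pi>\<^sub>E z\<in>?I. {x \<in> Zp_carrier p. x K = a z})"
      unfolding mat_fibre_def carrier_Zp_mat[OF p2] by (rule Set.set_eqI) (unfold mem_Collect_eq PiE_iff, blast)
    moreover have "openin ?T (\<Pi>\<^sub>E z\<in>?I. {x \<in> Zp_carrier p. x K = a z})"
      unfolding Zp_mat_topology_def openin_PiE_gen
      using openin_Zp_topology_residue[OF PiE_mem[OF a]] by (auto intro: finite_subset[of _ ?I])
    ultimately have "?F a \<in> {U. openin ?T U}" by simp
    then show ?thesis unfolding sets sets_measure_of[OF sub] by (rule sigma_sets.Basic)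
  qed
  have finV: "finite ?V" by (intro finite_PiE) auto
  have finS: "finite S" by (rule finite_subset[OF S finV])
  have cardV: "real (card ?V) = (real p ^ K) ^ (n * c)" by (simp add: card_PiE)
  have disj: "disjoint_family_on ?F A" if "A \<subseteq> ?V" for A
    unfolding disjoint_family_on_def
  proof (intro ballI impI)
    fix a b assume ab: "a \<in> A" "b \<in> A" "a \<noteq> b"
    show "?F a \<inter> ?F b = {}"
    proof (rule ccontr)
      assume "?F a \<inter> ?F b \<noteq> {}"
      then obtain M where M: "\<forall>z\<in>?I. M z K = a z" "\<forall>z\<in>?I. M z K = b z" unfolding mat_fibre_def by blast
      have "a = b" by (rule PiE_ext[of a ?I "\<lambda>_. {0..<int p ^ K}" b]) (use ab that M in auto)
      then show False using ab by simp
    qed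
  qed
  have F_eq: "measure \<mu> (?F a) = measure \<mu> (?F (\<lambda>_. 0))" if a: "a \<in> ?V" for a
  proof -
    \<comment> \<open>The fibre depends only on the table inside the index set, so the constant 0
      can be traded for its restriction, which belongs to the tables whose fibres are known to be
      measurable.\<close>
    define z0 where "z0 = (\<lambda>z\<in>?I. 0::int)"
    have z0: "z0 \<in> ?V" using p2 by (auto simp: z0_def)
    have eq: "?F (\<lambda>_. 0) = ?F z0" unfolding mat_fibre_def z0_def by auto
    obtain g where g: "g \<in> carrier ?R" "?F a = (\<lambda>x. g \<otimes>\<^bsub>?R\<^esub> x) ` ?F (\<lambda>_. 0)"
      using mat_fibre_translate[OF p2 a] by blast
    have "emeasure \<mu> (?F a) = emeasure \<mu> (?F (\<lambda>_. 0))"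
      using haar g(1) F_sets[OF z0] unfolding g(2) eq normalized_haar_measure_def by blast
    then show ?thesis by (simp add: measure_def)
  qed
  have sum: "measure \<mu> (\<Union>a\<in>A. ?F a) = real (card A) * measure \<mu> (?F (\<lambda>_. 0))" if A: "A \<subseteq> ?V" for A
  proof -
    have "measure \<mu> (\<Union>a\<in>A. ?F a) = (\<Sum>a\<in>A. measure \<mu> (?F a))"
      using F_sets A by (intro finite_measure_finite_Union[OF finite_subset[OF A finV] _ disj[OF A]]) blast
    also have "\<dots> = (\<Sum>a\<in>A. measure \<mu> (?F (\<lambda>_. 0)))" using F_eq A by (intro sum.cong) auto
    finally show ?thesis by simp
  qed
  have "(\<Union>a\<in>?V. ?F a) = carrier ?R"
  proof
    show "carrier ?R \<subseteq> (\<Union>a\<in>?V. ?F a)"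
    proof
      fix M assume M: "M \<in> carrier ?R"
      have "(\<lambda>z\<in>?I. M z K) \<in> ?V"
      proof (rule PiE_I)
        show "(\<lambda>z\<in>?I. M z K) z \<in> {0..<int p ^ K}" if "z \<in> ?I" for z
          using PiE_mem[OF M[unfolded carrier_Zp_mat[OF p2]] that] that by (simp add: Zp_carrier_def)
      qed simp
      moreover have "M \<in> ?F (\<lambda>z\<in>?I. M z K)" unfolding mat_fibre_def using M by simp
      ultimately show "M \<in> (\<Union>a\<in>?V. ?F a)" by blast
    qed
  qed (auto simp: mat_fibre_def)
  then have "1 = (real p ^ K) ^ (n * c) * measure \<mu> (?F (\<lambda>_. 0))"
    using sum[OF order_refl] prob_space unfolding cardV space by simp
  then have "measure \<mu> (?F (\<lambda>_. 0)) = 1 / (real p ^ K) ^ (n * c)" using p2 by (simp add: field_simps)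
  then show "measure \<mu> (\<Union>a\<in>S. ?F a) = real (card S) / (real p ^ K) ^ (n * c)" using sum[OF S] by simp
  show "(\<Union>a\<in>S. ?F a) \<in> sets \<mu>" using finS S F_sets by (intro sets.finite_UN) auto
qed

text \<open>By \<open>coker_iso_iff\<close> the event is a union of fibres modulo p^(k+1). This
  yields measurability and turns the measure into a proportion of residue tables, which are then
  read column by column as lists.\<close>

lemma measure_coker:
  assumes p2: "p > 1" and haar: "normalized_haar_measure (Zp_mat p n c) (Zp_mat_topology p n c) \<mu>"
    and G: "group G" "order G = p ^ k" and q: "q = p ^ Suc k"
  shows "{M \<in> carrier (Zp_mat p n c). coker p n c M \<cong> G} \<in> sets \<mu>"
    "measure \<mu> {M \<in> carrier (Zp_mat p n c). coker p n c M \<cong> G}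
      = real (card (coker_lists (Zmod_vec q n) G c)) / (real q ^ n) ^ c"
proof -
  let ?V = "{..<n} \<times> {..<c} \<rightarrow>\<^sub>E {0..<int p ^ Suc k}" and ?X = "coker_lists (Zmod_vec q n) G c"
  have q0: "q > 0" using p2 by (simp add: q)
  have iq: "int p ^ Suc k = int q" by (simp add: q)
  define cols where "cols = (\<lambda>a :: nat \<times> nat \<Rightarrow> int. map (\<lambda>j. \<lambda>i\<in>{..<n}. a (i, j)) [0..<c])"
  define S where "S = {a \<in> ?V. cols a \<in> ?X}"
  have red: "red_cols (Suc k) n c M = cols a" if "M \<in> mat_fibre p (Suc k) n c a" for M a
    using that by (auto simp: red_cols_def cols_def mat_fibre_def fun_eq_iff)
  have colsV: "set (cols a) \<subseteq> carrier (Zmod_vec q n)" if a: "a \<in> ?V" for a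
  proof
    fix x assume "x \<in> set (cols a)"
    then obtain j where j: "j < c" "x = (\<lambda>i\<in>{..<n}. a (i, j))" by (auto simp: cols_def)
    have "a (i, j) \<in> {0..<int q}" if "i < n" for i using PiE_mem[OF a, of "(i, j)"] that j(1) unfolding iq by simp
    then show "x \<in> carrier (Zmod_vec q n)" unfolding carrier_Zmod_vec[OF q0] j(2) by (intro PiE_I) auto
  qed
  have E: "{M \<in> carrier (Zp_mat p n c). coker p n c M \<cong> G} = (\<Union>a\<in>S. mat_fibre p (Suc k) n c a)"
  proof (intro equalityI subsetI)
    fix M assume M: "M \<in> {M \<in> carrier (Zp_mat p n c). coker p n c M \<cong> G}"
    then have Mc: "M \<in> carrier (Zp_mat p n c)" by simp
    define a where "a = (\<lambda>z\<in>{..<n} \<times> {..<c}. M z (Suc k))"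
    have aV: "a \<in> ?V"
    proof (rule PiE_I)
      show "a z \<in> {0..<int p ^ Suc k}" if "z \<in> {..<n} \<times> {..<c}" for z
        using PiE_mem[OF Mc[unfolded carrier_Zp_mat[OF p2]] that] that unfolding a_def Zp_carrier_def by (simp del: power_Suc)
    qed (simp add: a_def)
    have Ma: "M \<in> mat_fibre p (Suc k) n c a" using Mc unfolding mat_fibre_def a_def by simp
    have "Zmod_vec q n Mod generate (Zmod_vec q n) (set (cols a)) \<cong> G"
      using coker_iso_iff[OF p2 Mc G] M unfolding red[OF Ma] q by blast
    then have "cols a \<in> ?X" using colsV[OF aV] by (simp add: cols_def)
    then show "M \<in> (\<Union>a\<in>S. mat_fibre p (Suc k) n c a)" using aV Ma unfolding S_def by blast
  next
    fix M assume "M \<in> (\<Union>a\<in>S. mat_fibre p (Suc k) n c a)"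
    then obtain a where a: "a \<in> ?V" "cols a \<in> ?X" "M \<in> mat_fibre p (Suc k) n c a" unfolding S_def by blast
    have Mc: "M \<in> carrier (Zp_mat p n c)" using a(3) unfolding mat_fibre_def by blast
    have "coker p n c M \<cong> G"
      using coker_iso_iff[OF p2 Mc G] a(2) unfolding red[OF a(3)] q by blast
    then show "M \<in> {M \<in> carrier (Zp_mat p n c). coker p n c M \<cong> G}" using Mc by blast
  qed
  have "bij_betw cols S ?X"
    unfolding bij_betw_def
  proof
    show "inj_on cols S"
    proof (rule inj_onI)
      fix a b assume ab: "a \<in> S" "b \<in> S" "cols a = cols b"
      have V: "a \<in> ?V" "b \<in> ?V" using ab unfolding S_def by blast+
      have "a (i, j) = b (i, j)" if "i < n" "j < c" for i j
      proof -
        have "cols a ! j = cols b ! j" using ab by simp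
        then have "(\<lambda>i\<in>{..<n}. a (i, j)) = (\<lambda>i\<in>{..<n}. b (i, j))" using that by (simp add: cols_def)
        from fun_cong[OF this, of i] show ?thesis using that by simp
      qed
      then show "a = b" by (intro PiE_ext[OF V]) auto
    qed
    show "cols ` S = ?X"
    proof (intro equalityI subsetI)
      fix xs assume xs: "xs \<in> ?X"
      define a where "a = (\<lambda>z\<in>{..<n} \<times> {..<c}. (xs ! snd z) (fst z))"
      have xsj: "xs ! j \<in> {..<n} \<rightarrow>\<^sub>E {0..<int q}" if "j < c" for j
        using xs that nth_mem[of j xs] unfolding carrier_Zmod_vec[OF q0, symmetric] by blast
      have aV: "a \<in> ?V"
      proof (rule PiE_I)
        fix z assume z: "z \<in> {..<n} \<times> {..<c}"
        then have "(xs ! snd z) (fst z) \<in> {0..<int q}" by (intro PiE_mem[OF xsj]) auto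
        then show "a z \<in> {0..<int p ^ Suc k}" using z unfolding a_def iq by simp
      qed (simp add: a_def)
      have "cols a = xs"
      proof (rule nth_equalityI)
        show "length (cols a) = length xs" using xs by (simp add: cols_def)
        fix j assume "j < length (cols a)"
        then have j: "j < c" by (simp add: cols_def)
        have "cols a ! j = (\<lambda>i\<in>{..<n}. a (i, j))" using j by (simp add: cols_def)
        also have "\<dots> = (\<lambda>i\<in>{..<n}. (xs ! j) i)" using j by (auto simp: a_def fun_eq_iff)
        also have "\<dots> = xs ! j" using xsj[OF j] by (rule PiE_restrict)
        finally show "cols a ! j = xs ! j" .
      qed
      then show "xs \<in> cols ` S" using aV xs unfolding S_def by blast
    qed (auto simp only: S_def)
  qed
  then have cardS: "card S = card ?X" by (rule bij_betw_same_card)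
  have SV: "S \<subseteq> ?V" unfolding S_def by blast
  show "{M \<in> carrier (Zp_mat p n c). coker p n c M \<cong> G} \<in> sets \<mu>"
    unfolding E by (rule haar_measure_mat_fibres(1)[OF p2 haar SV])
  have "(real p ^ Suc k) ^ (n * c) = (real q ^ n) ^ c" by (simp only: q of_nat_power power_mult)
  then show "measure \<mu> {M \<in> carrier (Zp_mat p n c). coker p n c M \<cong> G} = real (card ?X) / (real q ^ n) ^ c"
    unfolding E haar_measure_mat_fibres(2)[OF p2 haar SV] cardS by (simp only:)
qed

text \<open>Under j = n + m - i the factors become 1 - p^(-j) with m < j \<le> n + m.\<close>

lemma prod_eq_eta_ratio:
  assumes p2: "p \<ge> 2"
  shows "(\<Prod>i<n. 1 - real p ^ i / real p ^ (n + m)) = eta p (enat (n + m)) / eta p (enat m)"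
proof (induction n)
  case 0
  show ?case using eta_enat_pos[OF p2, of m] by simp
next
  case (Suc n)
  have "(\<Prod>i<Suc n. 1 - real p ^ i / real p ^ (Suc n + m)) = (1 - 1 / real p ^ Suc (n + m)) * (\<Prod>i<n. 1 - real p ^ i / real p ^ (n + m))"
    unfolding prod.lessThan_Suc_shift using p2 by simp
  then show ?case unfolding Suc by (simp add: eta_Suc)
qed

lemma order_AutoGroup_pos:
  assumes "group G" "finite (carrier G)"
  shows "order (AutoGroup G) > 0"
proof -
  have "auto G \<subseteq> carrier G \<rightarrow>\<^sub>E carrier G" by (auto simp: auto_def hom_def Bij_def PiE_def)
  then have "finite (auto G)" using assms(2) finite_PiE[of "carrier G" "\<lambda>_. carrier G"] by (metis finite_subset)
  moreover have "auto G \<noteq> {}" using group.id_in_auto[OF assms(1)] by blast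
  ultimately show ?thesis by (simp add: order_def AutoGroup_def card_gt_0_iff)
qed

theorem theorem4:
  fixes p m n :: nat
    and \<mu> :: "(nat \<times> nat \<Rightarrow> nat \<Rightarrow> int) measure"
    and G :: "('a, 'b) monoid_scheme"
  assumes "prime p"
    and "n \<ge> 1"
    and "normalized_haar_measure (Zp_mat p n (n + m)) (Zp_mat_topology p n (n + m)) \<mu>"
    and "finite_abelian_p_group p G"
  shows "{M \<in> carrier (Zp_mat p n (n + m)). coker p n (n + m) M \<cong> G} \<in> sets \<mu> \<and>
    \<bar>measure \<mu> {M \<in> carrier (Zp_mat p n (n + m)). coker p n (n + m) M \<cong> G}
        - (w_coeff p m G + lambda_coeff p m G / real p ^ n)\<bar>
      \<le> sqrt ((eta p (enat m))\<^sup>2 / (eta p \<infinity>)\<^sup>2 - 1) / real p ^ (2 * n)"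
proof -
  obtain k where G: "comm_group G" "finite (carrier G)" "order G = p ^ k"
    using assms(4) by (auto simp: finite_abelian_p_group_def)
  interpret G: comm_group G by fact
  have p2: "p \<ge> 2" and p1: "p > 1" using assms(1) prime_ge_2_nat prime_gt_1_nat by blast+
  define r where "r = p_rank p G"
  define q where "q = p ^ Suc k"
  define v where "v = 1 / (real (order G) ^ m * real (order (AutoGroup G)))"
  have r: "order G = p ^ r * card (pth_powers p G)" unfolding r_def by (rule order_eq_p_rank[OF assms(1) G(1,2)])
  have pos: "0 < real (order G)" "0 < real (order (AutoGroup G))" "0 < real q"
    using order_AutoGroup_pos[OF G.is_group G(2)] p1 by (auto simp: G(3) q_def)
  note counts = card_coker_lists[OF assms(1) G r q_def]
  \<comment> \<open>Stated for every N because it is used twice: N = n gives the measure in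
    question, and N = r gives the bound \<open>hyp\<close> on v.\<close>
  have prob: "real (card (coker_lists (Zmod_vec q N) G (N + m))) / (real q ^ N) ^ (N + m)
    = v * ((\<Prod>i<r. 1 - real p ^ i / real p ^ N) * (eta p (enat (N + m)) / eta p (enat m)))" for N
  proof -
    have "x / Q = 1 / (g ^ m * a) * (P * E)"
      if "x * (a * g ^ (N + m)) = Q * (g ^ N * P) * E" "a > 0" "g > 0" "Q > 0" for x Q g a P E :: real
      using that by (simp add: field_simps power_add)
    from this[OF counts(1)[where n = N and c = "N + m"]] show ?thesis
      using pos unfolding v_def prod_eq_eta_ratio[OF p2] by simp
  qed
  have hyp: "v * (eta p (enat r) * eta p (enat (r + m)) / eta p (enat m)) \<le> 1 / real p ^ (r * (r + m))"
  proof -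
    have "(\<Prod>i<r. 1 - real p ^ i / real p ^ r) = eta p (enat r)"
      using prod_eq_eta_ratio[OF p2, of r 0] by (simp add: eta_0)
    then have "v * (eta p (enat r) * eta p (enat (r + m)) / eta p (enat m))
        = real (card (coker_lists (Zmod_vec q r) G (r + m))) / (real q ^ r) ^ (r + m)"
      using prob[of r] by simp
    also have "\<dots> \<le> 1 / (real p ^ r) ^ (r + m)"
    proof -
      have "real (card (coker_lists (Zmod_vec q r) G (r + m)) * (p ^ r) ^ (r + m)) \<le> real ((q ^ r) ^ (r + m))"
        using counts(2)[where c = "r + m"] by (simp only: of_nat_le_iff)
      then have "real (card (coker_lists (Zmod_vec q r) G (r + m))) * (real p ^ r) ^ (r + m) \<le> (real q ^ r) ^ (r + m)"
        by (simp only: of_nat_mult of_nat_power)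
      moreover have "0 < (real q ^ r) ^ (r + m)" "0 < (real p ^ r) ^ (r + m)" using pos p1 by simp_all
      ultimately show ?thesis by (simp add: field_simps)
    qed
    finally show ?thesis by (simp add: power_mult)
  qed
  have v: "v > 0" using pos by (simp add: v_def)
  have w: "w_coeff p m G = eta p \<infinity> / eta p (enat m) * v" by (simp add: w_coeff_def v_def)
  have measure: "measure \<mu> {M \<in> carrier (Zp_mat p n (n + m)). coker p n (n + m) M \<cong> G}
      = v * ((\<Prod>i<r. 1 - real p ^ i / real p ^ n) * (eta p (enat (n + m)) / eta p (enat m)))"
    unfolding measure_coker(2)[OF p1 assms(3) G.is_group G(3) q_def] by (rule prob)
  show ?thesis
  proof
    show "{M \<in> carrier (Zp_mat p n (n + m)). coker p n (n + m) M \<cong> G} \<in> sets \<mu>"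
      by (rule measure_coker(1)[OF p1 assms(3) G.is_group G(3) q_def])
    show "\<bar>measure \<mu> {M \<in> carrier (Zp_mat p n (n + m)). coker p n (n + m) M \<cong> G}
        - (w_coeff p m G + lambda_coeff p m G / real p ^ n)\<bar>
      \<le> sqrt ((eta p (enat m))\<^sup>2 / (eta p \<infinity>)\<^sup>2 - 1) / real p ^ (2 * n)"
      unfolding measure lambda_coeff_def w r_def[symmetric]
      by (rule expansion_bound[OF p2 assms(2) v hyp])
  qed
qed

end
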